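(* Let $(X,\rho,\mu)$ be a space of homogeneous type and let $T$ be an operator defined on bounded functions with bounded support. Suppose that for some exponents $1\le p_0\le q_0<\infty$ and some $\alpha>0$, $$\|Tf\|_{L^{q_0}(w^{q_0})}\le C[w]_{A_{p_0,q_0}}^\alpha\|f\|_{L^{p_0}(w^{p_0})}$$ for all weights $w\in A_{p_0,q_0}$. Then for all exponents $1<p\le q<\infty$ with $1/p-1/q=1/p_0-1/q_0$ and all $w\in A_{p,q}$, $$\|Tf\|_{L^{q}(w^q)}\le C'[w]_{A_{p,q}}^{\alpha\max\{1,\frac{q_0}{p_0'}\frac{p'}{q}\}}\|f\|_{L^p(w^p)},$$ with $C'$ depending only on $C$, $\alpha$, $p_0,q_0,p,q$ and the space.
   Context: $(X,\rho,\mu)$ is a space of homogeneous type: $\rho$ a quasi-metric with $\rho(x,y)\le A_0(\rho(x,z)+\rho(z,y))$, $A_0\ge1$; balls $B(x,r)=\{y:\rho(x,y)<r\}$; $\mu$ a positive Borel measure with $0<\mu(B(x,2r))\le C_\mu\mu(B(x,r))<\infty$. $L^p(v)=L^p(X,v\,d\mu)$. $p'$ is the dual exponent ($1'=\infty$, $1/\infty=0$). $Mf(x)=\sup_{B\ni x}\frac1{\mu(B)}\int_B|f|d\mu$. For $1<p\le q<\infty$, $[w]_{A_{p,q}}=\sup_B\big(\frac1{\mu(B)}\int_Bw^qd\mu\big)\big(\frac1{\mu(B)}\int_Bw^{-p'}d\mu\big)^{q/p'}$; for $1\le q<\infty$, $[w]_{A_{1,q}}$ is the least $C$ with $M(w^q)\le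 Cw^q$ a.e. *)

theory Defs
  imports "HOL-Analysis.Analysis"
begin

definition qball :: "'a measure \<Rightarrow> ('a \<Rightarrow> 'a \<Rightarrow> real) \<Rightarrow> 'a \<Rightarrow> real \<Rightarrow> 'a set" where
  "qball M \<rho> x r = {y \<in> space M. \<rho> x y < r}"

definition qballs :: "'a measure \<Rightarrow> ('a \<Rightarrow> 'a \<Rightarrow> real) \<Rightarrow> 'a set set" where
  "qballs M \<rho> = {qball M \<rho> x r | x r. x \<in> space M \<and> 0 < r}"

definition homogeneous_type ::
  "'a measure \<Rightarrow> ('a \<Rightarrow> 'a \<Rightarrow> real) \<Rightarrow> real \<Rightarrow> real \<Rightarrow> bool" where
  "homogeneous_type M \<rho> A0 C\<mu> \<longleftrightarrow>
     space M \<noteq> {} \<and> 1 \<le> A0 \<and>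
     (\<forall>x\<in>space M. \<forall>y\<in>space M. 0 \<le> \<rho> x y \<and> (\<rho> x y = 0 \<longleftrightarrow> x = y) \<and> \<rho> x y = \<rho> y x) \<and>
     (\<forall>x\<in>space M. \<forall>y\<in>space M. \<forall>z\<in>space M. \<rho> x y \<le> A0 * (\<rho> x z + \<rho> z y)) \<and>
     (\<forall>x\<in>space M. \<forall>r>0. qball M \<rho> x r \<in> sets M \<and>
        0 < emeasure M (qball M \<rho> x r) \<and>
        emeasure M (qball M \<rho> x (2 * r)) \<le> ennreal C\<mu> * emeasure M (qball M \<rho> x r) \<and>
        emeasure M (qball M \<rho> x (2 * r)) < \<infinity>)"

definition weight :: "'a measure \<Rightarrow> ('a \<Rightarrow> real) \<Rightarrow> bool" where
  "weight M w \<longleftrightarrow> w \<in> borel_measurable M \<and> (AE x in M. 0 < w x)"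

definition avg :: "'a measure \<Rightarrow> 'a set \<Rightarrow> ('a \<Rightarrow> real) \<Rightarrow> real" where
  "avg M B g = (\<integral>x\<in>B. g x \<partial>M) / measure M B"

definition maxfun :: "'a measure \<Rightarrow> ('a \<Rightarrow> 'a \<Rightarrow> real) \<Rightarrow> ('a \<Rightarrow> real) \<Rightarrow> 'a \<Rightarrow> ennreal" where
  "maxfun M \<rho> f x = (SUP B\<in>{B \<in> qballs M \<rho>. x \<in> B}. (\<integral>\<^sup>+y\<in>B. ennreal \<bar>f y\<bar> \<partial>M) / emeasure M B)"

text \<open>Dual exponent, encoded as 1/p' = 1 - 1/p (so 1/1' = 0).\<close>
definition inv_dual :: "real \<Rightarrow> real" where
  "inv_dual p = 1 - 1 / p"

definition in_Apq :: "'a measure \<Rightarrow> ('a \<Rightarrow> 'a \<Rightarrow> real) \<Rightarrow> real \<Rightarrow> real \<Rightarrow> ('a \<Rightarrow> real) \<Rightarrow> bool" where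
  "in_Apq M \<rho> p q w \<longleftrightarrow> weight M w \<and>
     (\<forall>B\<in>qballs M \<rho>. set_integrable M B (\<lambda>x. w x powr q)) \<and>
     (if p = 1 then (\<exists>C. AE x in M. maxfun M \<rho> (\<lambda>y. w y powr q) x \<le> ennreal (C * w x powr q))
      else (\<forall>B\<in>qballs M \<rho>. set_integrable M B (\<lambda>x. w x powr (- (p / (p - 1))))) \<and>
           bdd_above ((\<lambda>B. avg M B (\<lambda>x. w x powr q) *
                 avg M B (\<lambda>x. w x powr (- (p / (p - 1)))) powr (q * inv_dual p)) ` qballs M \<rho>))"

definition Apq_const :: "'a measure \<Rightarrow> ('a \<Rightarrow> 'a \<Rightarrow> real) \<Rightarrow> real \<Rightarrow> real \<Rightarrow> ('a \<Rightarrow> real) \<Rightarrow> real" where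
  "Apq_const M \<rho> p q w =
     (if p = 1 then Inf {C. AE x in M. maxfun M \<rho> (\<lambda>y. w y powr q) x \<le> ennreal (C * w x powr q)}
      else Sup ((\<lambda>B. avg M B (\<lambda>x. w x powr q) *
                 avg M B (\<lambda>x. w x powr (- (p / (p - 1)))) powr (q * inv_dual p)) ` qballs M \<rho>))"

text \<open>Real power on [0,\<infinity>] for a positive exponent (\<infinity>^a = \<infinity>).\<close>
definition ennpow :: "ennreal \<Rightarrow> real \<Rightarrow> ennreal" where
  "ennpow x a = (if x = \<infinity> then \<infinity> else ennreal (enn2real x powr a))"

definition Lp_norm :: "'a measure \<Rightarrow> real \<Rightarrow> ('a \<Rightarrow> real) \<Rightarrow> ('a \<Rightarrow> real) \<Rightarrow> ennreal" where
  "Lp_norm M p v f = ennpow (\<integral>\<^sup>+x. ennreal (\<bar>f x\<bar> powr p * v x) \<partial>M) (1 / p)"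

definition bdd_bdd_supp :: "'a measure \<Rightarrow> ('a \<Rightarrow> 'a \<Rightarrow> real) \<Rightarrow> ('a \<Rightarrow> real) \<Rightarrow> bool" where
  "bdd_bdd_supp M \<rho> f \<longleftrightarrow> f \<in> borel_measurable M \<and> (\<exists>K. \<forall>x\<in>space M. \<bar>f x\<bar> \<le> K) \<and>
     (\<exists>B\<in>qballs M \<rho>. {x \<in> space M. f x \<noteq> 0} \<subseteq> B)"

end

theory Submission
  imports Defs
begin

text \<open>
  Put \<open>W = w\<^sup>q\<close>, \<open>r = 1 + q/p'\<close> and \<open>\<sigma> = W\<^bsup>-1/(r-1)\<^esup>\<close>; then \<open>[w]\<^bsub>A(p,q)\<^esub>\<close> is the \<open>A\<^sub>r\<close> constant of \<open>W\<close>,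
  and \<open>r/q\<close>, called \<open>l\<close> below, is the same number for both pairs of exponents. The numbers \<open>d\<close> and \<open>d0\<close> are \<open>r - 1\<close> and \<open>r\<^sub>0 - 1\<close>.
  Lerner's argument, with the dyadic maximal functions replaced by averages over a ball divided by the measure of its
  Vitali dilate, gives Buckley's sharp bound \<open>[W]\<^bsup>1/(r-1)\<^esup>\<close> for the maximal operator on \<open>L\<^sup>r(W)\<close>. It uses no differentiation
  theorem; none is available here, since the measure need not be Borel regular. Rubio de Francia's
  iteration then yields an \<open>A\<^sub>1\<close> majorant \<open>H\<close> of a given function, with constant of that size.

  If \<open>p < p\<^sub>0\<close>, let \<open>H\<close> majorise \<open>h\<close> with \<open>h\<^sup>r W = |f|\<^sup>p w\<^sup>p\<close> (up to a small positive perturbation) and apply the hypothesis to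
  \<open>W H\<^bsup>r-r0\<^esup>\<close>. If \<open>p > p\<^sub>0\<close>, let \<open>V\<close> be the majorant in \<open>L\<^bsup>r'\<^esup>(\<sigma>)\<close> of \<open>v\<close> with \<open>v\<^bsup>r'\<^esup> \<sigma> = |Tf|\<^sup>q w\<^sup>q\<close> and apply the hypothesis to
  \<open>W\<^bsup>\<theta>\<^esup> V\<^bsup>1-\<theta>\<^esup>\<close>, where \<open>\<theta> = (r\<^sub>0-1)/(r-1)\<close>. As constants are immaterial, Hoelder's
  inequality is replaced throughout by \<open>a\<^bsup>\<theta>\<^esup> b\<^bsup>1-\<theta>\<^esup> \<le> a + b\<close> after normalisation.
\<close>

section \<open>Powers and integrals of extended nonnegative functions\<close>

text \<open>The two entries of the maximum in the exponent reflect how the majorant enters the new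
  weight. Below \<open>p0\<close>, H has \<open>A_1\<close> constant about [W]^(1/(r-1)), so W
  H^(r-r0) has constant about [W] times the (r0-r)-th power of it, which is [W]^((r0-1)/(r-1)); and
  (r0-1)/(r-1) is the ratio (q0/p0')(p'/q). Above \<open>p0\<close>, the dual weight sigma has
  \<open>A_r'\<close> constant [W]^(1/(r-1)), and Buckley's exponent 1/(r'-1) = r-1 turns this back
  into [W]; a geometric mean of W and V then keeps the first power. A weaker exponent in the maximal
  theorem would spoil both computations.

  The operator is arbitrary, so \<open>T f\<close> may be non-measurable and nothing is known about
  the finiteness of its norm. Yet above \<open>p0\<close> the majorant is built from that norm,
  which then reappears on the right and must be absorbed. Both difficulties disappear on measurable
  minorants of |T f|^q w^q with finite integral. The perturbation is there because weights must be
  positive, while \<open>f\<close> and \<open>T f\<close> may vanish.\<close>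

lemma ennpow_top [simp]: "ennpow top a = top"
  by (simp add: ennpow_def)

lemma ennpow_0 [simp]: "ennpow 0 a = 0"
  by (simp add: ennpow_def)

lemma ennpow_ennreal: "0 \<le> x \<Longrightarrow> ennpow (ennreal x) a = ennreal (x powr a)"
  by (simp add: ennpow_def)

lemma ennpow_1_right [simp]: "ennpow x 1 = x"
  by (cases x) (auto simp: ennpow_ennreal)

lemma ennpow_mono: "x \<le> y \<Longrightarrow> 0 \<le> a \<Longrightarrow> ennpow x a \<le> ennpow y a"
  by (cases x; cases y) (auto simp: ennpow_ennreal powr_mono2 top_unique)

lemma ennpow_mult: "ennpow (x * y) a = ennpow x a * ennpow y a"
  by (cases x; cases y)
    (auto simp: ennpow_ennreal powr_mult ennreal_mult[symmetric] ennreal_mult_top ennreal_top_mult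
      simp del: ennreal_0 simp flip: ennreal_0)

lemma ennpow_ennpow: "ennpow (ennpow x a) b = ennpow x (a * b)"
  by (cases x) (auto simp: ennpow_ennreal powr_powr)

lemma measurable_ennpow [measurable]:
  assumes [measurable]: "f \<in> borel_measurable M"
  shows "(\<lambda>x. ennpow (f x) a) \<in> borel_measurable M"
  unfolding ennpow_def by measurable

text \<open>For a positive exponent the power is an order isomorphism of the extended half-line,
  with inverse exponent \<open>1 / a\<close>.\<close>

lemma ennpow_SUP:
  assumes a: "0 < a"
  shows "ennpow (SUP i\<in>I. f i) a = (SUP i\<in>I. ennpow (f i) a)"
proof (rule antisym)
  let ?y = "SUP i\<in>I. ennpow (f i) a"
  have "f i \<le> ennpow ?y (1 / a)" if "i \<in> I" for i
  proof -
    have "ennpow (ennpow (f i) a) (1 / a) \<le> ennpow ?y (1 / a)"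
      using a that by (intro ennpow_mono SUP_upper) auto
    then show ?thesis
      using a by (simp add: ennpow_ennpow)
  qed
  then have "ennpow (SUP i\<in>I. f i) a \<le> ennpow (ennpow ?y (1 / a)) a"
    using a by (intro ennpow_mono SUP_least) auto
  then show "ennpow (SUP i\<in>I. f i) a \<le> ?y"
    using a by (simp add: ennpow_ennpow)
next
  show "(SUP i\<in>I. ennpow (f i) a) \<le> ennpow (SUP i\<in>I. f i) a"
    using a by (intro SUP_least ennpow_mono SUP_upper) auto
qed

section \<open>Strong-type inequalities from weak-type ones\<close>

text \<open>Used twice in Doob's argument: with \<open>c = p\<close> to spread
  \<open>m powr p\<close> over the levels, and with \<open>c = p - 1\<close> to collect them
  again.\<close>

lemma nn_integral_powr_layer:
  fixes c m :: real
  assumes c: "0 < c" and m: "0 \<le> m"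
  shows "(\<integral>\<^sup>+t. ennreal (c * t powr (c - 1)) * indicator {0..m} t \<partial>lborel) = ennreal (m powr c)"
proof -
  let ?f = "\<lambda>t::real. c * t powr (c - 1)"
  have "(?f has_integral c * (m powr (c - 1 + 1) / (c - 1 + 1))) {0..m}"
    using c m by (intro has_integral_mult_right has_integral_powr_from_0) auto
  then have "((\<lambda>t. if t \<in> {0..m} then ?f t else 0) has_integral m powr c) UNIV"
    using c by (subst has_integral_restrict_UNIV) simp
  then have "(\<integral>\<^sup>+t. ennreal (if t \<in> {0..m} then ?f t else 0) \<partial>lborel) = ennreal (m powr c)"
    using c by (intro nn_integral_has_integral_lborel) auto
  moreover have "(\<integral>\<^sup>+t. ennreal (?f t) * indicator {0..m} t \<partial>lborel) = (\<integral>\<^sup>+t. ennreal (if t \<in> {0..m} then ?f t else 0) \<partial>lborel)"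
    by (intro nn_integral_cong) (auto simp: indicator_def)
  ultimately show ?thesis by simp
qed

text \<open>Doob's argument: integrate the hypothesis against \<open>p t\<^sup>p\<^sup>-\<^sup>2 dt\<close>.\<close>

lemma layer_cake_maximal:
  fixes m :: "'a \<Rightarrow> real" and g :: "'a \<Rightarrow> ennreal"
  assumes "sigma_finite_measure N" and p: "1 < p"
    and [measurable]: "m \<in> borel_measurable N" "g \<in> borel_measurable N"
    and m: "\<And>x. 0 \<le> m x"
    and weak: "\<And>t. 0 < t \<Longrightarrow>
      ennreal t * emeasure N {x \<in> space N. t \<le> m x} \<le> (\<integral>\<^sup>+x. g x * indicator {x. t \<le> m x} x \<partial>N)"
  shows "(\<integral>\<^sup>+x. ennreal (m x powr p) \<partial>N) \<le> ennreal (p / (p - 1)) * (\<integral>\<^sup>+x. g x * ennreal (m x powr (p - 1)) \<partial>N)"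
proof -
  interpret sigma_finite_measure N by fact
  interpret pair_sigma_finite lborel N ..
  have [measurable]: "(\<lambda>(t, x). t \<le> m x) \<in> measurable (lborel \<Otimes>\<^sub>M N) (count_space UNIV)"
    by measurable
  let ?h = "\<lambda>t x. if 0 \<le> t \<and> t \<le> m x then 1 else 0 :: ennreal"
  have "(\<integral>\<^sup>+x. ennreal (m x powr p) \<partial>N)
      = (\<integral>\<^sup>+x. (\<integral>\<^sup>+t. ennreal (p * t powr (p - 1)) * ?h t x \<partial>lborel) \<partial>N)"
    using p m
    by (intro nn_integral_cong, subst nn_integral_powr_layer[symmetric])
      (auto intro!: nn_integral_cong simp: indicator_def)
  also have "\<dots> = (\<integral>\<^sup>+t. (\<integral>\<^sup>+x. ennreal (p * t powr (p - 1)) * ?h t x \<partial>N) \<partial>lborel)"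
    by (rule Fubini') measurable
  also have "\<dots> \<le> (\<integral>\<^sup>+t. (\<integral>\<^sup>+x. ennreal (p * t powr (p - 2)) * g x * ?h t x \<partial>N) \<partial>lborel)"
  proof (rule nn_integral_mono)
    fix t :: real
    show "(\<integral>\<^sup>+x. ennreal (p * t powr (p - 1)) * ?h t x \<partial>N)
        \<le> (\<integral>\<^sup>+x. ennreal (p * t powr (p - 2)) * g x * ?h t x \<partial>N)"
    proof (cases "0 < t")
      case True
      \<comment> \<open>One factor \<open>t\<close> is split off to be paired with the measure of
        the superlevel set, as \<open>weak\<close> demands.\<close>
      have eq: "p * t powr (p - 1) = (p * t powr (p - 2)) * t"
        using True powr_add[of t "p - 2" 1] by simp
      have "(\<integral>\<^sup>+x. ennreal (p * t powr (p - 1)) * ?h t x \<partial>N)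
          = ennreal (p * t powr (p - 1)) * (\<integral>\<^sup>+x. indicator {x \<in> space N. t \<le> m x} x \<partial>N)"
        using True by (subst nn_integral_cmult[symmetric]) (auto intro!: nn_integral_cong simp: indicator_def)
      also have "\<dots> = ennreal (p * t powr (p - 2)) * (ennreal t * emeasure N {x \<in> space N. t \<le> m x})"
        unfolding eq using True p by (subst nn_integral_indicator) (auto simp: ennreal_mult mult_ac)
      also have "\<dots> \<le> ennreal (p * t powr (p - 2)) * (\<integral>\<^sup>+x. g x * indicator {x. t \<le> m x} x \<partial>N)"
        using weak[OF True] by (rule mult_left_mono) simp
      also have "\<dots> = (\<integral>\<^sup>+x. ennreal (p * t powr (p - 2)) * g x * ?h t x \<partial>N)"
        using True by (subst nn_integral_cmult[symmetric])
          (auto intro!: nn_integral_cong simp: indicator_def)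
      finally show ?thesis .
    next
      case False
      then have 0: "ennreal (p * t powr (p - 1)) * ?h t x = 0" for x
        by (cases "t = 0") auto
      show ?thesis unfolding 0 by simp
    qed
  qed
  also have "\<dots> = (\<integral>\<^sup>+x. (\<integral>\<^sup>+t. ennreal (p * t powr (p - 2)) * g x * ?h t x \<partial>lborel) \<partial>N)"
    by (rule Fubini'[symmetric]) measurable
  also have "\<dots> = (\<integral>\<^sup>+x. ennreal (p / (p - 1)) * (g x * ennreal (m x powr (p - 1))) \<partial>N)"
  proof (rule nn_integral_cong)
    fix x
    have "(\<integral>\<^sup>+t. ennreal (p * t powr (p - 2)) * g x * ?h t x \<partial>lborel)
        = (\<integral>\<^sup>+t. (ennreal (p / (p - 1)) * g x) * (ennreal ((p - 1) * t powr (p - 1 - 1)) * indicator {0..m x} t) \<partial>lborel)"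
    proof (rule nn_integral_cong)
      fix t :: real
      have "ennreal (p / (p - 1)) * ennreal ((p - 1) * t powr (p - 1 - 1)) = ennreal (p * t powr (p - 2))"
        using p by (subst ennreal_mult'[symmetric]) auto
      then have "ennreal (p * t powr (p - 2)) * g x = (ennreal (p / (p - 1)) * g x) * ennreal ((p - 1) * t powr (p - 1 - 1))"
        by (simp only: mult_ac)
      then show "ennreal (p * t powr (p - 2)) * g x * ?h t x
          = (ennreal (p / (p - 1)) * g x) * (ennreal ((p - 1) * t powr (p - 1 - 1)) * indicator {0..m x} t)"
        by (simp only: mult.assoc indicator_def atLeastAtMost_iff of_bool_def)
    qed
    also have "\<dots> = ennreal (p / (p - 1)) * g x * ennreal (m x powr (p - 1))"
      using p m by (subst nn_integral_cmult, measurable, subst nn_integral_powr_layer) auto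
    finally show "(\<integral>\<^sup>+t. ennreal (p * t powr (p - 2)) * g x * ?h t x \<partial>lborel)
        = ennreal (p / (p - 1)) * (g x * ennreal (m x powr (p - 1)))"
      by (simp add: mult.assoc)
  qed
  also have "\<dots> = ennreal (p / (p - 1)) * (\<integral>\<^sup>+x. g x * ennreal (m x powr (p - 1)) \<partial>N)"
    by (rule nn_integral_cmult) measurable
  finally show ?thesis .
qed

text \<open>Young's inequality with a free parameter, by cases: if m is at most k times g, the first
  term dominates, and otherwise g < m / k and the second does. A large \<open>k\<close> makes the
  second term absorbable.\<close>

lemma mult_powr_le_split:
  fixes g :: ennreal
  assumes p: "1 < p" and k: "0 < k" and m: "0 \<le> m"
  shows "g * ennreal (m powr (p - 1)) \<le> ennreal (k powr (p - 1)) * ennpow g p + ennreal (m powr p / k)"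
proof (cases g)
  case (real g')
  show ?thesis
  proof (cases "m \<le> k * g'")
    case True
    have "g' * m powr (p - 1) \<le> g' * (k * g') powr (p - 1)"
      using True m p real by (intro mult_left_mono powr_mono2) auto
    also have "\<dots> = k powr (p - 1) * g' powr p"
      using real k p powr_mult_base[of g' "p - 1"] by (simp add: powr_mult mult_ac)
    finally have "ennreal (g' * m powr (p - 1)) \<le> ennreal (k powr (p - 1) * g' powr p)"
      by (rule ennreal_leI)
    then have "g * ennreal (m powr (p - 1)) \<le> ennreal (k powr (p - 1)) * ennpow g p"
      using real by (simp add: ennpow_ennreal ennreal_mult)
    then show ?thesis by (rule order_trans) simp
  next
    case False
    then have "g' * m powr (p - 1) \<le> m / k * m powr (p - 1)"
      using k by (intro mult_right_mono) (auto simp: field_simps)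
    also have "\<dots> = m powr p / k"
      using m p powr_mult_base[of m "p - 1"] by (simp add: mult_ac)
    finally have "ennreal (g' * m powr (p - 1)) \<le> ennreal (m powr p / k)"
      by (rule ennreal_leI)
    then have "g * ennreal (m powr (p - 1)) \<le> ennreal (m powr p / k)"
      using real by (simp add: ennreal_mult)
    then show ?thesis by (rule order_trans) simp
  qed
next
  case top
  then show ?thesis
    using k by (simp add: ennreal_mult_top)
qed

text \<open>After the layer-cake step, the \<open>m powr p\<close> part is absorbed into the left
  side, which \<open>fin\<close> permits. The constant depends on \<open>p\<close> alone and not on
  the measure \<open>N\<close>; hence the weighted maximal bounds below do not depend on the
  weight.\<close>

lemma maximal_strong_type:
  fixes m :: "'a \<Rightarrow> real" and g :: "'a \<Rightarrow> ennreal"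
  assumes "sigma_finite_measure N" and p: "1 < p"
    and [measurable]: "m \<in> borel_measurable N" "g \<in> borel_measurable N"
    and m: "\<And>x. 0 \<le> m x"
    and weak: "\<And>t. 0 < t \<Longrightarrow>
      ennreal t * emeasure N {x \<in> space N. t \<le> m x} \<le> (\<integral>\<^sup>+x. g x * indicator {x. t \<le> m x} x \<partial>N)"
    and fin: "(\<integral>\<^sup>+x. ennreal (m x powr p) \<partial>N) < \<infinity>"
  shows "(\<integral>\<^sup>+x. ennreal (m x powr p) \<partial>N) \<le> ennreal ((2 * (p / (p - 1))) powr p) * (\<integral>\<^sup>+x. ennpow (g x) p \<partial>N)"
proof -
  let ?q = "p / (p - 1)"
  \<comment> \<open>Chosen so that \<open>?q * (1 / ?k)\<close> is one half. After absorbing half of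
    \<open>?I\<close>, the factor \<open>2 * ?q * ?k powr (p - 1)\<close> is exactly
    \<open>?k powr p\<close>.\<close>
  let ?k = "2 * ?q"
  let ?I = "\<integral>\<^sup>+x. ennreal (m x powr p) \<partial>N"
  let ?J = "\<integral>\<^sup>+x. ennpow (g x) p \<partial>N"
  have q: "0 < ?q" "0 < ?k" using p by auto
  have "?I \<le> ennreal ?q * (\<integral>\<^sup>+x. g x * ennreal (m x powr (p - 1)) \<partial>N)"
    by (rule layer_cake_maximal) (use assms in auto)
  also have "\<dots> \<le> ennreal ?q * (\<integral>\<^sup>+x. ennreal (?k powr (p - 1)) * ennpow (g x) p + ennreal (1 / ?k) * ennreal (m x powr p) \<partial>N)"
  proof (intro mult_left_mono nn_integral_mono)
    fix x
    have "ennreal (1 / ?k) * ennreal (m x powr p) = ennreal (m x powr p / ?k)"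
      by (subst ennreal_mult''[symmetric]) (auto simp: mult.commute)
    then show "g x * ennreal (m x powr (p - 1)) \<le> ennreal (?k powr (p - 1)) * ennpow (g x) p + ennreal (1 / ?k) * ennreal (m x powr p)"
      using mult_powr_le_split[OF p q(2) m[of x], of "g x"] by (simp only:)
  qed simp
  also have "\<dots> = ennreal ?q * (ennreal (?k powr (p - 1)) * ?J + ennreal (1 / ?k) * ?I)"
    by (subst nn_integral_add) (auto simp: nn_integral_cmult)
  also have "\<dots> = ennreal (?q * ?k powr (p - 1)) * ?J + ennreal (1 / 2) * ?I"
  proof -
    have "?q * (1 / ?k) = 1 / 2" using p by (auto simp: field_simps)
    then have "ennreal ?q * ennreal (1 / ?k) = ennreal (1 / 2)"
      using q by (metis ennreal_mult' less_imp_le)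
    then show ?thesis
      using q by (simp only: distrib_left mult.assoc[symmetric] ennreal_mult' less_imp_le)
  qed
  finally have *: "?I \<le> ennreal (?q * ?k powr (p - 1)) * ?J + ennreal (1 / 2) * ?I" .
  define h :: real where "h = 1 / 2"
  show ?thesis
  proof (cases "?J = \<infinity>")
    case True
    have "0 < ?k powr p" using q(2) less_imp_neq[OF q(2)] by (simp only: powr_gt_zero not_False_eq_True)
    then show ?thesis using True by (simp add: ennreal_mult_top)
  next
    case False
    obtain i where i: "?I = ennreal i" "0 \<le> i" using fin by (cases ?I) auto
    obtain j where j: "?J = ennreal j" "0 \<le> j" using False by (cases ?J) auto
    have nn: "0 \<le> ?q * ?k powr (p - 1) * j + h * i"
      using q(1) i(2) j(2) by (intro add_nonneg_nonneg mult_nonneg_nonneg) (auto simp: h_def intro: less_imp_le)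
    have "ennreal i \<le> ennreal (?q * ?k powr (p - 1) * j + h * i)"
    proof -
      have "0 \<le> h" "0 \<le> ?q * ?k powr (p - 1)"
        using q(1) by (simp add: h_def, intro mult_nonneg_nonneg powr_ge_zero less_imp_le)
      then show ?thesis
        using *[unfolded i(1) j(1), folded h_def] i(2) j(2) by (simp only: ennreal_mult' ennreal_plus mult_nonneg_nonneg)
    qed
    then have "i \<le> ?q * ?k powr (p - 1) * j + h * i"
      using nn by (simp only: ennreal_le_iff)
    then have "i \<le> ?k * ?k powr (p - 1) * j" by (simp add: h_def)
    also have "?k * ?k powr (p - 1) = ?k powr p"
      using q powr_mult_base[of ?k "p - 1"] by simp
    finally show ?thesis
      using i j q by (simp add: ennreal_mult'[symmetric])
  qed
qed

section \<open>Geometric means, lower integrals and positive perturbations\<close>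

text \<open>Hoelder's inequality up to the factor 2: once \<open>a\<close> and \<open>b\<close> are
  divided by \<open>X\<close> and \<open>Y\<close>, each of the two integrals contributes at most
  one copy of the normalising product.\<close>

lemma nn_integral_geometric_mean_le:
  fixes a b :: "'a \<Rightarrow> real"
  assumes [measurable]: "a \<in> borel_measurable N" "b \<in> borel_measurable N" "B \<in> sets N"
    and ab: "\<And>x. x \<in> space N \<Longrightarrow> 0 \<le> a x" "\<And>x. x \<in> space N \<Longrightarrow> 0 \<le> b x"
    and XY: "0 < X" "0 < Y" and \<theta>: "0 \<le> \<theta>" "\<theta> \<le> 1"
    and X: "(\<integral>\<^sup>+x\<in>B. ennreal (a x) \<partial>N) \<le> ennreal X"
    and Y: "(\<integral>\<^sup>+x\<in>B. ennreal (b x) \<partial>N) \<le> ennreal Y"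
  shows "(\<integral>\<^sup>+x\<in>B. ennreal (a x powr \<theta> * b x powr (1 - \<theta>)) \<partial>N) \<le> ennreal (2 * X powr \<theta> * Y powr (1 - \<theta>))"
proof -
  let ?c = "X powr \<theta> * Y powr (1 - \<theta>)"
  have pw: "a x powr \<theta> * b x powr (1 - \<theta>) \<le> ?c / X * a x + ?c / Y * b x" if "x \<in> space N" for x
  proof -
    define u v where "u = a x / X" and "v = b x / Y"
    have uv: "0 \<le> u" "0 \<le> v" using ab[OF that] XY by (auto simp: u_def v_def)
    have "u powr \<theta> * v powr (1 - \<theta>) \<le> max u v powr \<theta> * max u v powr (1 - \<theta>)"
      using uv \<theta> by (intro mult_mono powr_mono2) auto
    also have "\<dots> \<le> max u v"
      using uv powr_add[of "max u v" \<theta> "1 - \<theta>"] by (auto simp: max_def)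
    also have "\<dots> \<le> u + v" using uv by auto
    finally have "?c * (u powr \<theta> * v powr (1 - \<theta>)) \<le> ?c * (u + v)"
      using XY by (intro mult_left_mono) auto
    moreover have "?c * (u powr \<theta> * v powr (1 - \<theta>)) = a x powr \<theta> * b x powr (1 - \<theta>)"
      using XY ab[OF that] by (simp add: u_def v_def powr_divide)
    ultimately show ?thesis
      by (simp add: u_def v_def distrib_left)
  qed
  have "(\<integral>\<^sup>+x\<in>B. ennreal (a x powr \<theta> * b x powr (1 - \<theta>)) \<partial>N)
      \<le> (\<integral>\<^sup>+x. ennreal (?c / X) * (ennreal (a x) * indicator B x) + ennreal (?c / Y) * (ennreal (b x) * indicator B x) \<partial>N)"
  proof (rule nn_integral_mono)
    fix x assume x: "x \<in> space N"
    have "ennreal (a x powr \<theta> * b x powr (1 - \<theta>)) \<le> ennreal (?c / X) * ennreal (a x) + ennreal (?c / Y) * ennreal (b x)"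
      using pw[OF x] ab[OF x] XY
      by (simp add: ennreal_mult'[symmetric] ennreal_plus[symmetric] ennreal_leI del: ennreal_plus)
    then show "ennreal (a x powr \<theta> * b x powr (1 - \<theta>)) * indicator B x
        \<le> ennreal (?c / X) * (ennreal (a x) * indicator B x) + ennreal (?c / Y) * (ennreal (b x) * indicator B x)"
      by (auto simp: indicator_def)
  qed
  also have "\<dots> = ennreal (?c / X) * (\<integral>\<^sup>+x\<in>B. ennreal (a x) \<partial>N) + ennreal (?c / Y) * (\<integral>\<^sup>+x\<in>B. ennreal (b x) \<partial>N)"
    by (subst nn_integral_add) (auto simp: nn_integral_cmult)
  also have "\<dots> \<le> ennreal (?c / X) * ennreal X + ennreal (?c / Y) * ennreal Y"
    using X Y by (intro add_mono mult_left_mono) auto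
  also have "\<dots> = ennreal (2 * X powr \<theta> * Y powr (1 - \<theta>))"
    using XY by (simp add: ennreal_mult'[symmetric] ennreal_plus[symmetric] del: ennreal_plus)
  finally show ?thesis .
qed

text \<open>The integral of a non-measurable function is a lower integral, so it is tested by integrable minorants.\<close>

lemma nn_integral_le_by_minorants:
  fixes F :: "'a \<Rightarrow> ennreal"
  assumes "sigma_finite_measure M"
    and le: "\<And>u::'a \<Rightarrow> real. u \<in> borel_measurable M \<Longrightarrow> (\<And>x. 0 \<le> u x) \<Longrightarrow> (\<And>x. ennreal (u x) \<le> F x) \<Longrightarrow>
      (\<integral>\<^sup>+x. ennreal (u x) \<partial>M) < \<infinity> \<Longrightarrow> (\<integral>\<^sup>+x. ennreal (u x) \<partial>M) \<le> c"
  shows "(\<integral>\<^sup>+x. F x \<partial>M) \<le> c"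
  unfolding nn_integral_def_finite
proof (safe intro!: SUP_least)
  interpret sigma_finite_measure M by fact
  fix g assume sf: "simple_function M g" and gF: "g \<le> F" and gfin: "\<forall>x. g x < top"
  note sf[THEN borel_measurable_simple_function, measurable]
  \<comment> \<open>Cutting off to sets of finite measure turns a bounded simple function into an
    integrable one, so that \<open>le\<close> applies; monotone convergence then removes the
    cut-off.\<close>
  obtain A :: "nat \<Rightarrow> 'a set" where A: "range A \<subseteq> sets M" "(\<Union>i. A i) = space M"
      "\<And>i. emeasure M (A i) \<noteq> \<infinity>" "incseq A"
    by (rule sigma_finite_incseq) blast
  have [measurable]: "A i \<in> sets M" for i using A by auto
  have "integral\<^sup>S M g = (\<integral>\<^sup>+x. g x \<partial>M)"
    using sf by (rule nn_integral_eq_simple_integral[symmetric])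
  also have "\<dots> = (\<integral>\<^sup>+x. (SUP i. g x * indicator (A i) x) \<partial>M)"
  proof (rule nn_integral_cong)
    fix x assume "x \<in> space M"
    then obtain i where "x \<in> A i" using A(2) by auto
    then show "g x = (SUP i. g x * indicator (A i) x)"
      by (intro antisym SUP_upper2[of i] SUP_least) (auto simp: indicator_def)
  qed
  also have "\<dots> = (SUP i. \<integral>\<^sup>+x. g x * indicator (A i) x \<partial>M)"
    using A(4) by (intro nn_integral_monotone_convergence_SUP)
      (auto simp: incseq_def le_fun_def indicator_def)
  also have "\<dots> \<le> c"
  proof (rule SUP_least)
    fix i
    let ?u = "\<lambda>x. enn2real (g x) * indicator (A i) x"
    have u: "ennreal (?u x) = g x * indicator (A i) x" for x
      using gfin by (auto simp: indicator_def less_top)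
    have fin: "finite (g ` space M)" using sf by (simp add: simple_function_def)
    have "\<exists>K::ennreal. K < top \<and> (\<forall>x\<in>space M. g x \<le> K)"
    proof (cases "space M = {}")
      case False
      then show ?thesis
        using fin gfin by (intro exI[of _ "Max (g ` space M)"]) (auto simp: Max_less_iff)
    qed (auto intro: exI[of _ 0])
    then obtain K where K: "K < top" "\<And>x. x \<in> space M \<Longrightarrow> g x \<le> K" by blast
    have "(\<integral>\<^sup>+x. ennreal (?u x) \<partial>M) \<le> (\<integral>\<^sup>+x. K * indicator (A i) x \<partial>M)"
      unfolding u using K by (intro nn_integral_mono mult_right_mono) auto
    also have "\<dots> = K * emeasure M (A i)" by (simp add: nn_integral_cmult)
    also have "\<dots> < \<infinity>" using K A(3)[of i] by (auto simp: ennreal_mult_less_top less_top)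
    finally have "(\<integral>\<^sup>+x. ennreal (?u x) \<partial>M) \<le> c"
      using gF by (intro le) (auto simp: le_fun_def u split: split_indicator simp del: ennreal_mult'')
    then show "(\<integral>\<^sup>+x. g x * indicator (A i) x \<partial>M) \<le> c" by (simp add: u)
  qed
  finally show "integral\<^sup>S M g \<le> c" .
qed

text \<open>Added to a nonnegative function whose integral is at most \<epsilon>, it makes the
  function strictly positive and at most doubles that bound.\<close>

lemma positive_integrable_function:
  assumes "sigma_finite_measure M" and \<epsilon>: "0 < (\<epsilon> :: real)"
  obtains \<phi> :: "'a \<Rightarrow> real" where "\<phi> \<in> borel_measurable M" "\<And>x. 0 < \<phi> x" "(\<integral>\<^sup>+x. ennreal (\<phi> x) \<partial>M) \<le> ennreal \<epsilon>"
proof -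
  interpret sigma_finite_measure M by fact
  obtain h where [measurable]: "h \<in> borel_measurable M" and fin: "integral\<^sup>N M h \<noteq> \<infinity>"
    and h: "\<And>x. x \<in> space M \<Longrightarrow> 0 < h x \<and> h x < \<infinity>"
    using Ex_finite_integrable_function by blast
  obtain I where I: "integral\<^sup>N M h = ennreal I" "0 \<le> I" using fin by (cases "integral\<^sup>N M h") auto
  define k where "k = \<epsilon> / (I + 1)"
  have k: "0 < k" "k * I \<le> \<epsilon>" using I \<epsilon> by (auto simp: k_def field_simps)
  \<comment> \<open>The value 1 off \<open>space M\<close> gives positivity without a membership
    condition.\<close>
  define \<phi> where "\<phi> x = (if x \<in> space M then k * enn2real (h x) else 1)" for x
  show thesis
  proof (rule that[of \<phi>])
    show "\<phi> \<in> borel_measurable M" unfolding \<phi>_def[abs_def] by measurable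
    show "0 < \<phi> x" for x using h[of x] k by (auto simp: \<phi>_def enn2real_positive_iff)
    have "(\<integral>\<^sup>+x. ennreal (\<phi> x) \<partial>M) = (\<integral>\<^sup>+x. ennreal k * h x \<partial>M)"
      using h k by (intro nn_integral_cong) (auto simp: \<phi>_def ennreal_mult' less_top)
    also have "\<dots> = ennreal (k * I)" using I k by (simp add: nn_integral_cmult ennreal_mult')
    also have "\<dots> \<le> ennreal \<epsilon>" using k by (intro ennreal_leI)
    finally show "(\<integral>\<^sup>+x. ennreal (\<phi> x) \<partial>M) \<le> ennreal \<epsilon>" .
  qed
qed

lemma Lp_norm_cong_AE:
  assumes "AE x in M. v x = v' x"
  shows "Lp_norm M p v f = Lp_norm M p v' f"
proof -
  have "(\<integral>\<^sup>+x. ennreal (\<bar>f x\<bar> powr p * v x) \<partial>M) = (\<integral>\<^sup>+x. ennreal (\<bar>f x\<bar> powr p * v' x) \<partial>M)"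
    using assms by (intro nn_integral_cong_AE) auto
  then show ?thesis by (simp add: Lp_norm_def)
qed

section \<open>Balls in spaces of homogeneous type\<close>

locale homogeneous_space =
  fixes M :: "'a measure" and \<rho> :: "'a \<Rightarrow> 'a \<Rightarrow> real" and A0 C\<mu> :: real
  assumes homogeneous: "homogeneous_type M \<rho> A0 C\<mu>"
begin

abbreviation qb :: "'a \<Rightarrow> real \<Rightarrow> 'a set" where "qb \<equiv> qball M \<rho>"

lemma space_nonempty: "space M \<noteq> {}" and A0_ge_1: "1 \<le> A0"
  using homogeneous by (auto simp: homogeneous_type_def)

lemma rho_nonneg: "x \<in> space M \<Longrightarrow> y \<in> space M \<Longrightarrow> 0 \<le> \<rho> x y"
  and rho_self: "x \<in> space M \<Longrightarrow> \<rho> x x = 0"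
  and rho_commute: "x \<in> space M \<Longrightarrow> y \<in> space M \<Longrightarrow> \<rho> x y = \<rho> y x"
  and rho_triangle: "x \<in> space M \<Longrightarrow> y \<in> space M \<Longrightarrow> z \<in> space M \<Longrightarrow> \<rho> x y \<le> A0 * (\<rho> x z + \<rho> z y)"
  using homogeneous unfolding homogeneous_type_def by blast+

lemma rho_less:
  assumes "x \<in> space M" "y \<in> space M" "z \<in> space M" "\<rho> x z < a" "\<rho> z y < b"
  shows "\<rho> x y < A0 * (a + b)"
  using rho_triangle[OF assms(1-3)] mult_strict_left_mono[of "\<rho> x z + \<rho> z y" "a + b" A0] A0_ge_1 assms(4,5)
  by linarith

lemma sets_qb: "x \<in> space M \<Longrightarrow> 0 < r \<Longrightarrow> qb x r \<in> sets M"
  using homogeneous by (simp add: homogeneous_type_def)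

lemma emeasure_qb_finite: "x \<in> space M \<Longrightarrow> 0 < r \<Longrightarrow> emeasure M (qb x r) < \<infinity>"
  using homogeneous[unfolded homogeneous_type_def] by (elim conjE ballE[of _ _ x] allE[of _ "r / 2"]) auto

lemma emeasure_qb: "x \<in> space M \<Longrightarrow> 0 < r \<Longrightarrow> emeasure M (qb x r) = ennreal (measure M (qb x r))"
  using emeasure_qb_finite[of x r] by (intro emeasure_eq_ennreal_measure) auto

lemma measure_qb_pos: "x \<in> space M \<Longrightarrow> 0 < r \<Longrightarrow> 0 < measure M (qb x r)"
proof -
  assume *: "x \<in> space M" "0 < r"
  then have "0 < emeasure M (qb x r)" using homogeneous unfolding homogeneous_type_def by blast
  then show ?thesis using emeasure_qb[OF *] by simp
qed

lemma qb_subset_space: "qb x r \<subseteq> space M"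
  by (auto simp: qball_def)

lemma centre_in_qb: "x \<in> space M \<Longrightarrow> 0 < r \<Longrightarrow> x \<in> qb x r"
  by (simp add: qball_def rho_self)

lemma measure_qb_mono:
  "x \<in> space M \<Longrightarrow> 0 < r \<Longrightarrow> y \<in> space M \<Longrightarrow> 0 < s \<Longrightarrow> qb x r \<subseteq> qb y s \<Longrightarrow> measure M (qb x r) \<le> measure M (qb y s)"
  using emeasure_qb_finite[of y s] by (intro measure_mono_fmeasurable) (auto simp: sets_qb fmeasurable_def)

text \<open>The maximum with 1 avoids a discussion of the sign of \<open>C\<mu>\<close> and gives a
  factor whose powers stay at least 1.\<close>

lemma doubling:
  assumes "x \<in> space M" "0 < r"
  shows "measure M (qb x (2 * r)) \<le> max 1 C\<mu> * measure M (qb x r)"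
proof -
  have "emeasure M (qb x (2 * r)) \<le> ennreal C\<mu> * emeasure M (qb x r)"
    using homogeneous assms by (simp add: homogeneous_type_def)
  also have "\<dots> \<le> ennreal (max 1 C\<mu>) * emeasure M (qb x r)"
    by (intro mult_right_mono ennreal_leI) auto
  finally show ?thesis
    using assms by (simp add: emeasure_qb ennreal_mult'[symmetric])
qed

text \<open>Doubling is iterated until \<open>2 ^ n\<close> exceeds \<open>k\<close>, so the
  constant depends on \<open>k\<close> but not on the ball.\<close>

lemma dilation_bound:
  obtains D where "1 \<le> D" "\<And>x r. x \<in> space M \<Longrightarrow> 0 < r \<Longrightarrow> measure M (qb x (k * r)) \<le> D * measure M (qb x r)"
proof -
  define E where "E = max 1 C\<mu>"
  have E: "1 \<le> E" by (simp add: E_def)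
  obtain n where n: "k \<le> 2 ^ n"
    using real_arch_pow[of 2 k] by (auto intro: less_imp_le)
  have pow: "measure M (qb x (2 ^ n * r)) \<le> E ^ n * measure M (qb x r)" if "x \<in> space M" "0 < r" for x r
  proof (induction n)
    case (Suc n)
    have "measure M (qb x (2 * (2 ^ n * r))) \<le> E * measure M (qb x (2 ^ n * r))"
      unfolding E_def using that by (intro doubling) auto
    also have "\<dots> \<le> E * (E ^ n * measure M (qb x r))"
      using Suc E by (intro mult_left_mono) auto
    finally show ?case by (simp add: mult.assoc)
  qed simp
  show thesis
  proof (rule that[of "E ^ n"])
    fix x r assume x: "x \<in> space M" and r: "0 < (r::real)"
    have "k * r \<le> 2 ^ n * r"
      using n r by (intro mult_right_mono) auto
    then have "qb x (k * r) \<subseteq> qb x (2 ^ n * r)"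
      by (auto simp: qball_def)
    then have "measure M (qb x (k * r)) \<le> measure M (qb x (2 ^ n * r))"
    proof (cases "0 < k * r")
      case True
      then show ?thesis using x r \<open>qb x (k * r) \<subseteq> _\<close> by (intro measure_qb_mono) auto
    next
      case False
      then have "qb x (k * r) = {}"
        using rho_nonneg[OF x] by (fastforce simp: qball_def)
      then show ?thesis by simp
    qed
    also have "\<dots> \<le> E ^ n * measure M (qb x r)" using pow x r by simp
    finally show "measure M (qb x (k * r)) \<le> E ^ n * measure M (qb x r)" .
  qed (use E in simp)
qed

text \<open>Two quasi-triangle inequalities along x, z, y, u give first \<open>A0 * (r + s)\<close>
  for the distance of the centres and then \<open>A0 * (A0 * (r + s) + s)\<close>, at most
  \<open>3 * A0\<^sup>2 * r\<close>. This is the origin of the Vitali dilation factor.\<close>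

lemma qb_engulf:
  assumes x: "x \<in> space M" and y: "y \<in> space M" and s: "s \<le> r" and z: "z \<in> qb x r" "z \<in> qb y s"
  shows "qb y s \<subseteq> qb x (3 * A0\<^sup>2 * r)"
proof
  fix u assume u: "u \<in> qb y s"
  have sp: "z \<in> space M" "u \<in> space M" using z u by (auto simp: qball_def)
  have r: "0 \<le> r" using z(1) rho_nonneg[OF x sp(1)] by (auto simp: qball_def)
  have "\<rho> x y < A0 * (r + s)"
    using z rho_commute[OF y sp(1)] by (intro rho_less[of x y z]) (auto simp: qball_def x y)
  then have "\<rho> x u < A0 * (A0 * (r + s) + s)"
    using u by (intro rho_less[of x u y]) (auto simp: qball_def x y)
  also have "\<dots> \<le> A0 * (A0 * (r + r) + A0 * r)"
  proof (intro mult_left_mono add_mono)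
    have "1 * r \<le> A0 * r" using A0_ge_1 r by (rule mult_right_mono)
    then show "s \<le> A0 * r" using s by simp
  qed (use s A0_ge_1 in auto)
  also have "\<dots> = 3 * A0\<^sup>2 * r" by (simp add: power2_eq_square algebra_simps)
  finally show "u \<in> qb x (3 * A0\<^sup>2 * r)" using sp by (simp add: qball_def)
qed

lemma qb_exhausts:
  assumes "x0 \<in> space M"
  shows "(\<Union>n. qb x0 (real (Suc n))) = space M"
proof safe
  fix x assume "x \<in> space M"
  moreover obtain n where "\<rho> x0 x < real n" using reals_Archimedean2 by blast
  ultimately show "x \<in> (\<Union>n. qb x0 (real (Suc n)))" by (auto simp: qball_def intro!: exI[of _ n])
qed (use qb_subset_space in auto)

lemma sigma_finite: "sigma_finite_measure M"
proof -
  obtain x0 where x0: "x0 \<in> space M" using space_nonempty by auto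
  show ?thesis
    using qb_exhausts[OF x0] emeasure_qb_finite[OF x0] sets_qb[OF x0]
    by (intro sigma_finite_measure.intro exI[of _ "range (\<lambda>n. qb x0 (real (Suc n)))"]) (auto simp: less_top)
qed

section \<open>Total boundedness, density and a countable family of balls\<close>

text \<open>A maximal \<open>e\<close>-separated subset is a net. Its cardinality is bounded because
  small balls round its points are disjoint, lie in one large ball, and by doubling each carry a
  fixed share of the measure of \<open>qb x0 R\<close>.\<close>

lemma finite_net_in_ball:
  assumes x0: "x0 \<in> space M" and R: "0 < R" and e: "0 < e"
  shows "\<exists>P. finite P \<and> P \<subseteq> space M \<and> (\<forall>x\<in>qb x0 R. \<exists>y\<in>P. \<rho> x y < e)"
proof -
  define sep where "sep P \<longleftrightarrow> finite P \<and> P \<subseteq> qb x0 R \<and> (\<forall>x\<in>P. \<forall>y\<in>P. x \<noteq> y \<longrightarrow> e \<le> \<rho> x y)" for P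
  \<comment> \<open>Two balls of this radius that meet have centres at distance less than
    \<open>A0 * (d + d) = e\<close>.\<close>
  define d where "d = e / (2 * A0)"
  have d: "0 < d" using e A0_ge_1 by (simp add: d_def)
  obtain D where D: "1 \<le> D"
    \<comment> \<open>The factor is such that at \<open>r = d\<close> the dilated ball has radius
      \<open>A0 * (R + R)\<close> and contains \<open>qb x0 R\<close>.\<close>
    "\<And>x r. x \<in> space M \<Longrightarrow> 0 < r \<Longrightarrow> measure M (qb x (A0 * (R + R) / d * r)) \<le> D * measure M (qb x r)"
    by (rule dilation_bound[of "A0 * (R + R) / d"]) blast
  let ?m = "measure M (qb x0 R)" and ?L = "measure M (qb x0 (A0 * (R + d)))"
  have m: "0 < ?m" using x0 R by (rule measure_qb_pos)
  have big: "0 < A0 * (R + d)" using A0_ge_1 R d by (intro mult_pos_pos) auto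
  have bound: "real (card P) \<le> ?L * D / ?m" if P: "sep P" for P
  proof -
    have fin: "finite P" and PR: "P \<subseteq> qb x0 R" and sp: "\<And>x. x \<in> P \<Longrightarrow> x \<in> space M"
      using P by (auto simp: sep_def qball_def)
    have "?m \<le> D * measure M (qb x d)" if x: "x \<in> P" for x
    proof -
      have "qb x0 R \<subseteq> qb x (A0 * (R + R))"
      proof
        fix z assume z: "z \<in> qb x0 R"
        have "\<rho> x x0 < R" using x PR sp[OF x] x0 rho_commute[of x x0] by (auto simp: qball_def)
        then show "z \<in> qb x (A0 * (R + R))"
          using z sp[OF x] x0 rho_less[of x z x0 R R] by (simp add: qball_def)
      qed
      then have "?m \<le> measure M (qb x (A0 * (R + R)))"
        using x sp x0 R A0_ge_1 by (intro measure_qb_mono) auto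
      also have "\<dots> \<le> D * measure M (qb x d)"
        using D(2)[of x d] x sp d by simp
      finally show ?thesis .
    qed
    then have "real (card P) * ?m \<le> (\<Sum>x\<in>P. D * measure M (qb x d))"
      by (subst sum_constant[symmetric]) (intro sum_mono, auto)
    also have "\<dots> = D * (\<Sum>x\<in>P. measure M (qb x d))" by (simp add: sum_distrib_left)
    also have "(\<Sum>x\<in>P. measure M (qb x d)) = measure M (\<Union>x\<in>P. qb x d)"
    proof (rule measure_finite_Union[symmetric])
      show "disjoint_family_on (\<lambda>x. qb x d) P"
      proof (unfold disjoint_family_on_def, intro ballI impI)
        fix x y assume xy: "x \<in> P" "y \<in> P" "x \<noteq> y"
        have "\<rho> x y < A0 * (d + d)" if "z \<in> qb x d" "z \<in> qb y d" for z
          using that xy sp rho_commute[of y z] by (intro rho_less[of x y z]) (auto simp: qball_def)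
        moreover have "A0 * (d + d) = e" using A0_ge_1 by (simp add: d_def field_simps)
        ultimately show "qb x d \<inter> qb y d = {}"
          using xy P by (auto simp: sep_def not_less[symmetric])
      qed
    qed (use fin sp d sets_qb emeasure_qb_finite in \<open>auto simp: less_top\<close>)
    also have "\<dots> \<le> ?L"
    proof (rule measure_mono_fmeasurable)
      show "(\<Union>x\<in>P. qb x d) \<subseteq> qb x0 (A0 * (R + d))"
        using PR x0 by (fastforce simp: qball_def intro!: rho_less)
      show "(\<Union>x\<in>P. qb x d) \<in> sets M" using fin sp d sets_qb by auto
      show "qb x0 (A0 * (R + d)) \<in> fmeasurable M"
        using x0 big sets_qb emeasure_qb_finite by (auto simp: fmeasurable_def)
    qed
    finally show ?thesis using m D(1) by (simp add: field_simps)
  qed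
  obtain N :: nat where N: "?L * D / ?m < real N" using reals_Archimedean2 by blast
  have "sep {}" by (simp add: sep_def)
  moreover have "card P < N" if "sep P" for P
    using bound[OF that] N by linarith
  ultimately obtain P where P: "sep P" and max: "\<And>Q. sep Q \<Longrightarrow> card Q \<le> card P"
    using ex_has_greatest_nat[of sep "{}" card N] by (metis less_imp_le)
  have "\<exists>y\<in>P. \<rho> x y < e" if x: "x \<in> qb x0 R" for x
  proof (rule ccontr)
    assume neg: "\<not> ?thesis"
    have xs: "x \<in> space M" using x by (simp add: qball_def)
    have "x \<notin> P" using neg e rho_self[OF xs] by force
    moreover have "sep (insert x P)"
      using neg P x xs rho_commute by (auto simp: sep_def not_less qball_def subset_iff)
    ultimately show False using max[of "insert x P"] P by (simp add: sep_def)
  qed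
  then show ?thesis using P by (intro exI[of _ P]) (auto simp: sep_def qball_def)
qed

lemma countable_dense:
  obtains S where "countable S" "S \<subseteq> space M" "\<And>x e. x \<in> space M \<Longrightarrow> 0 < e \<Longrightarrow> \<exists>y\<in>S. \<rho> x y < e"
proof -
  obtain x0 where x0: "x0 \<in> space M" using space_nonempty by auto
  have "\<forall>n m. \<exists>P. finite P \<and> P \<subseteq> space M \<and> (\<forall>x\<in>qb x0 (real (Suc n)). \<exists>y\<in>P. \<rho> x y < 1 / real (Suc m))"
    using x0 by (intro allI finite_net_in_ball) auto
  then obtain P where P: "\<And>n m. finite (P n m)" "\<And>n m. P n m \<subseteq> space M"
    "\<And>n m x. x \<in> qb x0 (real (Suc n)) \<Longrightarrow> \<exists>y\<in>P n m. \<rho> x y < 1 / real (Suc m)"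
    by metis
  show thesis
  proof (rule that[of "\<Union>n m. P n m"])
    show "countable (\<Union>n m. P n m)" using P(1) by (intro countable_UN) (auto intro: countable_finite)
    show "\<exists>y\<in>\<Union>n m. P n m. \<rho> x y < e" if x: "x \<in> space M" and e: "0 < e" for x e
    proof -
      obtain n where n: "x \<in> qb x0 (real (Suc n))" using qb_exhausts[OF x0] x by blast
      obtain m where "1 / real (Suc m) < e" using nat_approx_posE[OF e] .
      then show ?thesis using P(3)[OF n, of m] by (meson UN_I UNIV_I less_trans)
    qed
    show "(\<Union>n m. P n m) \<subseteq> space M" using P(2) by blast
  qed
qed

text \<open>A countable family comparable to all balls keeps the maximal operator measurable,
  although arbitrary unions of quasi-metric balls need not be.\<close>

lemma comparable_ball_sequence:
  obtains c :: "nat \<Rightarrow> 'a" and s :: "nat \<Rightarrow> real" and D :: real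
  where "1 \<le> D" "\<And>n. c n \<in> space M" "\<And>n. 0 < s n"
    "\<And>x r. x \<in> space M \<Longrightarrow> 0 < r \<Longrightarrow> measure M (qb x (3 * A0\<^sup>2 * r)) \<le> D * measure M (qb x r)"
    "\<And>x r. x \<in> space M \<Longrightarrow> 0 < r \<Longrightarrow>
      \<exists>n. qb x r \<subseteq> qb (c n) (s n) \<and> measure M (qb (c n) (s n)) \<le> D * measure M (qb x r)"
proof -
  obtain S where S: "countable S" "S \<subseteq> space M" "\<And>x e. x \<in> space M \<Longrightarrow> 0 < e \<Longrightarrow> \<exists>y\<in>S. \<rho> x y < e"
    using countable_dense by blast
  obtain D1 where D1: "1 \<le> D1"
    "\<And>x r. x \<in> space M \<Longrightarrow> 0 < r \<Longrightarrow> measure M (qb x (3 * A0\<^sup>2 * r)) \<le> D1 * measure M (qb x r)"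
    by (rule dilation_bound[of "3 * A0\<^sup>2"]) blast
  obtain D2 where D2: "1 \<le> D2"
    "\<And>x r. x \<in> space M \<Longrightarrow> 0 < r \<Longrightarrow> measure M (qb x (4 * A0\<^sup>2 * r)) \<le> D2 * measure M (qb x r)"
    by (rule dilation_bound[of "4 * A0\<^sup>2"]) blast
  define T where "T = S \<times> (\<rat> \<inter> {0<..} :: real set)"
  have "countable T" using S(1) countable_rat by (auto simp: T_def)
  moreover have "T \<noteq> {}"
  proof -
    obtain x0 where "x0 \<in> space M" using space_nonempty by auto
    then obtain y where "y \<in> S" using S(3)[of x0 1] by auto
    then have "(y, 1) \<in> T" by (simp add: T_def)
    then show ?thesis by auto
  qed
  ultimately obtain f :: "nat \<Rightarrow> 'a \<times> real" where f: "range f = T"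
    using range_from_nat_into by metis
  have fT: "f n \<in> T" for n using f by auto
  show thesis
  proof (rule that[of "max D1 D2" "\<lambda>n. fst (f n)" "\<lambda>n. snd (f n)"])
    show "1 \<le> max D1 D2" using D1 by simp
    show "fst (f n) \<in> space M" "0 < snd (f n)" for n
      using fT[of n] S(2) by (auto simp: T_def)
    fix x r assume x: "x \<in> space M" and r: "0 < (r::real)"
    show "measure M (qb x (3 * A0\<^sup>2 * r)) \<le> max D1 D2 * measure M (qb x r)"
      using D1(2)[OF x r] by (rule order_trans) (intro mult_right_mono, auto)
    obtain y where y: "y \<in> S" "\<rho> x y < r" using S(3)[OF x r] by auto
    have ys: "y \<in> space M" using y S by auto
    \<comment> \<open>A radius above \<open>2 * A0 * r\<close> makes the ball round \<open>y\<close>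
      contain \<open>qb x r\<close>; one below \<open>3 * A0 * r\<close> keeps it inside
      \<open>qb x (4 * A0\<^sup>2 * r)\<close>, which \<open>D2\<close> controls.\<close>
    have "2 * A0 * r < 3 * A0 * r" using A0_ge_1 r by simp
    then obtain q where q: "q \<in> \<rat>" "2 * A0 * r < q" "q < 3 * A0 * r"
      using Rats_dense_in_real by blast
    have q0: "0 < q" using q A0_ge_1 r by (smt (verit) mult_nonneg_nonneg)
    have "(y, q) \<in> range f" unfolding f using y q q0 by (simp add: T_def)
    then obtain n where n: "f n = (y, q)" by force
    have "qb x r \<subseteq> qb y q"
    proof
      fix z assume z: "z \<in> qb x r"
      then have "\<rho> y z < A0 * (r + r)"
        using y x ys rho_commute[of x y] by (intro rho_less[of y z x]) (auto simp: qball_def)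
      then show "z \<in> qb y q" using z q by (simp add: qball_def)
    qed
    moreover have "measure M (qb y q) \<le> max D1 D2 * measure M (qb x r)"
    proof -
      have "qb y q \<subseteq> qb x (4 * A0\<^sup>2 * r)"
      proof
        fix z assume z: "z \<in> qb y q"
        then have "\<rho> x z < A0 * (r + 3 * A0 * r)"
          using y x ys q by (intro rho_less[of x z y]) (auto simp: qball_def)
        also have "\<dots> \<le> A0 * (A0 * r + 3 * A0 * r)"
          using A0_ge_1 r by (intro mult_left_mono add_right_mono) auto
        finally show "z \<in> qb x (4 * A0\<^sup>2 * r)" using z by (simp add: qball_def power2_eq_square algebra_simps)
      qed
      then have "measure M (qb y q) \<le> measure M (qb x (4 * A0\<^sup>2 * r))"
        using x ys q0 r A0_ge_1 by (intro measure_qb_mono) auto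
      also have "\<dots> \<le> D2 * measure M (qb x r)" using D2 x r by simp
      also have "\<dots> \<le> max D1 D2 * measure M (qb x r)" by (intro mult_right_mono) auto
      finally show ?thesis .
    qed
    ultimately show "\<exists>n. qb x r \<subseteq> qb (fst (f n)) (snd (f n)) \<and>
        measure M (qb (fst (f n)) (snd (f n))) \<le> max D1 D2 * measure M (qb x r)"
      using n by (intro exI[of _ n]) simp
  qed
qed

lemma qb_in_qballs: "x \<in> space M \<Longrightarrow> 0 < r \<Longrightarrow> qb x r \<in> qballs M \<rho>"
  unfolding qballs_def by blast

lemma qballs_D:
  assumes "B \<in> qballs M \<rho>"
  shows "B \<in> sets M" "emeasure M B = ennreal (measure M B)" "0 < measure M B"
  using assms sets_qb emeasure_qb measure_qb_pos unfolding qballs_def by blast+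

lemma qballs_nonempty: "qballs M \<rho> \<noteq> {}"
  using space_nonempty qb_in_qballs[of _ 1] by fastforce

section \<open>Averages over balls and the weight classes\<close>

text \<open>Balls have positive measure. This turns an almost-everywhere \<open>A_1\<close> estimate
  into one usable point of a given ball.\<close>

lemma AE_meets_qball:
  assumes B: "B \<in> qballs M \<rho>" and ae: "AE x in M. P x"
  obtains x where "x \<in> B" "P x"
proof -
  have "\<exists>x\<in>B. P x"
  proof (rule ccontr)
    assume "\<not> ?thesis"
    then have "AE x in M. x \<notin> B" using ae by (auto elim!: eventually_mono)
    then have "B \<in> null_sets M" using qballs_D[OF B] by (simp add: AE_iff_null_sets)
    then show False using qballs_D[OF B] by (metis ennreal_eq_0_iff not_le null_setsD1)
  qed
  then show thesis using that by blast
qed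

lemma nn_integral_qball_pos:
  assumes B: "B \<in> qballs M \<rho>" and [measurable]: "u \<in> borel_measurable M" and u: "\<And>x. 0 < (u x :: real)"
  shows "0 < (\<integral>\<^sup>+x\<in>B. ennreal (u x) \<partial>M)"
proof -
  have [measurable]: "B \<in> sets M" using qballs_D[OF B] by auto
  have "(\<integral>\<^sup>+x\<in>B. ennreal (u x) \<partial>M) \<noteq> 0"
  proof
    assume "(\<integral>\<^sup>+x\<in>B. ennreal (u x) \<partial>M) = 0"
    then have "AE x in M. ennreal (u x) * indicator B x = 0"
      by (subst (asm) nn_integral_0_iff_AE) auto
    then obtain x where "x \<in> B" "ennreal (u x) * indicator B x = 0" using AE_meets_qball[OF B] by blast
    then show False using u[of x] by (simp add: ennreal_eq_0_iff)
  qed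
  then show ?thesis by (simp add: zero_less_iff_neq_zero)
qed

text \<open>\<open>avg\<close> is a Bochner average, which defaults to 0 for non-integrable
  functions; integrability is therefore obtained together with the bound, from a finite nonnegative
  integral.\<close>

lemma avg_of_nn_integral:
  assumes B: "B \<in> qballs M \<rho>" and [measurable]: "u \<in> borel_measurable M" and u: "\<And>x. 0 \<le> (u x :: real)"
    and le: "(\<integral>\<^sup>+x\<in>B. ennreal (u x) \<partial>M) \<le> ennreal (a * measure M B)" and a: "0 \<le> a"
  shows "set_integrable M B u" "0 \<le> avg M B u" "avg M B u \<le> a"
proof -
  have [measurable]: "B \<in> sets M" and m: "0 < measure M B" using qballs_D[OF B] by auto
  have eq: "ennreal (indicator B x * u x) = ennreal (u x) * indicator B x" for x
    by (auto simp: indicator_def)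
  show int: "set_integrable M B u"
    unfolding set_integrable_def using le u
    by (intro integrableI_nonneg) (auto simp: eq less_top[symmetric] top_unique)
  show "0 \<le> avg M B u"
    unfolding avg_def set_lebesgue_integral_def using u by (auto intro!: divide_nonneg_nonneg)
  have "ennreal (LINT x:B|M. u x) = (\<integral>\<^sup>+x\<in>B. ennreal (u x) \<partial>M)"
    unfolding set_lebesgue_integral_def using int u
    by (subst nn_integral_eq_integral[symmetric]) (auto simp: set_integrable_def eq)
  then have "ennreal (LINT x:B|M. u x) \<le> ennreal (a * measure M B)" using le by (simp only:)
  then have "(LINT x:B|M. u x) \<le> a * measure M B"
    using a m by (subst (asm) ennreal_le_iff) auto
  then show "avg M B u \<le> a" using m by (simp add: avg_def field_simps)
qed

lemma nn_integral_of_avg: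
  assumes B: "B \<in> qballs M \<rho>" and [measurable]: "u \<in> borel_measurable M" and u: "\<And>x. 0 < (u x :: real)"
    and int: "set_integrable M B u"
  shows "(\<integral>\<^sup>+x\<in>B. ennreal (u x) \<partial>M) = ennreal (avg M B u * measure M B)" "0 < avg M B u"
proof -
  have [measurable]: "B \<in> sets M" and m: "0 < measure M B" using qballs_D[OF B] by auto
  have eq: "ennreal (indicator B x * u x) = ennreal (u x) * indicator B x" for x
    by (auto simp: indicator_def)
  have "ennreal (LINT x:B|M. u x) = (\<integral>\<^sup>+x\<in>B. ennreal (u x) \<partial>M)"
    unfolding set_lebesgue_integral_def using int u
    by (subst nn_integral_eq_integral[symmetric]) (auto simp: set_integrable_def eq less_imp_le)
  then show *: "(\<integral>\<^sup>+x\<in>B. ennreal (u x) \<partial>M) = ennreal (avg M B u * measure M B)"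
    using m by (simp add: avg_def)
  show "0 < avg M B u"
    using nn_integral_qball_pos[OF B, of u] u m by (simp add: * zero_less_mult_iff)
qed

text \<open>The supremum is reduced to bounds for two nonnegative integrals on each ball.
  Nonnegativity of the constant is recorded because the constant is later compared inside a
  power.\<close>

lemma Apq_intro:
  assumes p: "1 < p" and [measurable]: "w \<in> borel_measurable M" and w: "\<And>x. 0 < w x"
    and *: "\<And>B. B \<in> qballs M \<rho> \<Longrightarrow> \<exists>a c. 0 \<le> a \<and> 0 \<le> c \<and>
      (\<integral>\<^sup>+x\<in>B. ennreal (w x powr q) \<partial>M) \<le> ennreal (a * measure M B) \<and>
      (\<integral>\<^sup>+x\<in>B. ennreal (w x powr (- (p / (p - 1)))) \<partial>M) \<le> ennreal (c * measure M B) \<and>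
      a * c powr (q * inv_dual p) \<le> Q"
    and q: "0 < q"
  shows "in_Apq M \<rho> p q w" "0 \<le> Apq_const M \<rho> p q w" "Apq_const M \<rho> p q w \<le> Q"
proof -
  let ?F = "\<lambda>B. avg M B (\<lambda>x. w x powr q) * avg M B (\<lambda>x. w x powr (- (p / (p - 1)))) powr (q * inv_dual p)"
  have e: "0 < q * inv_dual p" using p q by (simp add: inv_dual_def)
  have F: "set_integrable M B (\<lambda>x. w x powr q)" "set_integrable M B (\<lambda>x. w x powr (- (p / (p - 1))))"
      "0 \<le> ?F B" "?F B \<le> Q" if B: "B \<in> qballs M \<rho>" for B
  proof -
    obtain a c where ac: "0 \<le> a" "0 \<le> c"
      "(\<integral>\<^sup>+x\<in>B. ennreal (w x powr q) \<partial>M) \<le> ennreal (a * measure M B)"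
      "(\<integral>\<^sup>+x\<in>B. ennreal (w x powr (- (p / (p - 1)))) \<partial>M) \<le> ennreal (c * measure M B)"
      "a * c powr (q * inv_dual p) \<le> Q"
      using *[OF B] by blast
    note 1 = avg_of_nn_integral[OF B _ _ ac(3) ac(1)] and 2 = avg_of_nn_integral[OF B _ _ ac(4) ac(2)]
    show "set_integrable M B (\<lambda>x. w x powr q)" by (rule 1) auto
    show "set_integrable M B (\<lambda>x. w x powr (- (p / (p - 1))))" by (rule 2) auto
    show "0 \<le> ?F B" by (intro mult_nonneg_nonneg 1) auto
    have "?F B \<le> a * c powr (q * inv_dual p)"
      using e ac by (intro mult_mono powr_mono2 1 2) auto
    then show "?F B \<le> Q" using ac(5) by linarith
  qed
  have bdd: "bdd_above (?F ` qballs M \<rho>)" using F(4) by (intro bdd_aboveI2)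
  show "in_Apq M \<rho> p q w"
    unfolding in_Apq_def weight_def using p w F(1,2) bdd by auto
  obtain B where B: "B \<in> qballs M \<rho>" using qballs_nonempty by auto
  have "?F B \<le> Sup (?F ` qballs M \<rho>)" using B bdd by (intro cSup_upper) auto
  then show "0 \<le> Apq_const M \<rho> p q w" using F(3)[OF B] p by (simp add: Apq_const_def)
  show "Apq_const M \<rho> p q w \<le> Q"
    using p qballs_nonempty F(4) by (auto simp: Apq_const_def intro!: cSup_least)
qed

lemma Apq_elim:
  assumes p: "1 < p" and w: "\<And>x. 0 < w x" and A: "in_Apq M \<rho> p q w" and B: "B \<in> qballs M \<rho>"
  obtains a c where "0 < a" "0 < c"
      "(\<integral>\<^sup>+x\<in>B. ennreal (w x powr q) \<partial>M) = ennreal (a * measure M B)"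
      "(\<integral>\<^sup>+x\<in>B. ennreal (w x powr (- (p / (p - 1)))) \<partial>M) = ennreal (c * measure M B)"
      "a * c powr (q * inv_dual p) \<le> Apq_const M \<rho> p q w"
proof -
  let ?F = "\<lambda>B. avg M B (\<lambda>x. w x powr q) * avg M B (\<lambda>x. w x powr (- (p / (p - 1)))) powr (q * inv_dual p)"
  have [measurable]: "w \<in> borel_measurable M" using A by (simp add: in_Apq_def weight_def)
  have *: "set_integrable M B (\<lambda>x. w x powr q)" "set_integrable M B (\<lambda>x. w x powr (- (p / (p - 1))))"
    and bdd: "bdd_above (?F ` qballs M \<rho>)"
    using A B p by (auto simp: in_Apq_def)
  have w0: "0 < w x powr s" for x s using w[of x] by simp
  have "?F B \<le> Apq_const M \<rho> p q w"
    using bdd B p by (auto simp: Apq_const_def intro!: cSup_upper)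
  then show thesis
    using w0 * B by (intro that[OF _ _ nn_integral_of_avg(1) nn_integral_of_avg(1)] nn_integral_of_avg(2)) auto
qed

lemma Apq_const_pos:
  assumes "1 < p" and "\<And>x. 0 < w x" and "in_Apq M \<rho> p q w"
  shows "0 < Apq_const M \<rho> p q w"
proof -
  obtain B where "B \<in> qballs M \<rho>" using qballs_nonempty by auto
  from Apq_elim[OF assms this] obtain a c where
    "0 < a" "0 < c" "a * c powr (q * inv_dual p) \<le> Apq_const M \<rho> p q w" by blast
  moreover from this have "0 < a * c powr (q * inv_dual p)" by simp
  ultimately show ?thesis by linarith
qed

text \<open>Integrability over a ball follows from the estimate at a single point of it, where the
  right side is a finite number.\<close>

lemma A1q_intro:
  assumes [measurable]: "w \<in> borel_measurable M" and w: "\<And>x. 0 < w x" and Q: "0 \<le> Q"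
    and *: "AE x in M. \<forall>B\<in>qballs M \<rho>. x \<in> B \<longrightarrow>
      (\<integral>\<^sup>+y\<in>B. ennreal (w y powr q) \<partial>M) \<le> ennreal (Q * measure M B * w x powr q)"
  shows "in_Apq M \<rho> 1 q w" "0 \<le> Apq_const M \<rho> 1 q w" "Apq_const M \<rho> 1 q w \<le> Q"
proof -
  let ?S = "{C. AE x in M. maxfun M \<rho> (\<lambda>y. w y powr q) x \<le> ennreal (C * w x powr q)}"
  have "AE x in M. maxfun M \<rho> (\<lambda>y. w y powr q) x \<le> ennreal (Q * w x powr q)"
    using *
  proof eventually_elim
    case (elim x)
    show ?case unfolding maxfun_def
    proof (rule SUP_least)
      fix B assume "B \<in> {B \<in> qballs M \<rho>. x \<in> B}"
      then have B: "B \<in> qballs M \<rho>" "x \<in> B" by auto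
      have m: "emeasure M B = ennreal (measure M B)" "0 < measure M B" using qballs_D[OF B(1)] by auto
      have "(\<integral>\<^sup>+y\<in>B. ennreal \<bar>w y powr q\<bar> \<partial>M) / emeasure M B \<le> ennreal (Q * measure M B * w x powr q) / emeasure M B"
        using elim B by (intro divide_right_mono_ennreal) auto
      also have "\<dots> = ennreal (Q * w x powr q)" using m Q by (simp add: divide_ennreal)
      finally show "(\<integral>\<^sup>+y\<in>B. ennreal \<bar>w y powr q\<bar> \<partial>M) / emeasure M B \<le> ennreal (Q * w x powr q)" .
    qed
  qed
  then have QS: "Q \<in> ?S" by simp
  \<comment> \<open>The infimum ranges over all reals, and \<open>ennreal\<close> truncates a
    negative bound to 0. Such a \<open>C\<close> would force the maximal function of a positive
    weight to vanish somewhere.\<close>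
  have nonneg: "0 \<le> C" if C: "C \<in> ?S" for C
  proof (rule ccontr)
    assume neg: "\<not> 0 \<le> C"
    obtain B where B: "B \<in> qballs M \<rho>" using qballs_nonempty by auto
    have "AE x in M. maxfun M \<rho> (\<lambda>y. w y powr q) x \<le> ennreal (C * w x powr q)" using C by simp
    then obtain x where x: "x \<in> B" "maxfun M \<rho> (\<lambda>y. w y powr q) x \<le> ennreal (C * w x powr q)"
      by (rule AE_meets_qball[OF B])
    have "C * w x powr q \<le> 0" using neg by (intro mult_nonpos_nonneg) auto
    then have "maxfun M \<rho> (\<lambda>y. w y powr q) x = 0" using x(2) by (simp add: ennreal_neg)
    moreover have "(\<integral>\<^sup>+y\<in>B. ennreal \<bar>w y powr q\<bar> \<partial>M) / emeasure M B \<le> maxfun M \<rho> (\<lambda>y. w y powr q) x"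
      unfolding maxfun_def using B x by (intro SUP_upper) auto
    ultimately have "(\<integral>\<^sup>+y\<in>B. ennreal (w y powr q) \<partial>M) = 0"
      using qballs_D[OF B] by (auto simp: ennreal_divide_eq_0_iff)
    moreover have "0 < (\<integral>\<^sup>+y\<in>B. ennreal (w y powr q) \<partial>M)"
      using w by (intro nn_integral_qball_pos[OF B]) (auto simp: less_imp_neq[THEN not_sym])
    ultimately show False by simp
  qed
  have "set_integrable M B (\<lambda>x. w x powr q)" if B: "B \<in> qballs M \<rho>" for B
  proof -
    obtain x where x: "x \<in> B" "\<forall>B\<in>qballs M \<rho>. x \<in> B \<longrightarrow>
      (\<integral>\<^sup>+y\<in>B. ennreal (w y powr q) \<partial>M) \<le> ennreal (Q * measure M B * w x powr q)"
      using AE_meets_qball[OF B *] by blast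
    then show ?thesis using B Q
      by (intro avg_of_nn_integral(1)[OF B, of _ "Q * w x powr q"]) (auto simp: mult_ac)
  qed
  then show "in_Apq M \<rho> 1 q w"
    unfolding in_Apq_def weight_def using w QS by auto
  show "0 \<le> Apq_const M \<rho> 1 q w"
    unfolding Apq_const_def using QS nonneg by (auto intro!: cInf_greatest)
  show "Apq_const M \<rho> 1 q w \<le> Q"
    unfolding Apq_const_def using QS nonneg by (auto intro!: cInf_lower bdd_belowI)
qed

text \<open>On a ball an \<open>A_1\<close> function behaves like its average \<open>t\<close>: it
  is almost everywhere at least \<open>t / L\<close>, which controls negative powers, while positive
  powers below 1 need only the average. The unknown \<open>t\<close> cancels when the two bounds are
  combined in the weight constant.\<close>

lemma perturbed_averages:
  fixes U Z H :: "'a \<Rightarrow> real"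
  assumes B: "B \<in> qballs M \<rho>"
    and [measurable]: "U \<in> borel_measurable M" "Z \<in> borel_measurable M" "H \<in> borel_measurable M"
    and pos: "\<And>x. 0 < U x" "\<And>x. 0 < Z x" "\<And>x. 0 < H x" "0 < a" "0 < c" "0 < L"
    and \<gamma>: "0 \<le> \<gamma>" and \<theta>: "0 \<le> \<theta>" "\<theta> \<le> 1"
    and a: "(\<integral>\<^sup>+x\<in>B. ennreal (U x) \<partial>M) \<le> ennreal (a * measure M B)"
    and c: "(\<integral>\<^sup>+x\<in>B. ennreal (Z x) \<partial>M) \<le> ennreal (c * measure M B)"
    and H: "AE x in M. \<forall>B\<in>qballs M \<rho>. x \<in> B \<longrightarrow> (\<integral>\<^sup>+y\<in>B. ennreal (H y) \<partial>M) \<le> ennreal (L * measure M B * H x)"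
  obtains t where "0 < t"
    "(\<integral>\<^sup>+x\<in>B. ennreal (U x * H x powr (- \<gamma>)) \<partial>M) \<le> ennreal (a * (t / L) powr (- \<gamma>) * measure M B)"
    "(\<integral>\<^sup>+x\<in>B. ennreal (Z x powr \<theta> * H x powr (1 - \<theta>)) \<partial>M) \<le> ennreal (2 * c powr \<theta> * t powr (1 - \<theta>) * measure M B)"
proof -
  have [measurable]: "B \<in> sets M" and m: "0 < measure M B" using qballs_D[OF B] by auto
  \<comment> \<open>One point satisfying the \<open>A_1\<close> estimate shows that \<open>H\<close>
    has finite integral over \<open>B\<close>.\<close>
  obtain x where x: "x \<in> B" and Hx: "\<forall>B\<in>qballs M \<rho>. x \<in> B \<longrightarrow>
      (\<integral>\<^sup>+y\<in>B. ennreal (H y) \<partial>M) \<le> ennreal (L * measure M B * H x)"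
    by (rule AE_meets_qball[OF B H])
  from bspec[OF Hx B] x have "(\<integral>\<^sup>+y\<in>B. ennreal (H y) \<partial>M) \<le> ennreal (L * measure M B * H x)" by (rule mp)
  then obtain I where I: "(\<integral>\<^sup>+y\<in>B. ennreal (H y) \<partial>M) = ennreal I" "0 \<le> I"
    by (cases "\<integral>\<^sup>+y\<in>B. ennreal (H y) \<partial>M") (auto simp: top_unique)
  have "0 < I" using nn_integral_qball_pos[OF B, of H] pos(3) I by simp
  define t where "t = I / measure M B"
  have t: "0 < t" "I = t * measure M B" using \<open>0 < I\<close> m by (auto simp: t_def)
  \<comment> \<open>The same estimate, read at almost every point of \<open>B\<close>, is the lower
    bound for \<open>H\<close>.\<close>
  have low: "AE x in M. x \<in> B \<longrightarrow> t / L \<le> H x"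
    using H
  proof eventually_elim
    case (elim x)
    show ?case
    proof
      assume "x \<in> B"
      then have "ennreal I \<le> ennreal (L * measure M B * H x)"
        using mp[OF bspec[OF elim B]] unfolding I(1) by blast
      then have "I \<le> L * measure M B * H x" using pos(3)[of x] pos(6) m by simp
      then show "t / L \<le> H x" using m pos(6) by (simp add: t_def field_simps)
    qed
  qed
  show thesis
  proof (rule that[OF t(1)])
    have "(\<integral>\<^sup>+x\<in>B. ennreal (U x * H x powr (- \<gamma>)) \<partial>M)
        \<le> (\<integral>\<^sup>+x. ennreal ((t / L) powr (- \<gamma>)) * (ennreal (U x) * indicator B x) \<partial>M)"
    proof (rule nn_integral_mono_AE, use low in eventually_elim)
      case (elim x)
      show ?case
      proof (cases "x \<in> B")
        case True
        have "U x * H x powr (- \<gamma>) \<le> (t / L) powr (- \<gamma>) * U x"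
          using elim True \<gamma> t pos(6) pos(1)[of x] by (subst mult.commute) (intro mult_right_mono powr_mono2', auto)
        then show ?thesis using True by (simp add: ennreal_mult'[symmetric] ennreal_leI)
      qed simp
    qed
    also have "\<dots> = ennreal ((t / L) powr (- \<gamma>)) * (\<integral>\<^sup>+x\<in>B. ennreal (U x) \<partial>M)"
      by (rule nn_integral_cmult) measurable
    also have "\<dots> \<le> ennreal ((t / L) powr (- \<gamma>)) * ennreal (a * measure M B)"
      using a by (rule mult_left_mono) simp
    also have "\<dots> = ennreal (a * (t / L) powr (- \<gamma>) * measure M B)"
      by (subst ennreal_mult'[symmetric]) (auto simp: mult_ac)
    finally show "(\<integral>\<^sup>+x\<in>B. ennreal (U x * H x powr (- \<gamma>)) \<partial>M) \<le> ennreal (a * (t / L) powr (- \<gamma>) * measure M B)" .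
    have "(\<integral>\<^sup>+x\<in>B. ennreal (Z x powr \<theta> * H x powr (1 - \<theta>)) \<partial>M)
        \<le> ennreal (2 * (c * measure M B) powr \<theta> * (t * measure M B) powr (1 - \<theta>))"
      using \<theta> c I t m pos by (intro nn_integral_geometric_mean_le) (auto intro: less_imp_le)
    also have "2 * (c * measure M B) powr \<theta> * (t * measure M B) powr (1 - \<theta>)
        = 2 * c powr \<theta> * t powr (1 - \<theta>) * (measure M B powr \<theta> * measure M B powr (1 - \<theta>))"
      using pos t m by (simp add: powr_mult)
    also have "measure M B powr \<theta> * measure M B powr (1 - \<theta>) = measure M B"
      using m by (simp add: powr_add[symmetric])
    finally show "(\<integral>\<^sup>+x\<in>B. ennreal (Z x powr \<theta> * H x powr (1 - \<theta>)) \<partial>M)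
        \<le> ennreal (2 * c powr \<theta> * t powr (1 - \<theta>) * measure M B)" .
  qed
qed

text \<open>\<open>weight\<close> requires positivity only almost everywhere; this allows passing to
  a version positive at every point.\<close>

lemma Apq_cong_AE:
  assumes p: "p \<noteq> 1" and [measurable]: "w \<in> borel_measurable M" "w' \<in> borel_measurable M"
    and eq: "AE x in M. w x = w' x"
  shows "in_Apq M \<rho> p q w \<longleftrightarrow> in_Apq M \<rho> p q w'" "Apq_const M \<rho> p q w = Apq_const M \<rho> p q w'"
proof -
  have int: "set_integrable M B (\<lambda>x. w x powr t) \<longleftrightarrow> set_integrable M B (\<lambda>x. w' x powr t)"
    and avg: "avg M B (\<lambda>x. w x powr t) = avg M B (\<lambda>x. w' x powr t)" if "B \<in> qballs M \<rho>" for B t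
  proof -
    have [measurable]: "B \<in> sets M" using qballs_D[OF that] by auto
    have ae: "AE x in M. indicator B x *\<^sub>R (w x powr t) = indicator B x *\<^sub>R (w' x powr t)"
      using eq by (auto elim!: eventually_mono)
    show "set_integrable M B (\<lambda>x. w x powr t) \<longleftrightarrow> set_integrable M B (\<lambda>x. w' x powr t)"
      unfolding set_integrable_def by (rule integrable_cong_AE) (use ae in \<open>auto\<close>)
    have "(LINT x:B|M. w x powr t) = (LINT x:B|M. w' x powr t)"
      unfolding set_lebesgue_integral_def by (rule integral_cong_AE) (use ae in \<open>auto\<close>)
    then show "avg M B (\<lambda>x. w x powr t) = avg M B (\<lambda>x. w' x powr t)" by (simp add: avg_def)
  qed
  have im: "(\<lambda>B. avg M B (\<lambda>x. w x powr q) * avg M B (\<lambda>x. w x powr (- (p / (p - 1)))) powr (q * inv_dual p)) ` qballs M \<rho>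
      = (\<lambda>B. avg M B (\<lambda>x. w' x powr q) * avg M B (\<lambda>x. w' x powr (- (p / (p - 1)))) powr (q * inv_dual p)) ` qballs M \<rho>"
    using avg by (intro image_cong) auto
  have "(AE x in M. 0 < w x) \<longleftrightarrow> (AE x in M. 0 < w' x)"
  proof
    assume "AE x in M. 0 < w x"
    with eq show "AE x in M. 0 < w' x" by eventually_elim auto
  next
    assume "AE x in M. 0 < w' x"
    with eq show "AE x in M. 0 < w x" by eventually_elim auto
  qed
  then have "weight M w \<longleftrightarrow> weight M w'" by (simp add: weight_def)
  then show "in_Apq M \<rho> p q w \<longleftrightarrow> in_Apq M \<rho> p q w'"
    unfolding in_Apq_def im using int p by auto
  show "Apq_const M \<rho> p q w = Apq_const M \<rho> p q w'"
    unfolding Apq_const_def im using p by simp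
qed

end

section \<open>Buckley's bound and Rubio de Francia majorants\<close>

locale comparable_balls = homogeneous_space M \<rho> A0 C\<mu>
  for M :: "'a measure" and \<rho> A0 C\<mu> +
  fixes ctr :: "nat \<Rightarrow> 'a" and s :: "nat \<Rightarrow> real" and D :: real
  assumes D_ge_1: "1 \<le> D" and c_space: "ctr n \<in> space M" and s_pos: "0 < s n"
    and dilate: "x \<in> space M \<Longrightarrow> 0 < r \<Longrightarrow> measure M (qb x (3 * A0\<^sup>2 * r)) \<le> D * measure M (qb x r)"
    and cover: "x \<in> space M \<Longrightarrow> 0 < r \<Longrightarrow>
      \<exists>n. qb x r \<subseteq> qb (ctr n) (s n) \<and> measure M (qb (ctr n) (s n)) \<le> D * measure M (qb x r)"
begin

abbreviation "b n \<equiv> qb (ctr n) (s n)"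
abbreviation "b' n \<equiv> qb (ctr n) (3 * A0\<^sup>2 * s n)"

lemma s'_pos: "0 < 3 * A0\<^sup>2 * s n"
  using s_pos[of n] A0_ge_1 by simp

lemma sets_b [measurable]: "b n \<in> sets M" and sets_b' [measurable]: "b' n \<in> sets M"
  using sets_qb[OF c_space] s_pos s'_pos by auto

lemma b_subset_b': "b n \<subseteq> b' n"
proof -
  have "1 * s n \<le> 3 * A0\<^sup>2 * s n"
    using one_le_power[OF A0_ge_1, of 2] s_pos[of n] by (intro mult_right_mono) auto
  then show ?thesis by (auto simp: qball_def)
qed

lemma b_nonempty: "b n \<noteq> {}"
  using centre_in_qb[OF c_space s_pos] by blast

section \<open>Weighted maximal operators on Vitali dilates\<close>

text \<open>Greedy selection: a ball of largest radius engulfs, once dilated, all balls that it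
  meets, and the rest form a smaller family.\<close>

lemma vitali:
  "finite I \<Longrightarrow> \<exists>J\<subseteq>I. disjoint_family_on b J \<and> (\<Union>i\<in>I. b i) \<subseteq> (\<Union>j\<in>J. b' j)"
proof (induction I rule: finite_psubset_induct)
  case (psubset I)
  show ?case
  proof (cases "I = {}")
    case False
    have "Max (s ` I) \<in> s ` I" using psubset(1) False by (intro Max_in) auto
    then obtain i where "i \<in> I" "s i = Max (s ` I)" by auto
    then have i: "i \<in> I" "\<And>j. j \<in> I \<Longrightarrow> s j \<le> s i"
      using psubset(1) by auto
    let ?I = "{j \<in> I. b j \<inter> b i = {}}"
    have "i \<notin> ?I" using b_nonempty[of i] by simp
    then have "?I \<subset> I" using i by blast
    from psubset(2)[OF this] obtain J where J: "J \<subseteq> ?I" "disjoint_family_on b J" "(\<Union>i\<in>?I. b i) \<subseteq> (\<Union>j\<in>J. b' j)"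
      by blast
    have engulf: "b j \<subseteq> b' i" if j: "j \<in> I" "b j \<inter> b i \<noteq> {}" for j
    proof -
      obtain z where "z \<in> b j" "z \<in> b i" using j(2) by blast
      then show ?thesis using i(2)[OF j(1)] by (intro qb_engulf[OF c_space c_space]) auto
    qed
    have "(\<Union>i\<in>I. b i) \<subseteq> (\<Union>j\<in>insert i J. b' j)"
    proof (rule UN_least)
      fix j assume "j \<in> I"
      then consider "j \<in> ?I" | "j \<in> I" "b j \<inter> b i \<noteq> {}" by blast
      then show "b j \<subseteq> (\<Union>j\<in>insert i J. b' j)"
      proof cases
        case 1
        then have "b j \<subseteq> (\<Union>i\<in>?I. b i)" by (rule UN_upper)
        then show ?thesis using J(3) by (simp add: le_supI2)
      next
        case 2
        then show ?thesis using engulf by (simp add: le_supI1)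
      qed
    qed
    moreover have "disjoint_family_on b (insert i J)"
      using J(1,2) by (auto simp: disjoint_family_on_def)
    ultimately show ?thesis using J(1) i(1) by (intro exI[of _ "insert i J"]) auto
  qed (auto simp: disjoint_family_on_def)
qed

text \<open>\<open>f\<close> already carries the weight: \<open>dmax u\<close> applied to the
  product of \<open>g\<close> and \<open>u\<close> replaces the maximal function of \<open>g\<close>
  with respect to the measure with density \<open>u\<close>.\<close>

definition dmax :: "('a \<Rightarrow> ennreal) \<Rightarrow> ('a \<Rightarrow> ennreal) \<Rightarrow> 'a \<Rightarrow> ennreal" where
  "dmax u f x = (SUP n. (\<integral>\<^sup>+y\<in>b n. f y \<partial>M) / (\<integral>\<^sup>+y\<in>b' n. u y \<partial>M) * indicator (b n) x)"

definition mx :: "('a \<Rightarrow> ennreal) \<Rightarrow> 'a \<Rightarrow> ennreal" where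
  "mx f x = (SUP n. (\<integral>\<^sup>+y\<in>b n. f y \<partial>M) / emeasure M (b n) * indicator (b n) x)"

lemma measurable_dmax [measurable]: "dmax u f \<in> borel_measurable M"
  unfolding dmax_def[abs_def] by measurable

lemma measurable_mx [measurable]: "mx f \<in> borel_measurable M"
  unfolding mx_def[abs_def] by measurable

lemma dmax_ge:
  "x \<in> b n \<Longrightarrow> (\<integral>\<^sup>+y\<in>b n. f y \<partial>M) / (\<integral>\<^sup>+y\<in>b' n. u y \<partial>M) \<le> dmax u f x"
  unfolding dmax_def by (intro SUP_upper2[of n]) auto

lemma mx_ge: "x \<in> b n \<Longrightarrow> (\<integral>\<^sup>+y\<in>b n. f y \<partial>M) / emeasure M (b n) \<le> mx f x"
  unfolding mx_def by (intro SUP_upper2[of n]) auto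

text \<open>Finite stages of a supremum of step functions. They are real-valued, their superlevel
  sets are finite unions of balls suited to \<open>vitali\<close>, and they increase to the full
  supremum.\<close>

primrec partial_max :: "(nat \<Rightarrow> real) \<Rightarrow> nat \<Rightarrow> 'a \<Rightarrow> real" where
  "partial_max a 0 x = 0"
| "partial_max a (Suc k) x = max (partial_max a k x) (a k * indicator (b k) x)"

lemma measurable_partial_max [measurable]: "partial_max a k \<in> borel_measurable M"
proof (induction k)
  case (Suc k)
  note this [measurable]
  show ?case unfolding partial_max.simps(2)[abs_def] by measurable
qed simp

lemma partial_max_nonneg: "0 \<le> partial_max a k x"
  by (induction k) auto

lemma partial_max_superlevel:
  assumes "0 < t"
  shows "{x \<in> space M. t \<le> partial_max a k x} = (\<Union>n\<in>{n. n < k \<and> t \<le> a n}. b n)"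
proof (induction k)
  case 0
  then show ?case using assms by auto
next
  case (Suc k)
  have "{x \<in> space M. t \<le> a k * indicator (b k) x} = (if t \<le> a k then b k else {})"
    using assms qb_subset_space by (auto simp: indicator_def split: if_splits)
  moreover have "{n. n < Suc k \<and> t \<le> a n} = (if t \<le> a k then insert k {n. n < k \<and> t \<le> a n} else {n. n < k \<and> t \<le> a n})"
    by (auto simp: less_Suc_eq)
  moreover have "{x \<in> space M. t \<le> partial_max a (Suc k) x} =
      {x \<in> space M. t \<le> partial_max a k x} \<union> {x \<in> space M. t \<le> a k * indicator (b k) x}"
    by (auto simp: le_max_iff_disj)
  ultimately show ?case using Suc by auto
qed

text \<open>A crude bound by one step function, for the a priori finiteness that the absorption in
  \<open>maximal_strong_type\<close> requires.\<close>

lemma partial_max_le: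
  assumes "\<And>n. 0 \<le> a n"
  shows "partial_max a k x \<le> (\<Sum>n<k. a n) * indicator (\<Union>n<k. b n) x"
proof (induction k)
  case (Suc k)
  have "(\<Sum>n<k. a n) * indicator (\<Union>n<k. b n) x \<le> (\<Sum>n<Suc k. a n) * indicator (\<Union>n<Suc k. b n) x"
    using assms by (intro mult_mono) (auto simp: indicator_def sum_nonneg)
  moreover have "a k * indicator (b k) x \<le> (\<Sum>n<Suc k. a n) * indicator (\<Union>n<Suc k. b n) x"
    using assms by (intro mult_mono) (auto simp: indicator_def sum_nonneg)
  ultimately show ?case using Suc by (auto intro: order_trans)
qed simp

lemma SUP_partial_max:
  assumes "\<And>n. 0 \<le> a n"
  shows "(SUP k. ennreal (partial_max a k x)) = (SUP n. ennreal (a n) * indicator (b n) x)"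
proof (rule antisym)
  have "ennreal (partial_max a k x) \<le> (SUP n. ennreal (a n) * indicator (b n) x)" for k
  proof (induction k)
    case (Suc k)
    have "ennreal (a k * indicator (b k) x) \<le> (SUP n. ennreal (a n) * indicator (b n) x)"
      by (intro SUP_upper2[of k]) (auto simp: indicator_def)
    then show ?case using Suc by (auto simp: max_def)
  qed simp
  then show "(SUP k. ennreal (partial_max a k x)) \<le> (SUP n. ennreal (a n) * indicator (b n) x)"
    by (rule SUP_least)
next
  show "(SUP n. ennreal (a n) * indicator (b n) x) \<le> (SUP k. ennreal (partial_max a k x))"
  proof (rule SUP_least)
    fix n
    have "ennreal (a n) * indicator (b n) x \<le> ennreal (partial_max a (Suc n) x)"
      by (auto simp: indicator_def intro: ennreal_leI)
    then show "ennreal (a n) * indicator (b n) x \<le> (SUP k. ennreal (partial_max a k x))"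
      by (rule order_trans) (rule SUP_upper, simp)
  qed
qed

lemma b'_in_qballs: "b' n \<in> qballs M \<rho>"
  using c_space s'_pos by (rule qb_in_qballs)

text \<open>Dilating only in the denominator makes the weak-type constant independent of the
  doubling constant of \<open>u\<close>.\<close>

lemma dmax_strong_type:
  fixes u :: "'a \<Rightarrow> real" and g :: "'a \<Rightarrow> ennreal"
  assumes [measurable]: "u \<in> borel_measurable M" "g \<in> borel_measurable M"
    and u: "\<And>x. 0 < u x" and ufin: "\<And>n. (\<integral>\<^sup>+x\<in>b' n. ennreal (u x) \<partial>M) < \<infinity>" and p: "1 < p"
  shows "(\<integral>\<^sup>+x. ennpow (dmax u (\<lambda>y. g y * ennreal (u y)) x) p * ennreal (u x) \<partial>M)
    \<le> ennreal ((2 * (p / (p - 1))) powr p) * (\<integral>\<^sup>+x. ennpow (g x) p * ennreal (u x) \<partial>M)"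
    (is "?L \<le> ennreal ?C * ?R")
proof (cases "?R = \<infinity>")
  case True
  have "?C \<noteq> 0" using p by auto
  then have "0 < ?C" using powr_ge_zero[of "2 * (p / (p - 1))" p] by linarith
  then show ?thesis unfolding True by (simp add: ennreal_mult_top del: times_divide_eq_right)
next
  case False
  \<comment> \<open>The weight is absorbed into the measure, so the unweighted strong-type lemma
    applies with its weight-free constant.\<close>
  define N where "N = density M (\<lambda>x. ennreal (u x))"
  have N [measurable_cong]: "sets N = sets M" by (simp add: N_def)
  have spN: "space N = space M" by (simp add: N_def)
  interpret M: sigma_finite_measure M by (rule sigma_finite)
  have sfN: "sigma_finite_measure N"
    unfolding N_def by (subst M.sigma_finite_iff_density_finite) auto
  have intN: "(\<integral>\<^sup>+x. f x \<partial>N) = (\<integral>\<^sup>+x. f x * ennreal (u x) \<partial>M)" if "f \<in> borel_measurable M" for f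
    unfolding N_def using that by (subst nn_integral_density) (auto simp: mult.commute)
  have emN: "emeasure N B = (\<integral>\<^sup>+x\<in>B. ennreal (u x) \<partial>M)" if "B \<in> sets M" for B
    unfolding N_def using that by (subst emeasure_density) auto
  define F where "F n = (\<integral>\<^sup>+y\<in>b n. g y * ennreal (u y) \<partial>M)" for n
  define U where "U n = (\<integral>\<^sup>+y\<in>b' n. ennreal (u y) \<partial>M)" for n
  have U: "0 < U n" "U n < \<infinity>" for n
    using nn_integral_qball_pos[OF b'_in_qballs, of u n] u ufin by (auto simp: U_def)
  have F: "F n < \<infinity>" for n
  proof -
    \<comment> \<open>This splits the integral of \<open>g\<close> over a ball into the finite mass
      of \<open>u\<close> and the finite right side, so the coefficients \<open>a n\<close> are real
      numbers.\<close>
    have g1: "y \<le> 1 + ennpow y p" for y :: ennreal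
    proof (cases "y \<le> 1")
      case False
      then have "ennpow y 1 \<le> ennpow y p"
        using p powr_mono[of 1 p] by (cases y) (auto simp: ennpow_ennreal simp del: ennpow_1_right)
      then show ?thesis by (simp add: add_increasing)
    qed (simp add: add_increasing2)
    have "F n \<le> (\<integral>\<^sup>+y. ennreal (u y) * indicator (b' n) y + ennpow (g y) p * ennreal (u y) \<partial>M)"
      unfolding F_def
    proof (rule nn_integral_mono)
      fix y
      have "g y * ennreal (u y) \<le> (1 + ennpow (g y) p) * ennreal (u y)"
        using g1 by (rule mult_right_mono) simp
      then show "g y * ennreal (u y) * indicator (b n) y \<le> ennreal (u y) * indicator (b' n) y + ennpow (g y) p * ennreal (u y)"
        using b_subset_b' by (auto simp: indicator_def distrib_right)
    qed
    also have "\<dots> = U n + ?R" unfolding U_def by (rule nn_integral_add) measurable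
    also have "\<dots> < \<infinity>" using U False by (simp add: less_top)
    finally show ?thesis .
  qed
  define a where "a n = enn2real (F n / U n)" for n
  have a: "ennreal (a n) = F n / U n" "0 \<le> a n" for n
  proof -
    have "F n / U n < top"
      using F[of n] U[of n] by (cases "F n"; cases "U n") (auto simp: divide_ennreal)
    then show "ennreal (a n) = F n / U n" by (simp add: a_def)
  qed (simp add: a_def)
  have le: "(\<integral>\<^sup>+x. ennreal (partial_max a k x powr p) \<partial>N) \<le> ennreal ?C * (\<integral>\<^sup>+x. ennpow (g x) p \<partial>N)" for k
  proof (rule maximal_strong_type[OF sfN p])
    show "partial_max a k \<in> borel_measurable N" "g \<in> borel_measurable N" by measurable
    show "0 \<le> partial_max a k x" for x by (rule partial_max_nonneg)
    show "ennreal t * emeasure N {x \<in> space N. t \<le> partial_max a k x}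
        \<le> (\<integral>\<^sup>+x. g x * indicator {x. t \<le> partial_max a k x} x \<partial>N)" if t: "0 < t" for t
    proof -
      let ?I = "{n. n < k \<and> t \<le> a n}"
      \<comment> \<open>The dilates cover the superlevel set while the selected balls are disjoint
        inside it. Since \<open>a j\<close> divides by the mass of the dilate,
        \<open>t * U j\<close> is at most \<open>F j\<close> and the terms \<open>F j\<close> add up
        to one integral.\<close>
      obtain J where J: "J \<subseteq> ?I" "disjoint_family_on b J" "(\<Union>i\<in>?I. b i) \<subseteq> (\<Union>j\<in>J. b' j)"
        using vitali[of ?I] by auto
      have fJ: "finite J" using J(1) by (rule finite_subset) simp
      have "ennreal t * emeasure N {x \<in> space N. t \<le> partial_max a k x} \<le> ennreal t * emeasure N (\<Union>j\<in>J. b' j)"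
        unfolding spN partial_max_superlevel[OF t] using J(3) fJ
        by (intro mult_left_mono emeasure_mono) (auto simp: N)
      also have "\<dots> \<le> ennreal t * (\<Sum>j\<in>J. emeasure N (b' j))"
        using fJ by (intro mult_left_mono emeasure_subadditive_finite) (auto simp: N)
      also have "\<dots> = (\<Sum>j\<in>J. ennreal t * U j)"
        by (simp add: emN U_def sum_distrib_left)
      also have "\<dots> \<le> (\<Sum>j\<in>J. F j)"
      proof (rule sum_mono)
        fix j assume "j \<in> J"
        then have "ennreal t \<le> F j / U j" using J(1) a(1)[of j] by (auto simp: ennreal_leI simp flip: a(1))
        then have "ennreal t * U j \<le> F j / U j * U j" by (rule mult_right_mono) simp
        also have "\<dots> = F j" using U[of j] by (simp add: ennreal_divide_times ennreal_mult_divide_eq less_top)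
        finally show "ennreal t * U j \<le> F j" .
      qed
      also have "\<dots> = (\<integral>\<^sup>+y. (\<Sum>j\<in>J. g y * ennreal (u y) * indicator (b j) y) \<partial>M)"
        unfolding F_def by (rule nn_integral_sum[symmetric]) measurable
      also have "\<dots> = (\<integral>\<^sup>+y. g y * ennreal (u y) * indicator (\<Union>j\<in>J. b j) y \<partial>M)"
        using J(2) fJ by (simp add: indicator_UN_disjoint sum_distrib_left)
      also have "\<dots> \<le> (\<integral>\<^sup>+y. g y * indicator {x. t \<le> partial_max a k x} y * ennreal (u y) \<partial>M)"
      proof (rule nn_integral_mono)
        fix y
        have "(\<Union>j\<in>J. b j) \<subseteq> {x. t \<le> partial_max a k x}"
          using J(1) partial_max_superlevel[OF t, of a k] by blast
        then show "g y * ennreal (u y) * indicator (\<Union>j\<in>J. b j) y \<le> g y * indicator {x. t \<le> partial_max a k x} y * ennreal (u y)"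
          by (auto simp: indicator_def)
      qed
      also have "\<dots> = (\<integral>\<^sup>+x. g x * indicator {x. t \<le> partial_max a k x} x \<partial>N)"
        by (rule intN[symmetric]) measurable
      finally show ?thesis .
    qed
    show "(\<integral>\<^sup>+x. ennreal (partial_max a k x powr p) \<partial>N) < \<infinity>"
    proof -
      let ?S = "\<Sum>n<k. a n" and ?B = "\<Union>n<k. b' n"
      have "(\<integral>\<^sup>+x. ennreal (partial_max a k x powr p) \<partial>N) \<le> (\<integral>\<^sup>+x. ennreal (?S powr p) * indicator ?B x \<partial>N)"
      proof (rule nn_integral_mono)
        fix x
        have "partial_max a k x \<le> ?S * indicator (\<Union>n<k. b n) x"
          using a(2) by (rule partial_max_le)
        also have "\<dots> \<le> ?S * indicator ?B x"
          using b_subset_b' a(2) by (intro mult_left_mono sum_nonneg) (auto simp: indicator_def)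
        finally have "partial_max a k x powr p \<le> (?S * indicator ?B x) powr p"
          using p by (intro powr_mono2 partial_max_nonneg) auto
        then have "ennreal (partial_max a k x powr p) \<le> ennreal ((?S * indicator ?B x) powr p)"
          by (rule ennreal_leI)
        then show "ennreal (partial_max a k x powr p) \<le> ennreal (?S powr p) * indicator ?B x"
            by (cases "x \<in> ?B") (simp_all only: indicator_simps mult_1_right mult_zero_right, simp_all)
      qed
      also have "\<dots> = ennreal (?S powr p) * emeasure N ?B" by (rule nn_integral_cmult_indicator) measurable
      also have "\<dots> \<le> ennreal (?S powr p) * (\<Sum>n<k. emeasure N (b' n))"
        by (intro mult_left_mono emeasure_subadditive_finite) (auto simp: N)
      also have "\<dots> < \<infinity>"
        using U by (auto simp: emN U_def[symmetric] ennreal_mult_less_top)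
      finally show ?thesis .
    qed
  qed
  have "?L = (\<integral>\<^sup>+x. ennpow (dmax u (\<lambda>y. g y * ennreal (u y)) x) p \<partial>N)"
    by (rule intN[symmetric]) measurable
  also have "\<dots> = (\<integral>\<^sup>+x. (SUP k. ennreal (partial_max a k x powr p)) \<partial>N)"
  proof (rule nn_integral_cong)
    fix x
    have "dmax u (\<lambda>y. g y * ennreal (u y)) x = (SUP k. ennreal (partial_max a k x))"
      unfolding SUP_partial_max[OF a(2)] a(1) by (simp add: dmax_def F_def U_def)
    then show "ennpow (dmax u (\<lambda>y. g y * ennreal (u y)) x) p = (SUP k. ennreal (partial_max a k x powr p))"
      using p by (simp add: ennpow_SUP ennpow_ennreal partial_max_nonneg)
  qed
  also have "\<dots> = (SUP k. \<integral>\<^sup>+x. ennreal (partial_max a k x powr p) \<partial>N)"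
    using p by (intro nn_integral_monotone_convergence_SUP incseq_SucI)
      (auto simp: le_fun_def intro!: ennreal_leI powr_mono2 partial_max_nonneg)
  also have "\<dots> \<le> ennreal ?C * (\<integral>\<^sup>+x. ennpow (g x) p \<partial>N)"
    using le by (rule SUP_least)
  also have "(\<integral>\<^sup>+x. ennpow (g x) p \<partial>N) = ?R" by (rule intN) measurable
  finally show ?thesis .
qed

section \<open>Buckley's bound by Lerner's argument\<close>

text \<open>With r' = r / (r - 1), the three factors come from the dilation constant raised to r',
  the bound of \<open>dmax W\<close> on L^r'(W), and that of \<open>dmax \<sigma>\<close> on
  L^r(sigma).\<close>

definition buckley_const :: "real \<Rightarrow> real" where
  "buckley_const r = (D powr r) powr (r / (r - 1)) *
     (2 * (r / (r - 1) / (r / (r - 1) - 1))) powr (r / (r - 1)) * (2 * (r / (r - 1))) powr r"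

text \<open>Each average factors as (sigma(b')/m) (F/sigma(b')). The Muckenhoupt condition bounds
  the (r-1)-th power of the first factor by a multiple of m/W(b'). The second is at most
  \<open>dmax \<sigma> f\<close> on all of the ball, so m times its power is at most an integral
  over the ball; divided by W(b') this is again an average of \<open>dmax\<close> type.\<close>

lemma mx_le_dmax_dmax:
  fixes W \<sigma> :: "'a \<Rightarrow> real" and f :: "'a \<Rightarrow> ennreal"
  assumes [measurable]: "W \<in> borel_measurable M" "\<sigma> \<in> borel_measurable M" "f \<in> borel_measurable M"
    and W: "\<And>x. 0 < W x" and \<sigma>: "\<And>x. 0 < \<sigma> x"
    and Wfin: "\<And>n. (\<integral>\<^sup>+x\<in>b' n. ennreal (W x) \<partial>M) < \<infinity>"
    and \<sigma>fin: "\<And>n. (\<integral>\<^sup>+x\<in>b' n. ennreal (\<sigma> x) \<partial>M) < \<infinity>"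
    and r: "1 < r" and A: "0 \<le> A"
    and muckenhoupt: "\<And>n. (\<integral>\<^sup>+x\<in>b' n. ennreal (W x) \<partial>M) * ennpow (\<integral>\<^sup>+x\<in>b' n. ennreal (\<sigma> x) \<partial>M) (r - 1)
      \<le> ennreal (A * measure M (b' n) powr r)"
  shows "ennpow (mx f x) (r - 1)
    \<le> ennreal (A * D powr r) * dmax W (\<lambda>y. ennpow (dmax \<sigma> f y) (r - 1)) x"
proof -
  let ?S = "dmax \<sigma> f" and ?V = "dmax W (\<lambda>y. ennpow (dmax \<sigma> f y) (r - 1))"
  have "ennpow ((\<integral>\<^sup>+y\<in>b n. f y \<partial>M) / emeasure M (b n) * indicator (b n) x) (r - 1)
      \<le> ennreal (A * D powr r) * ?V x" for n
  proof (cases "x \<in> b n")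
    case True
    obtain w where w: "(\<integral>\<^sup>+x\<in>b' n. ennreal (W x) \<partial>M) = ennreal w" "0 < w"
      using Wfin[of n] nn_integral_qball_pos[OF b'_in_qballs, of W n] W by (cases "\<integral>\<^sup>+x\<in>b' n. ennreal (W x) \<partial>M") auto
    obtain v where v: "(\<integral>\<^sup>+x\<in>b' n. ennreal (\<sigma> x) \<partial>M) = ennreal v" "0 < v"
      using \<sigma>fin[of n] nn_integral_qball_pos[OF b'_in_qballs, of \<sigma> n] \<sigma> by (cases "\<integral>\<^sup>+x\<in>b' n. ennreal (\<sigma> x) \<partial>M") auto
    define m where "m = measure M (b n)"
    have m: "emeasure M (b n) = ennreal m" "0 < m"
      using emeasure_qb[OF c_space s_pos] measure_qb_pos[OF c_space s_pos] by (auto simp: m_def)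
    define F where "F = (\<integral>\<^sup>+y\<in>b n. f y \<partial>M)"
    \<comment> \<open>The condition is used on the dilated ball; \<open>dilate\<close> returns to
      the measure \<open>m\<close> of the original one at the cost of
      \<open>D powr r\<close>.\<close>
    have "w * v powr (r - 1) \<le> A * measure M (b' n) powr r"
      using muckenhoupt[of n] w v A by (simp add: ennpow_ennreal ennreal_mult'[symmetric])
    also have "\<dots> \<le> A * (D * m) powr r"
      using dilate[OF c_space s_pos, of n] r A by (intro mult_left_mono powr_mono2) (auto simp: m_def)
    also have "\<dots> = A * D powr r * (m * m powr (r - 1))"
      using m D_ge_1 by (simp add: powr_mult powr_mult_base)
    finally have *: "(v / m) powr (r - 1) \<le> A * D powr r * (m / w)"
      using m w v by (simp add: powr_divide field_simps)
    have FS: "F / ennreal v \<le> ?S y" if "y \<in> b n" for y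
      using dmax_ge[OF that, of f \<sigma>] by (simp add: F_def v)
    have "ennpow (F / ennreal v) (r - 1) * ennreal m = (\<integral>\<^sup>+y. ennpow (F / ennreal v) (r - 1) * indicator (b n) y \<partial>M)"
      using m by (simp add: nn_integral_cmult_indicator)
    also have "\<dots> \<le> (\<integral>\<^sup>+y\<in>b n. ennpow (?S y) (r - 1) \<partial>M)"
      using FS r by (intro nn_integral_mono) (auto simp: indicator_def intro: ennpow_mono)
    finally have S: "ennpow (F / ennreal v) (r - 1) * ennreal m \<le> (\<integral>\<^sup>+y\<in>b n. ennpow (?S y) (r - 1) \<partial>M)" .
    have "F / ennreal m = F / ennreal v * ennreal (v / m)"
      using v m by (simp add: divide_ennreal_def inverse_ennreal mult.assoc ennreal_mult'[symmetric] field_simps)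
    then have "ennpow (F / ennreal m) (r - 1) = ennpow (F / ennreal v) (r - 1) * ennreal ((v / m) powr (r - 1))"
      using v m by (simp add: ennpow_mult ennpow_ennreal)
    also have "\<dots> \<le> ennpow (F / ennreal v) (r - 1) * ennreal (A * D powr r * (m / w))"
      using * by (intro mult_left_mono ennreal_leI) auto
    also have "ennreal (A * D powr r * (m / w)) = ennreal (A * D powr r) * (ennreal m * inverse (ennreal w))"
      using A m w by (simp add: inverse_ennreal ennreal_mult'[symmetric] divide_inverse mult.assoc)
    also have "ennpow (F / ennreal v) (r - 1) * (ennreal (A * D powr r) * (ennreal m * inverse (ennreal w)))
        = ennreal (A * D powr r) * (ennpow (F / ennreal v) (r - 1) * ennreal m * inverse (ennreal w))"
      by (simp only: mult_ac)
    also have "\<dots> \<le> ennreal (A * D powr r) * ((\<integral>\<^sup>+y\<in>b n. ennpow (?S y) (r - 1) \<partial>M) / ennreal w)"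
      unfolding divide_ennreal_def using S[unfolded divide_ennreal_def] by (intro mult_left_mono mult_right_mono) auto
    also have "\<dots> \<le> ennreal (A * D powr r) * ?V x"
      using dmax_ge[OF True, of "\<lambda>y. ennpow (?S y) (r - 1)" W] by (intro mult_left_mono) (auto simp: w)
    finally show ?thesis using True by (simp add: F_def m)
  qed simp
  then show ?thesis
    using r unfolding mx_def by (subst ennpow_SUP) (auto intro: SUP_least)
qed

text \<open>The pointwise bound is raised to the power r / (r - 1). Both weighted operators have
  bounds free of the weight, so \<open>A\<close> enters only through that bound; taking r-th roots
  gives the sharp power 1 / (r - 1).\<close>

lemma buckley:
  fixes W \<sigma> :: "'a \<Rightarrow> real" and f :: "'a \<Rightarrow> ennreal"
  assumes [measurable]: "W \<in> borel_measurable M" "\<sigma> \<in> borel_measurable M" "f \<in> borel_measurable M"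
    and W: "\<And>x. 0 < W x" and \<sigma>: "\<And>x. \<sigma> x = W x powr (- 1 / (r - 1))"
    and Wfin: "\<And>n. (\<integral>\<^sup>+x\<in>b' n. ennreal (W x) \<partial>M) < \<infinity>"
    and \<sigma>fin: "\<And>n. (\<integral>\<^sup>+x\<in>b' n. ennreal (\<sigma> x) \<partial>M) < \<infinity>"
    and r: "1 < r" and A: "0 \<le> A"
    and muckenhoupt: "\<And>n. (\<integral>\<^sup>+x\<in>b' n. ennreal (W x) \<partial>M) * ennpow (\<integral>\<^sup>+x\<in>b' n. ennreal (\<sigma> x) \<partial>M) (r - 1)
      \<le> ennreal (A * measure M (b' n) powr r)"
  shows "(\<integral>\<^sup>+x. ennpow (mx f x) r * ennreal (W x) \<partial>M)
    \<le> ennreal (buckley_const r * A powr (r / (r - 1))) * (\<integral>\<^sup>+x. ennpow (f x) r * ennreal (W x) \<partial>M)"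
proof -
  define q where "q = r / (r - 1)"
  have q: "1 < q" and qr: "(r - 1) * q = r" "q - 1 = 1 / (r - 1)" using r by (auto simp: q_def field_simps)
  have \<sigma>0: "0 < \<sigma> x" for x using W[of x] by (simp add: \<sigma>)
  define S where "S = dmax \<sigma> f"
  define V where "V = dmax W (\<lambda>y. ennpow (S y) (r - 1))"
  have [measurable]: "S \<in> borel_measurable M" "V \<in> borel_measurable M" by (auto simp: S_def V_def)
  let ?K1 = "(A * D powr r) powr q" and ?K2 = "(2 * (q / (q - 1))) powr q" and ?K3 = "(2 * (r / (r - 1))) powr r"
  have "ennpow (mx f x) r \<le> ennreal ?K1 * ennpow (V x) q" for x
  proof -
    have "ennpow (ennpow (mx f x) (r - 1)) q \<le> ennpow (ennreal (A * D powr r) * V x) q"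
      unfolding V_def S_def using q W \<sigma>0 Wfin \<sigma>fin r A muckenhoupt
      by (intro ennpow_mono mx_le_dmax_dmax) auto
    then show ?thesis using A by (simp add: ennpow_ennpow qr ennpow_mult ennpow_ennreal)
  qed
  then have "(\<integral>\<^sup>+x. ennpow (mx f x) r * ennreal (W x) \<partial>M) \<le> (\<integral>\<^sup>+x. ennreal ?K1 * (ennpow (V x) q * ennreal (W x)) \<partial>M)"
    by (intro nn_integral_mono) (auto simp: mult.assoc[symmetric] intro: mult_right_mono)
  also have "\<dots> = ennreal ?K1 * (\<integral>\<^sup>+x. ennpow (V x) q * ennreal (W x) \<partial>M)"
    by (rule nn_integral_cmult) measurable
  also have "(\<integral>\<^sup>+x. ennpow (V x) q * ennreal (W x) \<partial>M) \<le> ennreal ?K2 * (\<integral>\<^sup>+x. ennpow (S x) r * ennreal (\<sigma> x) \<partial>M)"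
  proof -
    \<comment> \<open>Division by \<open>W\<close> brings the function into the form required by
      \<open>dmax_strong_type\<close>; the leftover power \<open>W powr (1 - q)\<close> is
      \<open>\<sigma>\<close>.\<close>
    let ?g = "\<lambda>y. ennpow (S y) (r - 1) * ennreal (1 / W y)"
    have gW: "?g y * ennreal (W y) = ennpow (S y) (r - 1)" for y
      using W[of y] by (simp add: mult.assoc ennreal_mult'[symmetric])
    have "(\<integral>\<^sup>+x. ennpow (dmax W (\<lambda>y. ?g y * ennreal (W y)) x) q * ennreal (W x) \<partial>M)
      \<le> ennreal ?K2 * (\<integral>\<^sup>+x. ennpow (?g x) q * ennreal (W x) \<partial>M)"
      using W Wfin q by (intro dmax_strong_type) auto
    also have "(\<lambda>x. ennpow (?g x) q * ennreal (W x)) = (\<lambda>x. ennpow (S x) r * ennreal (\<sigma> x))"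
    proof
      fix x
      have "(1 / W x) powr q * W x = W x powr (- (q - 1))"
        using W[of x] by (simp add: powr_divide powr_diff powr_minus_divide)
      then have "(1 / W x) powr q * W x = \<sigma> x" by (simp add: \<sigma> qr)
      then show "ennpow (?g x) q * ennreal (W x) = ennpow (S x) r * ennreal (\<sigma> x)"
        using W[of x] by (simp add: ennpow_mult ennpow_ennpow qr ennpow_ennreal mult.assoc ennreal_mult'[symmetric])
    qed
    finally show ?thesis unfolding gW V_def[symmetric] .
  qed
  also have "(\<integral>\<^sup>+x. ennpow (S x) r * ennreal (\<sigma> x) \<partial>M) \<le> ennreal ?K3 * (\<integral>\<^sup>+x. ennpow (f x) r * ennreal (W x) \<partial>M)"
  proof -
    \<comment> \<open>Dually, the leftover power \<open>\<sigma> powr (1 - r)\<close> is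
      \<open>W\<close>.\<close>
    let ?g = "\<lambda>y. f y * ennreal (1 / \<sigma> y)"
    have gW: "?g y * ennreal (\<sigma> y) = f y" for y
      using \<sigma>0[of y] by (simp add: mult.assoc ennreal_mult'[symmetric])
    have "(\<integral>\<^sup>+x. ennpow (dmax \<sigma> (\<lambda>y. ?g y * ennreal (\<sigma> y)) x) r * ennreal (\<sigma> x) \<partial>M)
      \<le> ennreal ?K3 * (\<integral>\<^sup>+x. ennpow (?g x) r * ennreal (\<sigma> x) \<partial>M)"
      using \<sigma>0 \<sigma>fin r by (intro dmax_strong_type) auto
    also have "(\<lambda>x. ennpow (?g x) r * ennreal (\<sigma> x)) = (\<lambda>x. ennpow (f x) r * ennreal (W x))"
    proof
      fix x
      have "(1 / \<sigma> x) powr r * \<sigma> x = \<sigma> x powr (- (r - 1))"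
        using \<sigma>0[of x] by (simp add: powr_divide powr_diff powr_minus_divide)
      also have "\<dots> = W x powr ((- 1 / (r - 1)) * - (r - 1))" by (simp only: \<sigma> powr_powr)
      also have "(- 1 / (r - 1)) * - (r - 1) = 1" using r by (simp add: field_simps)
      also have "W x powr 1 = W x" using W[of x] by simp
      finally show "ennpow (?g x) r * ennreal (\<sigma> x) = ennpow (f x) r * ennreal (W x)"
        using \<sigma>0[of x] by (simp add: ennpow_mult ennpow_ennreal mult.assoc ennreal_mult'[symmetric])
    qed
    finally show ?thesis unfolding gW S_def[symmetric] .
  qed
  also have "ennreal ?K1 * (ennreal ?K2 * (ennreal ?K3 * (\<integral>\<^sup>+x. ennpow (f x) r * ennreal (W x) \<partial>M)))
      = ennreal (?K1 * ?K2 * ?K3) * (\<integral>\<^sup>+x. ennpow (f x) r * ennreal (W x) \<partial>M)"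
    by (simp only: mult.assoc ennreal_mult' powr_ge_zero)
  also have "?K1 * ?K2 * ?K3 = buckley_const r * A powr (r / (r - 1))"
    using A unfolding buckley_const_def q_def[symmetric] by (simp add: powr_mult mult_ac)
  finally show ?thesis by (simp add: mult_left_mono)
qed

section \<open>Rubio de Francia iteration\<close>

lemma mx_suminf_le:
  assumes [measurable]: "\<And>k. f k \<in> borel_measurable M"
  shows "mx (\<lambda>y. \<Sum>k. f k y) x \<le> (\<Sum>k. mx (f k) x)"
  unfolding mx_def[of "\<lambda>y. \<Sum>k. f k y"]
proof (rule SUP_least)
  fix n
  have "(\<integral>\<^sup>+y\<in>b n. (\<Sum>k. f k y) \<partial>M) = (\<integral>\<^sup>+y. (\<Sum>k. f k y * indicator (b n) y) \<partial>M)" by simp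
  also have "\<dots> = (\<Sum>k. \<integral>\<^sup>+y\<in>b n. f k y \<partial>M)"
    by (rule nn_integral_suminf) measurable
  finally have "(\<integral>\<^sup>+y\<in>b n. (\<Sum>k. f k y) \<partial>M) / emeasure M (b n) * indicator (b n) x
      = (\<Sum>k. (\<integral>\<^sup>+y\<in>b n. f k y \<partial>M) / emeasure M (b n) * indicator (b n) x)"
    by (simp add: divide_ennreal_def)
  also have "\<dots> \<le> (\<Sum>k. mx (f k) x)"
    unfolding mx_def by (intro suminf_le SUP_upper) auto
  finally show "(\<integral>\<^sup>+y\<in>b n. (\<Sum>k. f k y) \<partial>M) / emeasure M (b n) * indicator (b n) x \<le> (\<Sum>k. mx (f k) x)" .
qed

lemma mx_cmult_le:
  assumes [measurable]: "f \<in> borel_measurable M"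
  shows "mx (\<lambda>y. a * f y) x \<le> a * mx f x"
  unfolding mx_def[of "\<lambda>y. a * f y"]
proof (rule SUP_least)
  fix n
  have "(\<integral>\<^sup>+y\<in>b n. a * f y \<partial>M) = a * (\<integral>\<^sup>+y\<in>b n. f y \<partial>M)"
    by (simp add: mult.assoc nn_integral_cmult)
  then have "(\<integral>\<^sup>+y\<in>b n. a * f y \<partial>M) / emeasure M (b n) * indicator (b n) x
      = a * ((\<integral>\<^sup>+y\<in>b n. f y \<partial>M) / emeasure M (b n) * indicator (b n) x)"
    by (simp add: divide_ennreal_def mult.assoc)
  also have "\<dots> \<le> a * mx f x"
    unfolding mx_def by (intro mult_left_mono SUP_upper) auto
  finally show "(\<integral>\<^sup>+y\<in>b n. a * f y \<partial>M) / emeasure M (b n) * indicator (b n) x \<le> a * mx f x" .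
qed

text \<open>The ratio \<open>1/4\<close> instead of the usual \<open>1/2\<close> lets the sum be compared with a supremum,
  so that no Minkowski inequality is needed.\<close>

lemma rubio_de_francia:
  fixes W h :: "'a \<Rightarrow> real"
  assumes [measurable]: "W \<in> borel_measurable M" "h \<in> borel_measurable M"
    and W: "\<And>x. 0 < W x" and h: "\<And>x. 0 < h x" and r: "1 < r" and N: "0 < N"
    and bound: "\<And>f. f \<in> borel_measurable M \<Longrightarrow> (\<integral>\<^sup>+x. ennpow (mx f x) r * ennreal (W x) \<partial>M)
      \<le> ennreal (N powr r) * (\<integral>\<^sup>+x. ennpow (f x) r * ennreal (W x) \<partial>M)"
    and \<Phi>: "(\<integral>\<^sup>+x. ennreal (h x powr r * W x) \<partial>M) \<le> ennreal \<Phi>"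
  obtains H :: "'a \<Rightarrow> real" where "H \<in> borel_measurable M" "\<And>x. h x \<le> H x"
    "(\<integral>\<^sup>+x. ennreal (H x powr r * W x) \<partial>M) \<le> ennreal (2 powr (r + 1) * \<Phi>)"
    "AE x in M. \<forall>B\<in>qballs M \<rho>. x \<in> B \<longrightarrow> (\<integral>\<^sup>+y\<in>B. ennreal (H y) \<partial>M) \<le> ennreal (4 * N * D * measure M B * H x)"
proof -
  define it where "it k = (mx ^^ k) (\<lambda>x. ennreal (h x))" for k
  have it_Suc: "it (Suc k) = mx (it k)" and it_0: "it 0 = (\<lambda>x. ennreal (h x))" for k by (simp_all add: it_def)
  have [measurable]: "it k \<in> borel_measurable M" for k
    by (cases k) (simp_all add: it_Suc it_0)
  \<comment> \<open>Normalised iterates: each has norm in L^r(W) bounded like that of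
    \<open>h\<close>.\<close>
  define a where "a k x = ennreal ((1 / N) ^ k) * it k x" for k x
  have [measurable]: "a k \<in> borel_measurable M" for k
    unfolding a_def[abs_def] by measurable
  have a: "(\<integral>\<^sup>+x. ennpow (a k x) r * ennreal (W x) \<partial>M) \<le> ennreal \<Phi>" for k
  proof -
    have "(\<integral>\<^sup>+x. ennpow (it k x) r * ennreal (W x) \<partial>M) \<le> ennreal ((N powr r) ^ k) * ennreal \<Phi>"
    proof (induction k)
      case 0
      then show ?case using \<Phi> h by (simp add: it_0 ennpow_ennreal ennreal_mult'[symmetric] less_imp_le)
    next
      case (Suc k)
      have "(\<integral>\<^sup>+x. ennpow (it (Suc k) x) r * ennreal (W x) \<partial>M)
          \<le> ennreal (N powr r) * (\<integral>\<^sup>+x. ennpow (it k x) r * ennreal (W x) \<partial>M)"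
        unfolding it_Suc by (rule bound) measurable
      also have "\<dots> \<le> ennreal (N powr r) * (ennreal ((N powr r) ^ k) * ennreal \<Phi>)"
        using Suc by (rule mult_left_mono) simp
      finally show ?case by (simp add: mult.assoc ennreal_mult')
    qed
    then have "ennreal (((1 / N) ^ k) powr r) * (\<integral>\<^sup>+x. ennpow (it k x) r * ennreal (W x) \<partial>M)
        \<le> ennreal (((1 / N) ^ k) powr r) * (ennreal ((N powr r) ^ k) * ennreal \<Phi>)"
      by (rule mult_left_mono) simp
    also have "ennreal (((1 / N) ^ k) powr r) * (ennreal ((N powr r) ^ k) * ennreal \<Phi>)
        = ennreal (((1 / N) ^ k) powr r * (N powr r) ^ k) * ennreal \<Phi>"
      by (simp only: mult.assoc ennreal_mult' powr_ge_zero)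
    also have "((1 / N) ^ k) powr r * (N powr r) ^ k = 1"
      using N by (simp add: powr_realpow[symmetric] powr_powr powr_mult[symmetric] powr_divide mult.commute
          del: powr_realpow)
    finally show ?thesis
      using N by (simp add: a_def ennpow_mult ennpow_ennreal mult.assoc nn_integral_cmult)
  qed
  define G where "G x = (\<Sum>k. ennreal ((1 / 4) ^ k) * a k x)" for x
  have [measurable]: "G \<in> borel_measurable M" unfolding G_def[abs_def] by measurable
  have hG: "ennreal (h x) \<le> G x" for x
  proof -
    have "ennreal (h x) = (\<Sum>k\<in>{0}. ennreal ((1 / 4) ^ k) * a k x)" by (simp add: a_def it_0)
    also have "\<dots> \<le> G x" unfolding G_def by (rule sum_le_suminf) auto
    finally show ?thesis .
  qed
  have mxG: "mx G x \<le> ennreal (4 * N) * G x" for x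
  proof -
    have "mx G x \<le> (\<Sum>k. mx (\<lambda>y. ennreal ((1 / 4) ^ k) * a k y) x)"
      unfolding G_def[abs_def] by (rule mx_suminf_le) measurable
    also have "\<dots> \<le> (\<Sum>k. ennreal (4 * N) * (ennreal ((1 / 4) ^ Suc k) * a (Suc k) x))"
    proof (rule suminf_le)
      fix k
      have "mx (\<lambda>y. ennreal ((1 / 4) ^ k) * a k y) x = mx (\<lambda>y. ennreal ((1 / 4) ^ k * (1 / N) ^ k) * it k y) x"
        using N by (simp add: a_def mult.assoc ennreal_mult)
      also have "\<dots> \<le> ennreal ((1 / 4) ^ k * (1 / N) ^ k) * it (Suc k) x"
        unfolding it_Suc by (rule mx_cmult_le) measurable
      \<comment> \<open>The maximal operator raises the index by one; the missing factors
        \<open>1 / 4\<close> and \<open>1 / N\<close> are restored by \<open>4 * N\<close>, the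
        future \<open>A_1\<close> constant up to \<open>D\<close>.\<close>
      also have "(1 / 4) ^ k * (1 / N) ^ k = (4 * N) * ((1 / 4) ^ Suc k * (1 / N) ^ Suc k)"
        using N by (simp add: field_simps)
      also have "ennreal ((4 * N) * ((1 / 4) ^ Suc k * (1 / N) ^ Suc k)) * it (Suc k) x
          = ennreal (4 * N) * (ennreal ((1 / 4) ^ Suc k) * a (Suc k) x)"
        using N unfolding a_def by (simp only: mult.assoc[symmetric] ennreal_mult' zero_le_mult_iff
            zero_le_power zero_le_divide_1_iff less_imp_le zero_le_numeral simp_thms)
      finally show "mx (\<lambda>y. ennreal ((1 / 4) ^ k) * a k y) x \<le> ennreal (4 * N) * (ennreal ((1 / 4) ^ Suc k) * a (Suc k) x)" .
    qed auto
    also have "\<dots> = ennreal (4 * N) * (\<Sum>k. ennreal ((1 / 4) ^ Suc k) * a (Suc k) x)"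
      by (rule ennreal_suminf_cmult)
    also have "(\<Sum>k. ennreal ((1 / 4) ^ Suc k) * a (Suc k) x) \<le> G x"
      unfolding G_def by (subst (2) suminf_offset[of _ 1]) (auto simp: add_increasing)
    finally show ?thesis by (simp add: mult_left_mono)
  qed
  have half: "(\<Sum>k. ennreal ((1 / 2) ^ k)) = 2"
    by (subst suminf_ennreal2) (auto simp: suminf_geometric summable_geometric)
  have intG: "(\<integral>\<^sup>+x. ennpow (G x) r * ennreal (W x) \<partial>M) \<le> ennreal (2 powr (r + 1) * \<Phi>)"
  proof -
    have "ennpow (G x) r \<le> ennreal (2 powr r) * (\<Sum>k. ennreal ((1 / 2) ^ k) * ennpow (a k x) r)" for x
    proof -
      \<comment> \<open>Splitting 4^(-k) into 2^(-k) twice bounds the sum by \<open>2 * T\<close>.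
        The power of the supremum is at most the sum of the powers, and a second geometric sum gives
        the remaining 2 in \<open>2 powr (r + 1)\<close>.\<close>
      define T where "T = (SUP k. ennreal ((1 / 2) ^ k) * a k x)"
      have "G x \<le> (\<Sum>k. ennreal ((1 / 2) ^ k) * T)"
        unfolding G_def
      proof (rule suminf_le)
        fix k
        have "ennreal ((1 / 4) ^ k) * a k x = ennreal ((1 / 2) ^ k) * (ennreal ((1 / 2) ^ k) * a k x)"
          by (simp add: mult.assoc[symmetric] ennreal_mult'[symmetric] power_mult_distrib[symmetric] del: power_mult_distrib)
        also have "\<dots> \<le> ennreal ((1 / 2) ^ k) * T" unfolding T_def by (intro mult_left_mono SUP_upper) auto
        finally show "ennreal ((1 / 4) ^ k) * a k x \<le> ennreal ((1 / 2) ^ k) * T" .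
      qed auto
      also have "\<dots> = ennreal 2 * T" by (simp add: half ennreal_suminf_multc)
      finally have "ennpow (G x) r \<le> ennpow (ennreal 2 * T) r" using r by (intro ennpow_mono) auto
      also have "\<dots> = ennreal (2 powr r) * (SUP k. ennpow (ennreal ((1 / 2) ^ k) * a k x) r)"
        using r ennpow_ennreal[of 2 r] by (simp add: ennpow_mult T_def ennpow_SUP)
      also have "(SUP k. ennpow (ennreal ((1 / 2) ^ k) * a k x) r) \<le> (\<Sum>k. ennreal ((1 / 2) ^ k) * ennpow (a k x) r)"
      proof (rule SUP_least)
        fix k
        have "((1 / 2 :: real) ^ k) powr r \<le> ((1 / 2) ^ k) powr 1"
          using r by (intro powr_mono') (auto simp: power_le_one)
        then have "ennpow (ennreal ((1 / 2) ^ k) * a k x) r \<le> ennreal ((1 / 2) ^ k) * ennpow (a k x) r"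
          by (auto simp: ennpow_mult ennpow_ennreal intro!: mult_right_mono ennreal_leI)
        also have "\<dots> = (\<Sum>k\<in>{k}. ennreal ((1 / 2) ^ k) * ennpow (a k x) r)" by simp
        also have "\<dots> \<le> (\<Sum>k. ennreal ((1 / 2) ^ k) * ennpow (a k x) r)" by (rule sum_le_suminf) auto
        finally show "ennpow (ennreal ((1 / 2) ^ k) * a k x) r \<le> (\<Sum>k. ennreal ((1 / 2) ^ k) * ennpow (a k x) r)" .
      qed
      finally show ?thesis by (simp add: mult_left_mono)
    qed
    then have "(\<integral>\<^sup>+x. ennpow (G x) r * ennreal (W x) \<partial>M)
        \<le> (\<integral>\<^sup>+x. ennreal (2 powr r) * (\<Sum>k. ennreal ((1 / 2) ^ k) * ennpow (a k x) r) * ennreal (W x) \<partial>M)"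
      by (intro nn_integral_mono mult_right_mono) auto
    also have "\<dots> = (\<integral>\<^sup>+x. ennreal (2 powr r) * (\<Sum>k. ennreal ((1 / 2) ^ k) * (ennpow (a k x) r * ennreal (W x))) \<partial>M)"
      by (simp add: mult.assoc ennreal_suminf_multc[symmetric])
    also have "\<dots> = ennreal (2 powr r) * (\<Sum>k. ennreal ((1 / 2) ^ k) * (\<integral>\<^sup>+x. ennpow (a k x) r * ennreal (W x) \<partial>M))"
      by (subst nn_integral_cmult) (auto simp: nn_integral_suminf nn_integral_cmult)
    also have "\<dots> \<le> ennreal (2 powr r) * (\<Sum>k. ennreal ((1 / 2) ^ k) * ennreal \<Phi>)"
      using a by (intro mult_left_mono suminf_le) auto
    also have "\<dots> = ennreal (2 powr r) * (ennreal 2 * ennreal \<Phi>)" by (simp add: half ennreal_suminf_multc)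
    also have "\<dots> = ennreal (2 powr (r + 1) * \<Phi>)"
      by (simp only: powr_add mult.assoc ennreal_mult' powr_ge_zero zero_le_numeral powr_one)
    finally show ?thesis .
  qed
  have fin: "AE x in M. G x \<noteq> \<infinity>"
  proof -
    have "AE x in M. ennpow (G x) r * ennreal (W x) \<noteq> \<infinity>"
      using intG by (intro nn_integral_PInf_AE) (auto simp: top_unique)
    then show ?thesis
    proof (rule eventually_mono)
      fix x assume "ennpow (G x) r * ennreal (W x) \<noteq> \<infinity>"
      then show "G x \<noteq> \<infinity>" using W[of x] by (auto simp: ennreal_top_mult)
    qed
  qed
  \<comment> \<open>\<open>G\<close> is finite almost everywhere; using \<open>h\<close> on the
    exceptional set keeps \<open>h x \<le> H x\<close> valid at every point.\<close>
  define H where "H x = (if G x = \<infinity> then h x else enn2real (G x))" for x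
  have HG: "ennreal (H x) = G x" if "G x \<noteq> \<infinity>" for x
    using that by (simp add: H_def less_top)
  show thesis
  proof (rule that[of H])
    show Hm [measurable]: "H \<in> borel_measurable M" unfolding H_def[abs_def] by measurable
    show hH: "h x \<le> H x" for x
    proof (cases "G x = \<infinity>")
      case False
      then have "ennreal (h x) \<le> ennreal (H x)" using hG[of x] HG by simp
      moreover have "0 \<le> H x" using False by (simp add: H_def)
      ultimately show ?thesis by simp
    qed (simp add: H_def)
    have H0: "0 < H x" for x using h[of x] hH[of x] by linarith
    show "(\<integral>\<^sup>+x. ennreal (H x powr r * W x) \<partial>M) \<le> ennreal (2 powr (r + 1) * \<Phi>)"
    proof -
      have "(\<integral>\<^sup>+x. ennreal (H x powr r * W x) \<partial>M) = (\<integral>\<^sup>+x. ennpow (G x) r * ennreal (W x) \<partial>M)"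
      proof (rule nn_integral_cong_AE, use fin in eventually_elim)
        fix x assume "G x \<noteq> \<infinity>"
        then show "ennreal (H x powr r * W x) = ennpow (G x) r * ennreal (W x)"
          using H0[of x] by (simp add: HG[symmetric] ennpow_ennreal ennreal_mult')
      qed
      then show ?thesis using intG by simp
    qed
    show "AE x in M. \<forall>B\<in>qballs M \<rho>. x \<in> B \<longrightarrow> (\<integral>\<^sup>+y\<in>B. ennreal (H y) \<partial>M) \<le> ennreal (4 * N * D * measure M B * H x)"
      using fin
    proof eventually_elim
      case (elim x)
      show ?case
      proof (intro ballI impI)
        fix B assume "B \<in> qballs M \<rho>" and x: "x \<in> B"
        then obtain y t where B: "B = qb y t" "y \<in> space M" "0 < t" by (auto simp: qballs_def)
        \<comment> \<open>An arbitrary ball is enlarged to one of the countable family; this is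
          where \<open>D\<close> enters the \<open>A_1\<close> constant.\<close>
        obtain n where n: "qb y t \<subseteq> b n" "measure M (b n) \<le> D * measure M (qb y t)"
          using cover[OF B(2,3)] by blast
        have m: "emeasure M (b n) = ennreal (measure M (b n))" "0 < measure M (b n)"
          using emeasure_qb[OF c_space s_pos] measure_qb_pos[OF c_space s_pos] by auto
        have "(\<integral>\<^sup>+y\<in>B. ennreal (H y) \<partial>M) = (\<integral>\<^sup>+y\<in>B. G y \<partial>M)"
          by (rule nn_integral_cong_AE, use fin in eventually_elim) (simp add: HG)
        also have "\<dots> \<le> (\<integral>\<^sup>+y\<in>b n. G y \<partial>M)"
          using n(1) B(1) by (intro nn_integral_mono) (auto simp: indicator_def)
        also have "\<dots> = (\<integral>\<^sup>+y\<in>b n. G y \<partial>M) / emeasure M (b n) * emeasure M (b n)"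
          using m by (simp add: ennreal_divide_times ennreal_mult_divide_eq)
        also have "\<dots> \<le> mx G x * emeasure M (b n)"
          using x n(1) B(1) by (intro mult_right_mono mx_ge) auto
        also have "\<dots> \<le> ennreal (4 * N) * ennreal (H x) * ennreal (D * measure M B)"
        proof (rule mult_mono)
          show "mx G x \<le> ennreal (4 * N) * ennreal (H x)" using mxG[of x] by (simp only: HG[OF elim])
          show "emeasure M (b n) \<le> ennreal (D * measure M B)" using n(2) by (simp only: m B(1) ennreal_leI)
        qed auto
        also have "\<dots> = ennreal (4 * N * D * measure M B * H x)"
          using N H0[of x] D_ge_1 by (simp add: ennreal_mult'[symmetric] mult_ac)
        finally show "(\<integral>\<^sup>+y\<in>B. ennreal (H y) \<partial>M) \<le> ennreal (4 * N * D * measure M B * H x)" .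
      qed
    qed
  qed
qed

lemma buckley_const_pos: "1 < r \<Longrightarrow> 0 < buckley_const r"
  using D_ge_1 by (simp add: buckley_const_def field_simps)

text \<open>The part of \<open>4 * N * D\<close> independent of the weight, where the power of
  \<open>A\<close> is split off from Buckley's operator bound \<open>N\<close>.\<close>

definition majorant_const :: "real \<Rightarrow> real" where
  "majorant_const e = 4 * buckley_const (1 + e) powr (1 / (1 + e)) * D"

lemma majorant_const_pos: "0 < e \<Longrightarrow> 0 < majorant_const e"
  using buckley_const_pos[of "1 + e"] D_ge_1 by (simp add: majorant_const_def)

text \<open>Here \<open>1 + e\<close> is the exponent r. The lemma serves W with
  \<open>e = d\<close> and, since r' - 1 = 1 / (r - 1), the dual weight with
  \<open>e = 1 / d\<close>.\<close>

lemma A1_majorant: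
  fixes U Z h :: "'a \<Rightarrow> real"
  assumes [measurable]: "U \<in> borel_measurable M" "h \<in> borel_measurable M"
    and U: "\<And>x. 0 < U x" and Z: "\<And>x. Z x = U x powr (- 1 / e)" and h: "\<And>x. 0 < h x"
    and e: "0 < e" and A: "0 < A"
    and ac: "\<And>B. B \<in> qballs M \<rho> \<Longrightarrow> \<exists>a c. 0 < a \<and> 0 < c \<and>
      (\<integral>\<^sup>+x\<in>B. ennreal (U x) \<partial>M) = ennreal (a * measure M B) \<and>
      (\<integral>\<^sup>+x\<in>B. ennreal (Z x) \<partial>M) = ennreal (c * measure M B) \<and> a * c powr e \<le> A"
    and \<Phi>: "(\<integral>\<^sup>+x. ennreal (h x powr (1 + e) * U x) \<partial>M) \<le> ennreal \<Phi>"
  obtains H :: "'a \<Rightarrow> real" where "H \<in> borel_measurable M" "\<And>x. h x \<le> H x"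
    "(\<integral>\<^sup>+x. ennreal (H x powr (1 + e) * U x) \<partial>M) \<le> ennreal (2 powr (e + 2) * \<Phi>)"
    "AE x in M. \<forall>B\<in>qballs M \<rho>. x \<in> B \<longrightarrow>
      (\<integral>\<^sup>+y\<in>B. ennreal (H y) \<partial>M) \<le> ennreal (majorant_const e * A powr (1 / e) * measure M B * H x)"
proof -
  have Zeq: "Z = (\<lambda>x. U x powr (- 1 / e))" using Z by auto
  have [measurable]: "Z \<in> borel_measurable M" unfolding Zeq by measurable
  define K where "K = buckley_const (1 + e)"
  have K: "0 < K" unfolding K_def using e by (intro buckley_const_pos) auto
  define N where "N = K powr (1 / (1 + e)) * A powr (1 / e)"
  have N: "0 < N" using K A by (simp add: N_def)
  have Nr: "N powr (1 + e) = K * A powr ((1 + e) / (1 + e - 1))"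
    using K A e by (simp add: N_def powr_mult powr_powr)
  have bound: "(\<integral>\<^sup>+x. ennpow (mx f x) (1 + e) * ennreal (U x) \<partial>M)
      \<le> ennreal (N powr (1 + e)) * (\<integral>\<^sup>+x. ennpow (f x) (1 + e) * ennreal (U x) \<partial>M)"
    if [measurable]: "f \<in> borel_measurable M" for f
    unfolding Nr K_def
  proof (rule buckley[where \<sigma> = Z])
    fix n
    obtain a c where *: "0 < a" "0 < c"
      "(\<integral>\<^sup>+x\<in>b' n. ennreal (U x) \<partial>M) = ennreal (a * measure M (b' n))"
      "(\<integral>\<^sup>+x\<in>b' n. ennreal (Z x) \<partial>M) = ennreal (c * measure M (b' n))" "a * c powr e \<le> A"
      using ac[OF b'_in_qballs[of n]] by blast
    have m: "0 < measure M (b' n)" using measure_qb_pos[OF c_space s'_pos] .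
    show "(\<integral>\<^sup>+x\<in>b' n. ennreal (U x) \<partial>M) < \<infinity>" "(\<integral>\<^sup>+x\<in>b' n. ennreal (Z x) \<partial>M) < \<infinity>"
      using * by auto
    have "a * measure M (b' n) * (c * measure M (b' n)) powr e = a * c powr e * (measure M (b' n) powr 1 * measure M (b' n) powr e)"
      using * m by (simp add: powr_mult)
    also have "\<dots> \<le> A * measure M (b' n) powr (1 + e)"
      unfolding powr_add[symmetric] using * by (intro mult_right_mono) auto
    finally show "(\<integral>\<^sup>+x\<in>b' n. ennreal (U x) \<partial>M) * ennpow (\<integral>\<^sup>+x\<in>b' n. ennreal (Z x) \<partial>M) (1 + e - 1)
        \<le> ennreal (A * measure M (b' n) powr (1 + e))"
      using * m by (simp add: ennpow_ennreal ennreal_mult'[symmetric] ennreal_leI)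
  qed (use U Z e A in auto)
  from rubio_de_francia[of U h "1 + e" N \<Phi>, OF _ _ U h _ N bound \<Phi>] e
  obtain H where H: "H \<in> borel_measurable M" "\<And>x. h x \<le> H x"
    "(\<integral>\<^sup>+x. ennreal (H x powr (1 + e) * U x) \<partial>M) \<le> ennreal (2 powr (1 + e + 1) * \<Phi>)"
    "AE x in M. \<forall>B\<in>qballs M \<rho>. x \<in> B \<longrightarrow> (\<integral>\<^sup>+y\<in>B. ennreal (H y) \<partial>M) \<le> ennreal (4 * N * D * measure M B * H x)"
    by auto
  have eq: "4 * N * D = majorant_const e * A powr (1 / e)" "1 + e + 1 = e + 2"
    by (simp_all add: majorant_const_def N_def K_def)
  show thesis using H unfolding eq by (intro that[of H])
qed

end

section \<open>Exponents of the off-diagonal extrapolation\<close>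

text \<open>Turns identities between products of powers into linear identities between
  logarithms.\<close>

lemma eq_if_ln_eq: "0 < x \<Longrightarrow> 0 < y \<Longrightarrow> ln x = ln y \<Longrightarrow> x = (y::real)"
  by simp

locale off_diagonal_exponents =
  fixes p0 q0 p q d0 d l :: real
  assumes p0: "1 \<le> p0" and pq0: "p0 \<le> q0" and p: "1 < p" and pq: "p \<le> q"
    and gap: "1 / p - 1 / q = 1 / p0 - 1 / q0"
  defines "d0 \<equiv> q0 * inv_dual p0" and "d \<equiv> q * inv_dual p" and "l \<equiv> 1 - (1 / p - 1 / q)"
begin

lemma pos: "0 < p" "0 < q" "0 < p0" "0 < q0" "1 < q"
  using p pq p0 pq0 by auto

lemma d_pos: "0 < d" and d0_nonneg: "0 \<le> d0" and d0_pos: "1 < p0 \<Longrightarrow> 0 < d0" and d0_eq_0: "p0 = 1 \<Longrightarrow> d0 = 0"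
  using pos p p0 by (auto simp: d_def d0_def inv_dual_def)

text \<open>Since \<open>gap\<close> makes \<open>l\<close> common to both pairs,
  \<open>1 + d = q * l\<close> and \<open>1 + d0 = q0 * l\<close>; most exponent identities below
  rest on this.\<close>

lemma d_eq: "d = q * l - 1" and d0_eq: "d0 = q0 * l - 1"
proof -
  show "d = q * l - 1" using pos by (simp add: d_def l_def inv_dual_def field_simps)
  show "d0 = q0 * l - 1" using pos unfolding l_def gap by (simp add: d0_def inv_dual_def field_simps)
qed

lemma inv_p: "1 / p = 1 - l + 1 / q" and inv_p0: "1 / p0 = 1 - l + 1 / q0"
  using gap by (simp_all add: l_def)

lemma l_pos: "0 < l"
proof -
  have "0 < q * l" using d_eq d_pos by simp
  then show ?thesis using pos by (simp add: zero_less_mult_iff)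
qed

text \<open>Identifies the weight w^(-p') with the dual weight of w^q, namely (w^q)^(-1/d).\<close>

lemma conj: "p / (p - 1) = q / d" and conj0: "1 < p0 \<Longrightarrow> p0 / (p0 - 1) = q0 / d0"
  using pos p by (auto simp: d_def d0_def inv_dual_def field_simps)

lemma q_less_iff: "q < q0 \<longleftrightarrow> p < p0" and q0_less_iff: "q0 < q \<longleftrightarrow> p0 < p"
proof -
  have "1 / p - 1 / p0 = 1 / q - 1 / q0" using gap by simp
  then have "p0 - p = (q0 - q) / (q * q0) * (p * p0)" using pos by (simp add: field_simps)
  moreover have "0 < p * p0 / (q * q0)" using pos by simp
  ultimately have *: "p0 - p = (q0 - q) * (p * p0 / (q * q0))" "0 < p * p0 / (q * q0)" by simp_all
  then show "q < q0 \<longleftrightarrow> p < p0" "q0 < q \<longleftrightarrow> p0 < p"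
    by (metis diff_gt_0_iff_gt zero_less_mult_pos2 mult_pos_pos)
      (metis * diff_less_0_iff_less mult_neg_pos zero_less_mult_pos2 minus_diff_eq mult_minus_left neg_0_less_iff_less mult_pos_pos)
qed

lemma d_diff: "d0 - d = (q0 - q) * l"
  by (simp add: d_eq d0_eq algebra_simps)

lemma delta: "(d0 - d) / (q0 * (1 + d)) = 1 / q - 1 / q0" "1 / p - 1 / p0 = 1 / q - 1 / q0"
proof -
  have "1 + d = q * l" by (simp add: d_eq)
  then have "(d0 - d) / (q0 * (1 + d)) = (q0 - q) / (q0 * q)" using pos l_pos by (simp add: d_diff)
  also have "\<dots> = 1 / q - 1 / q0" using pos by (simp add: field_simps)
  finally show "(d0 - d) / (q0 * (1 + d)) = 1 / q - 1 / q0" .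
  show "1 / p - 1 / p0 = 1 / q - 1 / q0" using gap by simp
qed

section \<open>Pointwise comparison of the two pairs of norms\<close>

text \<open>\<open>H\<close> occurs with a nonpositive exponent and may be lowered to
  \<open>h\<close>. As h^(1+d) w^q = E, all powers of \<open>w\<close> then cancel and one power of
  \<open>E\<close> remains.\<close>

lemma lower_pointwise_f:
  assumes lt: "q < q0" and w: "0 < w" and E: "0 < E" and f: "0 \<le> f" "f powr p * w powr p \<le> E"
    and h: "h = (E / w powr q) powr (1 / (1 + d))" and H: "h \<le> H"
  shows "f powr p0 * ((w powr q * H powr (- (d0 - d))) powr (1 / q0)) powr p0 \<le> E"
proof -
  have h0: "0 < h" using E w by (simp add: h)
  have dd: "0 \<le> d0 - d" using lt l_pos by (simp add: d_diff)
  have "f powr p0 = (f powr p) powr (p0 / p)" using pos by (simp add: powr_powr)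
  also have "\<dots> \<le> (E * w powr (- p)) powr (p0 / p)"
    using f w pos by (intro powr_mono2) (auto simp: powr_minus field_simps)
  finally have 1: "f powr p0 \<le> (E * w powr (- p)) powr (p0 / p)" .
  have 2: "((w powr q * H powr (- (d0 - d))) powr (1 / q0)) powr p0
      \<le> ((w powr q * h powr (- (d0 - d))) powr (1 / q0)) powr p0"
    using w h0 H dd pos by (intro powr_mono2 mult_left_mono powr_mono2') auto
  let ?x = "(E * w powr (- p)) powr (p0 / p) * ((w powr q * h powr (- (d0 - d))) powr (1 / q0)) powr p0"
  have "f powr p0 * ((w powr q * H powr (- (d0 - d))) powr (1 / q0)) powr p0 \<le> ?x"
    using 1 2 by (intro mult_mono) auto
  also have "?x = E"
  proof -
    have c1: "1 / p - (d0 - d) / (q0 * (1 + d)) = 1 / p0" using delta by simp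
    have c2: "q / q0 - 1 + q * ((d0 - d) / (q0 * (1 + d))) = 0"
      unfolding delta(1) using pos by (simp add: field_simps)
    have lnh: "ln h = 1 / (1 + d) * (ln E - q * ln w)" using E w by (simp add: h ln_div)
    have "ln ?x = p0 / p * (ln E + (- p) * ln w) + p0 * (1 / q0 * (q * ln w + (- (d0 - d)) * ln h))"
      using E w h0 by (simp add: ln_mult)
    also have "\<dots> = p0 * ((1 / p - (d0 - d) / (q0 * (1 + d))) * ln E + (q / q0 - 1 + q * ((d0 - d) / (q0 * (1 + d)))) * ln w)"
      unfolding lnh using pos d_pos by (simp add: divide_simps) (simp add: algebra_simps)
    also have "\<dots> = ln E" unfolding c1 c2 using pos by simp
    finally show ?thesis using E w h0 by (subst (asm) ln_inj_iff) auto
  qed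
  finally show ?thesis .
qed

text \<open>The powers of \<open>H\<close> cancel. The two factors are the integrand controlled by
  the hypothesis and that controlled by the norm of the majorant, ready for the geometric-mean
  lemma.\<close>

lemma lower_pointwise_G:
  assumes w: "0 < w" and H: "0 < H" and G: "0 \<le> G"
  shows "G powr q * w powr q
    = (G powr q0 * (w powr q * H powr (- (d0 - d)))) powr (q / q0) * (H powr (1 + d) * w powr q) powr (1 - q / q0)"
    (is "_ = ?x")
proof (cases "G = 0")
  case False
  have c: "q / q0 * (- (d0 - d)) + (1 - q / q0) * (1 + d) = 0"
  proof -
    have "1 + d = q * l" by (simp add: d_eq)
    then show ?thesis unfolding d_diff using pos by (simp add: field_simps)
  qed
  have "ln ?x = q / q0 * (q0 * ln G + (q * ln w + (- (d0 - d)) * ln H)) + (1 - q / q0) * ((1 + d) * ln H + q * ln w)"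
    using w H G False by (simp add: ln_mult)
  also have "\<dots> = q * ln G + q * ln w + (q / q0 * (- (d0 - d)) + (1 - q / q0) * (1 + d)) * ln H"
    using pos by (simp add: divide_simps) (simp add: algebra_simps)
  also have "\<dots> = ln (G powr q * w powr q)" unfolding c using w G False by (simp add: ln_mult)
  finally show ?thesis using w H G False by (subst (asm) ln_inj_iff) auto
qed (use w H in simp)

text \<open>Now the majorant has a nonnegative exponent and may be lowered to \<open>v\<close>.
  Equality would hold if \<open>E\<close> were exactly G^q w^q and \<open>V\<close> were
  \<open>v\<close>; the excess in \<open>E\<close> only helps.\<close>

lemma upper_pointwise_G:
  assumes lt: "q0 < q" and w: "0 < w" and E: "0 < E" and G: "0 \<le> G" "G powr q * w powr q \<le> E"
    and v: "v = (E / w powr (- (q / d))) powr (1 / (1 + 1 / d))" and V: "v \<le> V"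
  shows "G powr q * w powr q \<le> G powr q0 * ((w powr q) powr (d0 / d) * V powr (1 - d0 / d))"
proof (cases "G = 0")
  case False
  then have G0: "0 < G" using G by simp
  have v0: "0 < v" using E w by (simp add: v)
  have dd: "0 \<le> 1 - d0 / d" using lt l_pos d_pos d_diff by (simp add: divide_simps) (smt (verit) mult_neg_pos)
  let ?x = "G powr q0 * ((w powr q) powr (d0 / d) * v powr (1 - d0 / d))"
  have "1 / (1 + 1 / d) = d / (1 + d)" using d_pos by (simp add: field_simps)
  then have "(1 - d0 / d) * (1 / (1 + 1 / d)) = (d - d0) / (1 + d)" using d_pos by (simp add: left_diff_distrib)
  also have "\<dots> = 1 - q0 / q"
  proof -
    have "d - d0 = (q - q0) * l" "1 + d = q * l" using d_diff d_eq by (auto simp: algebra_simps)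
    then have "(d - d0) / (1 + d) = (q - q0) * l / (q * l)" by (simp only:)
    then show ?thesis using l_pos pos by (simp add: diff_divide_distrib)
  qed
  finally have c1: "(1 - d0 / d) * (1 / (1 + 1 / d)) = 1 - q0 / q" .
  have c2: "q * (d0 / d) + (1 - q0 / q) * (q / d) = q0"
  proof -
    have "q * (d0 / d) + (1 - q0 / q) * (q / d) = (q * d0 + q - q0) / d" using pos d_pos by (simp add: field_simps)
    also have "q * d0 + q - q0 = q0 * d" by (simp add: d_eq d0_eq algebra_simps)
    finally show ?thesis using d_pos by simp
  qed
  have lnE: "q * ln G + q * ln w \<le> ln E"
  proof -
    have "ln (G powr q * w powr q) \<le> ln E" using G G0 w by (intro ln_mono) auto
    then show ?thesis using G0 w by (simp add: ln_mult)
  qed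
  have lt1: "0 \<le> 1 - q0 / q" using lt pos by simp
  have lnv: "ln v = 1 / (1 + 1 / d) * (ln E + q / d * ln w)" using E w by (simp add: v ln_div)
  have "ln ?x = q0 * ln G + (d0 / d * (q * ln w) + (1 - d0 / d) * ln v)"
    using w v0 G0 by (simp add: ln_mult)
  also have "\<dots> = q0 * ln G + q * (d0 / d) * ln w + ((1 - d0 / d) * (1 / (1 + 1 / d))) * (ln E + q / d * ln w)"
    unfolding lnv by (simp only: mult.assoc mult.left_commute add.assoc)
  also have "\<dots> = q0 * ln G + (q * (d0 / d) + (1 - q0 / q) * (q / d)) * ln w + (1 - q0 / q) * ln E"
    unfolding c1 by (simp only: distrib_left distrib_right mult.assoc add_ac)
  also have "\<dots> = q0 * ln G + q0 * ln w + (1 - q0 / q) * ln E" unfolding c2 ..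
  also have "\<dots> \<ge> q0 * ln G + q0 * ln w + (1 - q0 / q) * (q * ln G + q * ln w)"
    using lnE lt1 by (intro add_left_mono mult_left_mono)
  also have "q0 * ln G + q0 * ln w + (1 - q0 / q) * (q * ln G + q * ln w) = ln (G powr q * w powr q)"
    using G0 w pos by (simp add: ln_mult field_simps)
  finally have "ln (G powr q * w powr q) \<le> ln ?x" .
  then have "G powr q * w powr q \<le> ?x" using G0 w v0 by (subst (asm) ln_le_cancel_iff) auto
  also have "\<dots> \<le> G powr q0 * ((w powr q) powr (d0 / d) * V powr (1 - d0 / d))"
    using V v0 dd by (intro mult_left_mono powr_mono2) auto
  finally show ?thesis .
qed simp

text \<open>A factorisation with weights \<open>p0 / p\<close> and \<open>1 - p0 / p\<close>, which
  bounds the \<open>p0\<close>-norm of \<open>f\<close> by its \<open>p\<close>-norm and the norm of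
  the majorant.\<close>

lemma upper_pointwise_f:
  assumes w: "0 < w" and V: "0 < V" and f: "0 \<le> f"
  shows "f powr p0 * (((w powr q) powr (d0 / d) * V powr (1 - d0 / d)) powr (1 / q0)) powr p0
    = (f powr p * w powr p) powr (p0 / p) * (V powr (1 + 1 / d) * w powr (- (q / d))) powr (1 - p0 / p)"
    (is "?x = ?y")
proof (cases "f = 0")
  case False
  have e: "1 - p0 / p = p0 * (1 / q0 - 1 / q)"
  proof -
    have "1 - p0 / p = p0 * (1 / p0 - 1 / p)" using pos by (simp add: field_simps)
    then show ?thesis using delta(2) by simp
  qed
  have "p0 * (1 / q0) * (1 - d0 / d) = p0 * ((d - d0) / (q0 * d))" using pos d_pos by (simp add: field_simps)
  also have "d - d0 = (q - q0) * l" using d_diff by (simp add: algebra_simps)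
  also have "p0 * ((q - q0) * l / (q0 * d)) = (p0 * (1 / q0 - 1 / q)) * ((q * l) / d)"
    using pos d_pos by (simp add: field_simps)
  also have "\<dots> = (1 - p0 / p) * (1 + 1 / d)" unfolding e using d_pos d_eq by (simp add: field_simps)
  finally have c1: "p0 * (1 / q0) * (1 - d0 / d) = (1 - p0 / p) * (1 + 1 / d)" .
  have c2: "p0 * (1 / q0) * (d0 / d * q) = p0 / p * p - (1 - p0 / p) * (q / d)"
  proof -
    have "p0 / p * p - (1 - p0 / p) * (q / d) = p0 * (d * q0 - q + q0) / (d * q0)"
      unfolding e using pos d_pos by (simp add: field_simps)
    also have "d * q0 - q + q0 = q * d0" by (simp add: d_eq d0_eq algebra_simps)
    finally have eq: "p0 / p * p - (1 - p0 / p) * (q / d) = p0 * (q * d0) / (d * q0)" .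
    show ?thesis unfolding eq by (simp add: mult_ac)
  qed
  have "ln ?x = p0 * ln f + p0 * (1 / q0 * (d0 / d * (q * ln w) + (1 - d0 / d) * ln V))"
    using w V f False by (simp add: ln_mult)
  also have "\<dots> = p0 * ln f + (p0 * (1 / q0) * (d0 / d * q)) * ln w + (p0 * (1 / q0) * (1 - d0 / d)) * ln V"
    by (simp only: distrib_left mult.assoc add.assoc)
  also have "\<dots> = p0 / p * (p * ln f + p * ln w) + (1 - p0 / p) * ((1 + 1 / d) * ln V + (- (q / d)) * ln w)"
    unfolding c1 c2 using pos by (simp add: algebra_simps add_divide_distrib diff_divide_distrib)
  also have "\<dots> = ln ?y"
    using w V f False by (simp add: ln_mult)
  finally show ?thesis using w V f False by (subst (asm) ln_inj_iff) auto
qed simp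

section \<open>Constants of the new weights and of the final estimates\<close>

text \<open>The exponents of \<open>t\<close> sum to zero. The \<open>A_1\<close> constant
  contributes A^((d0-d)/d) and the original weight one more \<open>A\<close>, together
  A^(d0/d).\<close>

lemma lower_Apq_bound:
  assumes lt: "p < p0" and pos': "0 < a" "0 < c" "0 < t" "0 < m" "0 < A" and ac: "a * c powr d \<le> A"
  shows "a * (t / (m * A powr (1 / d))) powr (- (d0 - d)) * (2 * c powr (d / d0) * t powr (1 - d / d0)) powr d0
    \<le> 2 powr d0 * m powr (d0 - d) * A powr (d0 / d)"
proof -
  have d0: "0 < d0" using lt p by (intro d0_pos) auto
  let ?L = "m * A powr (1 / d)"
  have "a * (t / ?L) powr (- (d0 - d)) * (2 * c powr (d / d0) * t powr (1 - d / d0)) powr d0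
      = 2 powr d0 * ?L powr (d0 - d) * (a * c powr d)"
  proof (rule eq_if_ln_eq)
    have "ln (a * (t / ?L) powr (- (d0 - d)) * (2 * c powr (d / d0) * t powr (1 - d / d0)) powr d0)
        = ln a + (- (d0 - d)) * (ln t - (ln m + 1 / d * ln A)) + d0 * (ln 2 + d / d0 * ln c + (1 - d / d0) * ln t)"
      using pos' by (simp add: ln_mult ln_div)
    also have "\<dots> = d0 * ln 2 + (d0 - d) * (ln m + 1 / d * ln A) + (ln a + d * ln c)"
      using d0 by (simp add: algebra_simps diff_divide_distrib)
    also have "\<dots> = ln (2 powr d0 * ?L powr (d0 - d) * (a * c powr d))"
      using pos' by (simp add: ln_mult)
    finally show "ln (a * (t / ?L) powr (- (d0 - d)) * (2 * c powr (d / d0) * t powr (1 - d / d0)) powr d0)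
        = ln (2 powr d0 * ?L powr (d0 - d) * (a * c powr d))" .
  qed (use pos' in auto)
  also have "\<dots> \<le> 2 powr d0 * ?L powr (d0 - d) * A"
    using ac by (intro mult_left_mono) auto
  also have "\<dots> = 2 powr d0 * m powr (d0 - d) * A powr (d0 / d)"
  proof (rule eq_if_ln_eq)
    show "ln (2 powr d0 * ?L powr (d0 - d) * A) = ln (2 powr d0 * m powr (d0 - d) * A powr (d0 / d))"
      using pos' d_pos by (simp add: ln_mult) (simp add: field_simps)
  qed (use pos' in auto)
  finally show ?thesis .
qed

text \<open>Again \<open>t\<close> cancels; the original weight contributes the power
  \<open>d0 / d\<close> of \<open>A\<close> and the majorant the complementary power, together the
  first power.\<close>

lemma upper_Apq_bound:
  assumes lt: "p0 < p" and p0: "1 < p0" and pos': "0 < a" "0 < c" "0 < t" "0 < m" "0 < A" and ac: "a * c powr d \<le> A"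
  shows "2 * a powr (d0 / d) * t powr (1 - d0 / d) * (c * (t / (m * A)) powr (- ((1 - d0 / d) / d0))) powr d0
    \<le> 2 * m powr (1 - d0 / d) * A"
proof -
  have d0: "0 < d0" using p0 by (intro d0_pos) auto
  have "2 * a powr (d0 / d) * t powr (1 - d0 / d) * (c * (t / (m * A)) powr (- ((1 - d0 / d) / d0))) powr d0
      = 2 * m powr (1 - d0 / d) * A powr (1 - d0 / d) * (a * c powr d) powr (d0 / d)"
  proof (rule eq_if_ln_eq)
    have "ln (2 * a powr (d0 / d) * t powr (1 - d0 / d) * (c * (t / (m * A)) powr (- ((1 - d0 / d) / d0))) powr d0)
        = ln 2 + d0 / d * ln a + (1 - d0 / d) * ln t + d0 * (ln c + (- ((1 - d0 / d) / d0)) * (ln t - (ln m + ln A)))"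
      using pos' by (simp add: ln_mult ln_div)
    also have "\<dots> = ln 2 + (1 - d0 / d) * ln m + (1 - d0 / d) * ln A + d0 / d * (ln a + d * ln c)"
    proof -
      have 1: "d0 * (- ((1 - d0 / d) / d0)) = - (1 - d0 / d)" using d0 by simp
      have 2: "d0 * (ln c + (- ((1 - d0 / d) / d0)) * (ln t - (ln m + ln A)))
          = d0 * ln c + - (1 - d0 / d) * (ln t - (ln m + ln A))"
        unfolding distrib_left mult.assoc[symmetric] 1 ..
      have 3: "d0 / d * (ln a + d * ln c) = d0 / d * ln a + d0 * ln c" using d_pos by (simp add: distrib_left)
      show ?thesis unfolding 2 3 by (simp add: algebra_simps)
    qed
    also have "\<dots> = ln (2 * m powr (1 - d0 / d) * A powr (1 - d0 / d) * (a * c powr d) powr (d0 / d))"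
      using pos' by (simp add: ln_mult)
    finally show "ln (2 * a powr (d0 / d) * t powr (1 - d0 / d) * (c * (t / (m * A)) powr (- ((1 - d0 / d) / d0))) powr d0)
      = ln (2 * m powr (1 - d0 / d) * A powr (1 - d0 / d) * (a * c powr d) powr (d0 / d))" .
  qed (use pos' in auto)
  also have "\<dots> \<le> 2 * m powr (1 - d0 / d) * A powr (1 - d0 / d) * A powr (d0 / d)"
    using ac pos' d0 d_pos by (intro mult_left_mono powr_mono2) auto
  also have "\<dots> = 2 * m powr (1 - d0 / d) * A"
    using pos' by (simp add: mult.assoc powr_add[symmetric])
  finally show ?thesis .
qed

lemma lower_final:
  assumes pos': "0 < C" "0 < k" "0 < A" "0 < F"
  shows "2 * ((C * (k * A powr (d0 / d)) powr \<alpha> * F powr (1 / p0)) powr q0) powr (q / q0) * (2 powr (d + 2) * F) powr (1 - q / q0)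
    = ((2 * (2 powr (d + 2)) powr (1 - q / q0)) powr (1 / q) * k powr \<alpha> * C * A powr (\<alpha> * (d0 / d)) * F powr (1 / p)) powr q"
    (is "?x = ?y")
proof (rule eq_if_ln_eq)
  have e: "q * (1 / p) = q * (1 / p0) + (1 - q / q0)"
    unfolding inv_p inv_p0 using pos by (simp add: right_diff_distrib distrib_left)
  have "ln ?x = ln 2 + q / q0 * (q0 * (ln C + \<alpha> * (ln k + d0 / d * ln A) + 1 / p0 * ln F)) + (1 - q / q0) * ((d + 2) * ln 2 + ln F)"
    using pos' by (simp add: ln_mult)
  also have "\<dots> = ln 2 + (1 - q / q0) * ((d + 2) * ln 2) + q * ln C + q * \<alpha> * ln k + q * (\<alpha> * (d0 / d)) * ln A + (q * (1 / p0) + (1 - q / q0)) * ln F"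
    using pos by (simp add: algebra_simps)
  also have "\<dots> = q * (1 / q * (ln 2 + (1 - q / q0) * ((d + 2) * ln 2)) + \<alpha> * ln k + ln C + \<alpha> * (d0 / d) * ln A + 1 / p * ln F)"
    unfolding e[symmetric] using pos by (simp add: distrib_left)
  also have "\<dots> = ln ?y" using pos' by (simp add: ln_mult)
  finally show "ln ?x = ln ?y" .
qed (use pos' in auto)

text \<open>On the right \<open>Y\<close> has total exponent 1 - q0/q, so moving it to the left
  leaves Y^(q0/q); raising to the power q/q0 solves for \<open>Y\<close>. Taking logarithms uses
  that \<open>Y\<close> is finite and positive.\<close>

lemma upper_final:
  assumes pos': "0 < C" "0 < Q" "0 < K" "0 < \<Phi>" "0 < Y"
    and le: "Y \<le> (C * Q * (2 * \<Phi> powr (p0 / p) * (K * Y) powr (1 - p0 / p)) powr (1 / p0)) powr q0"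
  shows "Y \<le> ((2 * K powr (1 - p0 / p)) powr (1 / p0) * Q * C * \<Phi> powr (1 / p)) powr q"
    (is "Y \<le> ?y")
proof -
  have e: "q0 * (1 / p0 * (1 - p0 / p)) = 1 - q0 / q"
  proof -
    have "1 / p0 * (1 - p0 / p) = 1 / p0 - 1 / p" using pos by (simp add: right_diff_distrib)
    also have "\<dots> = 1 / q0 - 1 / q" using delta(2) by simp
    finally show ?thesis using pos by (simp add: right_diff_distrib)
  qed
  have "ln Y \<le> ln ((C * Q * (2 * \<Phi> powr (p0 / p) * (K * Y) powr (1 - p0 / p)) powr (1 / p0)) powr q0)"
    using le pos' by (intro ln_mono) auto
  also have "\<dots> = q0 * (ln C + ln Q + 1 / p0 * (ln 2 + p0 / p * ln \<Phi> + (1 - p0 / p) * (ln K + ln Y)))"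
    using pos' by (simp add: ln_mult)
  also have "\<dots> = q0 * (ln C + ln Q + 1 / p0 * (ln 2 + (1 - p0 / p) * ln K) + 1 / p * ln \<Phi>) + (q0 * (1 / p0 * (1 - p0 / p))) * ln Y"
    using pos by (simp add: distrib_left)
  finally have "q0 / q * ln Y \<le> q0 * (ln C + ln Q + 1 / p0 * (ln 2 + (1 - p0 / p) * ln K) + 1 / p * ln \<Phi>)"
    unfolding e by (simp add: left_diff_distrib)
  then have "q / q0 * (q0 / q * ln Y) \<le> q / q0 * (q0 * (ln C + ln Q + 1 / p0 * (ln 2 + (1 - p0 / p) * ln K) + 1 / p * ln \<Phi>))"
    using pos by (intro mult_left_mono) auto
  then have "ln Y \<le> q * (1 / p0 * (ln 2 + (1 - p0 / p) * ln K) + ln Q + ln C + 1 / p * ln \<Phi>)"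
    using pos by (simp add: add_ac)
  also have "\<dots> = ln ?y" using pos' by (simp add: ln_mult)
  finally show ?thesis using pos' by (subst (asm) ln_le_cancel_iff) auto
qed

end

section \<open>Extrapolation\<close>

locale extrapolation =
  comparable_balls M \<rho> A0 C\<mu> ctr s D + off_diagonal_exponents p0 q0 p q d0 d l
  for M :: "'a measure" and \<rho> A0 C\<mu> and ctr :: "nat \<Rightarrow> 'a" and s D p0 q0 p q d0 d l
begin

text \<open>The prefactor of \<open>lower_final\<close>; \<open>2 powr (1 / p)\<close> pays for the
  perturbation, which doubles the bound for the integral of |f|^p w^p.\<close>

definition lower_const :: "real \<Rightarrow> real" where
  "lower_const \<alpha> = (2 * (2 powr (d + 2)) powr (1 - q / q0)) powr (1 / q) *
     (2 powr d0 * majorant_const d powr (d0 - d)) powr \<alpha> * 2 powr (1 / p)"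

definition upper_const :: "real \<Rightarrow> real" where
  "upper_const \<alpha> = (2 * (2 powr (1 / d + 2) * 2) powr (1 - p0 / p)) powr (1 / p0) *
     (2 * majorant_const (1 / d) powr (1 - d0 / d)) powr \<alpha>"

lemma weight_averages:
  assumes w: "\<And>x. 0 < w x" and A: "in_Apq M \<rho> p q w" and B: "B \<in> qballs M \<rho>"
  obtains a c where "0 < a" "0 < c"
    "(\<integral>\<^sup>+x\<in>B. ennreal (w x powr q) \<partial>M) = ennreal (a * measure M B)"
    "(\<integral>\<^sup>+x\<in>B. ennreal (w x powr (- (q / d))) \<partial>M) = ennreal (c * measure M B)"
    "a * c powr d \<le> Apq_const M \<rho> p q w"
  using Apq_elim[OF p w A B] unfolding conj d_def[symmetric] by blast

text \<open>\<open>G\<close> stands for a measurable minorant of |T f|; \<open>hyp\<close> is the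
  assumed inequality, stated for integrals so that it passes to \<open>G\<close>.\<close>

lemma extrapolate_below:
  fixes w f G :: "'a \<Rightarrow> real"
  assumes lt: "p < p0" and \<alpha>: "0 < \<alpha>" and C: "0 < C" and w: "\<And>x. 0 < w x" and A: "in_Apq M \<rho> p q w"
    and [measurable]: "f \<in> borel_measurable M" "G \<in> borel_measurable M" and G: "\<And>x. 0 \<le> G x"
    and \<Phi>: "0 < \<Phi>" "(\<integral>\<^sup>+x. ennreal (\<bar>f x\<bar> powr p * w x powr p) \<partial>M) \<le> ennreal \<Phi>"
    and hyp: "\<And>w0 \<Psi>. in_Apq M \<rho> p0 q0 w0 \<Longrightarrow> 0 < \<Psi> \<Longrightarrow>
      (\<integral>\<^sup>+x. ennreal (\<bar>f x\<bar> powr p0 * w0 x powr p0) \<partial>M) \<le> ennreal \<Psi> \<Longrightarrow>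
      (\<integral>\<^sup>+x. ennreal (G x powr q0 * w0 x powr q0) \<partial>M)
        \<le> ennreal ((C * Apq_const M \<rho> p0 q0 w0 powr \<alpha> * \<Psi> powr (1 / p0)) powr q0)"
  shows "(\<integral>\<^sup>+x. ennreal (G x powr q * w x powr q) \<partial>M)
    \<le> ennreal ((lower_const \<alpha> * C * Apq_const M \<rho> p q w powr (\<alpha> * (d0 / d)) * \<Phi> powr (1 / p)) powr q)"
proof -
  have [measurable]: "w \<in> borel_measurable M" using A by (simp add: in_Apq_def weight_def)
  define AA where "AA = Apq_const M \<rho> p q w"
  have AA: "0 < AA" unfolding AA_def using p w A by (rule Apq_const_pos)
  have lt': "q < q0" using lt q_less_iff by simp
  have p01: "1 < p0" using lt p by simp
  have d0: "0 < d0" using p01 by (rule d0_pos)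
  have dd: "0 < d0 - d" using lt' l_pos by (simp add: d_diff)
  obtain \<phi> where [measurable]: "\<phi> \<in> borel_measurable M" and \<phi>: "\<And>x. 0 < \<phi> x" "(\<integral>\<^sup>+x. ennreal (\<phi> x) \<partial>M) \<le> ennreal \<Phi>"
    using positive_integrable_function[OF sigma_finite \<Phi>(1)] by blast
  define E where "E x = \<bar>f x\<bar> powr p * w x powr p + \<phi> x" for x
  have [measurable]: "E \<in> borel_measurable M" unfolding E_def[abs_def] by measurable
  have E: "0 < E x" "\<bar>f x\<bar> powr p * w x powr p \<le> E x" for x
    using \<phi>(1)[of x] by (auto simp: E_def add_nonneg_pos less_imp_le)
  have intE: "(\<integral>\<^sup>+x. ennreal (E x) \<partial>M) \<le> ennreal (2 * \<Phi>)"
  proof -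
    have "(\<integral>\<^sup>+x. ennreal (E x) \<partial>M) = (\<integral>\<^sup>+x. ennreal (\<bar>f x\<bar> powr p * w x powr p) \<partial>M) + (\<integral>\<^sup>+x. ennreal (\<phi> x) \<partial>M)"
      unfolding E_def using \<phi>(1) by (subst nn_integral_add[symmetric]) (auto simp: less_imp_le intro!: nn_integral_cong ennreal_plus)
    also have "\<dots> \<le> ennreal \<Phi> + ennreal \<Phi>" using \<phi>(2) \<Phi>(2) by (rule add_mono[rotated])
    finally show ?thesis using \<Phi>(1) by (simp add: ennreal_plus[symmetric] del: ennreal_plus)
  qed
  define h where "h x = (E x / w x powr q) powr (1 / (1 + d))" for x
  have [measurable]: "h \<in> borel_measurable M" unfolding h_def[abs_def] by measurable
  have h0: "0 < h x" for x using E(1)[of x] w[of x] by (simp add: h_def)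
  have hE: "h x powr (1 + d) * w x powr q = E x" for x
    using E(1)[of x] w[of x] d_pos by (simp add: h_def powr_powr)
  define m where "m = majorant_const d"
  have m: "0 < m" unfolding m_def using d_pos by (rule majorant_const_pos)
  obtain H :: "'a \<Rightarrow> real" where [measurable]: "H \<in> borel_measurable M" and H: "\<And>x. h x \<le> H x"
    "(\<integral>\<^sup>+x. ennreal (H x powr (1 + d) * w x powr q) \<partial>M) \<le> ennreal (2 powr (d + 2) * (2 * \<Phi>))"
    "AE x in M. \<forall>B\<in>qballs M \<rho>. x \<in> B \<longrightarrow>
      (\<integral>\<^sup>+y\<in>B. ennreal (H y) \<partial>M) \<le> ennreal (m * AA powr (1 / d) * measure M B * H x)"
  proof (rule A1_majorant[of "\<lambda>x. w x powr q" h "\<lambda>x. w x powr (- (q / d))" d AA "2 * \<Phi>"])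
    show "\<exists>a c. 0 < a \<and> 0 < c \<and> (\<integral>\<^sup>+x\<in>B. ennreal (w x powr q) \<partial>M) = ennreal (a * measure M B) \<and>
        (\<integral>\<^sup>+x\<in>B. ennreal (w x powr (- (q / d))) \<partial>M) = ennreal (c * measure M B) \<and> a * c powr d \<le> AA"
      if B: "B \<in> qballs M \<rho>" for B
      by (rule weight_averages[OF w A B, folded AA_def]) blast
    show "(\<integral>\<^sup>+x. ennreal (h x powr (1 + d) * w x powr q) \<partial>M) \<le> ennreal (2 * \<Phi>)" using intE by (simp add: hE)
  qed (use w h0 d_pos AA in \<open>auto simp: powr_powr m_def less_imp_neq[THEN not_sym]\<close>)
  have H0: "0 < H x" for x using h0[of x] H(1)[of x] by linarith
  define W0 where "W0 x = w x powr q * H x powr (- (d0 - d))" for x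
  have W0: "0 < W0 x" for x using w[of x] H0[of x] by (simp add: W0_def)
  define w0 where "w0 x = W0 x powr (1 / q0)" for x
  have [measurable]: "w0 \<in> borel_measurable M" unfolding w0_def[abs_def] W0_def[abs_def] by measurable
  have w0: "0 < w0 x" "w0 x powr q0 = W0 x" for x using W0[of x] pos by (auto simp: w0_def powr_powr)
  \<comment> \<open>The dual weight of \<open>w0\<close> is a geometric mean of the old dual weight
    and \<open>H\<close>, because \<open>d < d0\<close>.\<close>
  have w0': "w0 x powr (- (p0 / (p0 - 1))) = (w x powr (- (q / d))) powr (d / d0) * H x powr (1 - d / d0)" for x
  proof (rule eq_if_ln_eq)
    have "ln (w0 x powr (- (p0 / (p0 - 1)))) = - (q0 / d0) * (1 / q0 * (q * ln (w x) + (- (d0 - d)) * ln (H x)))"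
      using w[of x] H0[of x] by (simp add: w0_def W0_def conj0[OF p01] ln_mult)
    also have "\<dots> = d / d0 * (- (q / d) * ln (w x)) + (1 - d / d0) * ln (H x)"
      using pos d_pos d0 by (simp add: divide_simps) (simp add: algebra_simps)
    finally show "ln (w0 x powr (- (p0 / (p0 - 1)))) = ln ((w x powr (- (q / d))) powr (d / d0) * H x powr (1 - d / d0))"
      using w[of x] H0[of x] by (simp add: ln_mult)
  qed (use w[of x] H0[of x] w0[of x] in auto)
  define k where "k = 2 powr d0 * m powr (d0 - d)"
  have k: "0 < k" using m by (simp add: k_def)
  define Q where "Q = k * AA powr (d0 / d)"
  have Q: "0 < Q" using k AA by (simp add: Q_def)
  have "\<exists>a c. 0 \<le> a \<and> 0 \<le> c \<and>
      (\<integral>\<^sup>+x\<in>B. ennreal (w0 x powr q0) \<partial>M) \<le> ennreal (a * measure M B) \<and>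
      (\<integral>\<^sup>+x\<in>B. ennreal (w0 x powr (- (p0 / (p0 - 1)))) \<partial>M) \<le> ennreal (c * measure M B) \<and>
      a * c powr (q0 * inv_dual p0) \<le> Q" if B: "B \<in> qballs M \<rho>" for B
  proof -
    obtain a c where ac: "0 < a" "0 < c"
      "(\<integral>\<^sup>+x\<in>B. ennreal (w x powr q) \<partial>M) = ennreal (a * measure M B)"
      "(\<integral>\<^sup>+x\<in>B. ennreal (w x powr (- (q / d))) \<partial>M) = ennreal (c * measure M B)"
      "a * c powr d \<le> AA"
      using weight_averages[OF w A B] unfolding AA_def by blast
    obtain t where t: "0 < t"
      "(\<integral>\<^sup>+x\<in>B. ennreal (w x powr q * H x powr (- (d0 - d))) \<partial>M)
        \<le> ennreal (a * (t / (m * AA powr (1 / d))) powr (- (d0 - d)) * measure M B)"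
      "(\<integral>\<^sup>+x\<in>B. ennreal ((w x powr (- (q / d))) powr (d / d0) * H x powr (1 - d / d0)) \<partial>M)
        \<le> ennreal (2 * c powr (d / d0) * t powr (1 - d / d0) * measure M B)"
    proof (rule perturbed_averages[OF B, of "\<lambda>x. w x powr q" "\<lambda>x. w x powr (- (q / d))" H a c "m * AA powr (1 / d)" "d0 - d" "d / d0"])
      show "0 < w x powr q" "0 < w x powr (- (q / d))" for x using w[of x] by simp_all
      show "0 < m * AA powr (1 / d)" using m AA by simp
      show "0 \<le> d0 - d" "0 \<le> d / d0" "d / d0 \<le> 1" using dd d_pos d0 by simp_all
      show "0 < H x" for x by (rule H0)
      show "0 < a" "0 < c" by (rule ac)+
      show "(\<integral>\<^sup>+x\<in>B. ennreal (w x powr q) \<partial>M) \<le> ennreal (a * measure M B)"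
        "(\<integral>\<^sup>+x\<in>B. ennreal (w x powr (- (q / d))) \<partial>M) \<le> ennreal (c * measure M B)"
        by (simp_all only: ac order_refl)
      show "AE x in M. \<forall>B\<in>qballs M \<rho>. x \<in> B \<longrightarrow>
          (\<integral>\<^sup>+y\<in>B. ennreal (H y) \<partial>M) \<le> ennreal (m * AA powr (1 / d) * measure M B * H x)"
        by (rule H(3))
      fix t assume "0 < t"
        "(\<integral>\<^sup>+x\<in>B. ennreal (w x powr q * H x powr (- (d0 - d))) \<partial>M)
          \<le> ennreal (a * (t / (m * AA powr (1 / d))) powr (- (d0 - d)) * measure M B)"
        "(\<integral>\<^sup>+x\<in>B. ennreal ((w x powr (- (q / d))) powr (d / d0) * H x powr (1 - d / d0)) \<partial>M)
          \<le> ennreal (2 * c powr (d / d0) * t powr (1 - d / d0) * measure M B)"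
      then show thesis by (rule that)
    qed measurable
    show ?thesis
      using t ac lower_Apq_bound[OF lt ac(1,2) t(1) m AA ac(5)] m AA
      by (intro exI[of _ "a * (t / (m * AA powr (1 / d))) powr (- (d0 - d))"]
          exI[of _ "2 * c powr (d / d0) * t powr (1 - d / d0)"])
        (auto simp: w0 W0_def w0' Q_def k_def d0_def)
  qed
  note Apq = Apq_intro[OF p01 _ w0(1) this pos(4)]
  have in0: "in_Apq M \<rho> p0 q0 w0" and c0: "0 \<le> Apq_const M \<rho> p0 q0 w0" "Apq_const M \<rho> p0 q0 w0 \<le> Q"
    by (rule Apq, measurable)+
  define X where "X = (C * Q powr \<alpha> * (2 * \<Phi>) powr (1 / p0)) powr q0"
  have X0: "0 < X" using C Q \<Phi> by (simp add: X_def)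
  \<comment> \<open>Written over \<open>space M\<close> so that the geometric-mean lemma, stated for
    sets, applies to the whole space.\<close>
  have X: "(\<integral>\<^sup>+x\<in>space M. ennreal (G x powr q0 * W0 x) \<partial>M) \<le> ennreal X"
  proof -
    have "(\<integral>\<^sup>+x. ennreal (\<bar>f x\<bar> powr p0 * w0 x powr p0) \<partial>M) \<le> (\<integral>\<^sup>+x. ennreal (E x) \<partial>M)"
    proof (intro nn_integral_mono ennreal_leI)
      fix x
      show "\<bar>f x\<bar> powr p0 * w0 x powr p0 \<le> E x"
        unfolding w0_def W0_def by (rule lower_pointwise_f[OF lt' w E(1) _ E(2) h_def H(1)]) auto
    qed
    then have "(\<integral>\<^sup>+x. ennreal (\<bar>f x\<bar> powr p0 * w0 x powr p0) \<partial>M) \<le> ennreal (2 * \<Phi>)"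
      using intE by (rule order_trans)
    then have "(\<integral>\<^sup>+x. ennreal (G x powr q0 * w0 x powr q0) \<partial>M)
        \<le> ennreal ((C * Apq_const M \<rho> p0 q0 w0 powr \<alpha> * (2 * \<Phi>) powr (1 / p0)) powr q0)"
      using \<Phi>(1) by (intro hyp in0) auto
    also have "\<dots> \<le> ennreal X"
      unfolding X_def using c0 C pos \<alpha> by (intro ennreal_leI powr_mono2 mult_right_mono mult_left_mono) auto
    finally show ?thesis by (simp add: w0 cong: nn_integral_cong_simp)
  qed
  have Y: "(\<integral>\<^sup>+x\<in>space M. ennreal (H x powr (1 + d) * w x powr q) \<partial>M) \<le> ennreal (2 powr (d + 2) * (2 * \<Phi>))"
    using H(2) by (simp cong: nn_integral_cong_simp)
  have [measurable]: "W0 \<in> borel_measurable M" unfolding W0_def[abs_def] by measurable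
  have "(\<integral>\<^sup>+x. ennreal (G x powr q * w x powr q) \<partial>M)
      = (\<integral>\<^sup>+x\<in>space M. ennreal ((G x powr q0 * W0 x) powr (q / q0) * (H x powr (1 + d) * w x powr q) powr (1 - q / q0)) \<partial>M)"
    using lower_pointwise_G[OF w H0 G] by (intro nn_integral_cong) (auto simp: W0_def)
  also have "\<dots> \<le> ennreal (2 * X powr (q / q0) * (2 powr (d + 2) * (2 * \<Phi>)) powr (1 - q / q0))"
    using X Y X0 \<Phi> lt' pos W0 by (intro nn_integral_geometric_mean_le) (auto simp: less_imp_le)
  also have "2 * X powr (q / q0) * (2 powr (d + 2) * (2 * \<Phi>)) powr (1 - q / q0)
      = ((2 * (2 powr (d + 2)) powr (1 - q / q0)) powr (1 / q) * k powr \<alpha> * C * AA powr (\<alpha> * (d0 / d)) * (2 * \<Phi>) powr (1 / p)) powr q"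
    unfolding X_def Q_def using C k AA \<Phi> by (intro lower_final) auto
  also have "\<dots> = (lower_const \<alpha> * C * AA powr (\<alpha> * (d0 / d)) * \<Phi> powr (1 / p)) powr q"
    using \<Phi> by (simp add: lower_const_def k_def m_def powr_mult mult_ac)
  finally show ?thesis unfolding AA_def .
qed

text \<open>Finiteness of the left side is assumed because the majorant is built from it and
  \<open>upper_final\<close> absorbs it.\<close>

lemma extrapolate_above:
  fixes w f G :: "'a \<Rightarrow> real"
  assumes lt: "p0 < p" and \<alpha>: "0 < \<alpha>" and C: "0 < C" and w: "\<And>x. 0 < w x" and A: "in_Apq M \<rho> p q w"
    and [measurable]: "f \<in> borel_measurable M" "G \<in> borel_measurable M" and G: "\<And>x. 0 \<le> G x"
    and fin: "(\<integral>\<^sup>+x. ennreal (G x powr q * w x powr q) \<partial>M) < \<infinity>"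
    and \<Phi>: "0 < \<Phi>" "(\<integral>\<^sup>+x. ennreal (\<bar>f x\<bar> powr p * w x powr p) \<partial>M) \<le> ennreal \<Phi>"
    and hyp: "\<And>w0 \<Psi>. in_Apq M \<rho> p0 q0 w0 \<Longrightarrow> 0 < \<Psi> \<Longrightarrow>
      (\<integral>\<^sup>+x. ennreal (\<bar>f x\<bar> powr p0 * w0 x powr p0) \<partial>M) \<le> ennreal \<Psi> \<Longrightarrow>
      (\<integral>\<^sup>+x. ennreal (G x powr q0 * w0 x powr q0) \<partial>M)
        \<le> ennreal ((C * Apq_const M \<rho> p0 q0 w0 powr \<alpha> * \<Psi> powr (1 / p0)) powr q0)"
  shows "(\<integral>\<^sup>+x. ennreal (G x powr q * w x powr q) \<partial>M)
    \<le> ennreal ((upper_const \<alpha> * C * Apq_const M \<rho> p q w powr \<alpha> * \<Phi> powr (1 / p)) powr q)"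
proof (cases "(\<integral>\<^sup>+x. ennreal (G x powr q * w x powr q) \<partial>M) = 0")
  case False
  then obtain Y where Y: "(\<integral>\<^sup>+x. ennreal (G x powr q * w x powr q) \<partial>M) = ennreal Y" "0 < Y"
    using fin by (cases "\<integral>\<^sup>+x. ennreal (G x powr q * w x powr q) \<partial>M") (auto simp: order_less_le)
  have [measurable]: "w \<in> borel_measurable M" using A by (simp add: in_Apq_def weight_def)
  define AA where "AA = Apq_const M \<rho> p q w"
  have AA: "0 < AA" unfolding AA_def using p w A by (rule Apq_const_pos)
  have lt': "q0 < q" using lt q0_less_iff by simp
  have dd: "d0 < d"
  proof -
    have "0 < (q - q0) * l" using lt' l_pos by simp
    then show ?thesis using d_diff by (simp add: algebra_simps)
  qed
  have \<theta>: "0 \<le> d0 / d" "d0 / d \<le> 1" using dd d_pos d0_nonneg by auto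
  \<comment> \<open>The perturbation has the size of the unknown \<open>Y\<close>, so it costs only
    a factor 2 in the quantity to be absorbed.\<close>
  obtain \<phi> where [measurable]: "\<phi> \<in> borel_measurable M" and \<phi>: "\<And>x. 0 < \<phi> x" "(\<integral>\<^sup>+x. ennreal (\<phi> x) \<partial>M) \<le> ennreal Y"
    using positive_integrable_function[OF sigma_finite Y(2)] by blast
  define E where "E x = G x powr q * w x powr q + \<phi> x" for x
  have [measurable]: "E \<in> borel_measurable M" unfolding E_def[abs_def] by measurable
  have E: "0 < E x" "G x powr q * w x powr q \<le> E x" for x
    using \<phi>(1)[of x] by (auto simp: E_def add_nonneg_pos less_imp_le)
  have intE: "(\<integral>\<^sup>+x. ennreal (E x) \<partial>M) \<le> ennreal (2 * Y)"
  proof -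
    have "(\<integral>\<^sup>+x. ennreal (E x) \<partial>M) = (\<integral>\<^sup>+x. ennreal (G x powr q * w x powr q) \<partial>M) + (\<integral>\<^sup>+x. ennreal (\<phi> x) \<partial>M)"
      unfolding E_def using \<phi>(1) by (subst nn_integral_add[symmetric]) (auto simp: less_imp_le intro!: nn_integral_cong ennreal_plus)
    also have "\<dots> \<le> ennreal Y + ennreal Y" unfolding Y(1) using \<phi>(2) by (rule add_left_mono)
    finally show ?thesis using Y(2) by (simp add: ennreal_plus[symmetric] del: ennreal_plus)
  qed
  define v where "v x = (E x / w x powr (- (q / d))) powr (1 / (1 + 1 / d))" for x
  have [measurable]: "v \<in> borel_measurable M" unfolding v_def[abs_def] by measurable
  have v0: "0 < v x" for x using E(1)[of x] w[of x] by (simp add: v_def)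
  have vE: "v x powr (1 + 1 / d) * w x powr (- (q / d)) = E x" for x
  proof -
    have "1 / (1 + 1 / d) * (1 + 1 / d) = 1" using d_pos by (simp add: add_pos_pos less_imp_neq[THEN not_sym])
    then have "v x powr (1 + 1 / d) = E x / w x powr (- (q / d))"
      unfolding v_def powr_powr using E(1)[of x] w[of x] by simp
    then show ?thesis using w[of x] by simp
  qed
  define m where "m = majorant_const (1 / d)"
  have m: "0 < m" unfolding m_def using d_pos by (intro majorant_const_pos) simp
  \<comment> \<open>Buckley's exponent for the dual weight is \<open>d\<close>, which undoes the
    root in its constant \<open>AA powr (1 / d)\<close>.\<close>
  have AAd: "(AA powr (1 / d)) powr (1 / (1 / d)) = AA" using AA d_pos by (simp add: powr_powr)
  obtain V :: "'a \<Rightarrow> real" where [measurable]: "V \<in> borel_measurable M" and V: "\<And>x. v x \<le> V x"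
    "(\<integral>\<^sup>+x. ennreal (V x powr (1 + 1 / d) * w x powr (- (q / d))) \<partial>M) \<le> ennreal (2 powr (1 / d + 2) * (2 * Y))"
    "AE x in M. \<forall>B\<in>qballs M \<rho>. x \<in> B \<longrightarrow>
      (\<integral>\<^sup>+y\<in>B. ennreal (V y) \<partial>M) \<le> ennreal (m * AA * measure M B * V x)"
  proof (rule A1_majorant[of "\<lambda>x. w x powr (- (q / d))" v "\<lambda>x. w x powr q" "1 / d" "AA powr (1 / d)" "2 * Y"])
    show "\<exists>a c. 0 < a \<and> 0 < c \<and> (\<integral>\<^sup>+x\<in>B. ennreal (w x powr (- (q / d))) \<partial>M) = ennreal (a * measure M B) \<and>
        (\<integral>\<^sup>+x\<in>B. ennreal (w x powr q) \<partial>M) = ennreal (c * measure M B) \<and> a * c powr (1 / d) \<le> AA powr (1 / d)"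
      if B: "B \<in> qballs M \<rho>" for B
    proof -
      obtain a c where ac: "0 < a" "0 < c"
        "(\<integral>\<^sup>+x\<in>B. ennreal (w x powr q) \<partial>M) = ennreal (a * measure M B)"
        "(\<integral>\<^sup>+x\<in>B. ennreal (w x powr (- (q / d))) \<partial>M) = ennreal (c * measure M B)"
        "a * c powr d \<le> AA"
        using weight_averages[OF w A B] unfolding AA_def by blast
      \<comment> \<open>Interchanging a weight and its dual raises the product of averages to the
        power \<open>1 / d\<close>.\<close>
      have "c * a powr (1 / d) = (a * c powr d) powr (1 / d)"
        using ac d_pos by (simp add: powr_mult powr_powr)
      also have "\<dots> \<le> AA powr (1 / d)" using ac d_pos by (intro powr_mono2) auto
      finally show ?thesis using ac by blast
    qed
    show "(\<integral>\<^sup>+x. ennreal (v x powr (1 + 1 / d) * w x powr (- (q / d))) \<partial>M) \<le> ennreal (2 * Y)" using intE by (simp only: vE)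
    show "w x powr q = (w x powr (- (q / d))) powr (- 1 / (1 / d))" for x using d_pos by (simp add: powr_powr)
  qed (use w v0 d_pos AA in \<open>auto simp: m_def AAd[simplified] less_imp_neq[THEN not_sym]\<close>)
  have V0: "0 < V x" for x using v0[of x] V(1)[of x] by linarith
  define W0 where "W0 x = (w x powr q) powr (d0 / d) * V x powr (1 - d0 / d)" for x
  have [measurable]: "W0 \<in> borel_measurable M" unfolding W0_def[abs_def] by measurable
  have W0: "0 < W0 x" for x using w[of x] V0[of x] by (simp add: W0_def)
  define w0 where "w0 x = W0 x powr (1 / q0)" for x
  have [measurable]: "w0 \<in> borel_measurable M" unfolding w0_def[abs_def] by measurable
  have w0: "0 < w0 x" "w0 x powr q0 = W0 x" for x using W0[of x] pos by (auto simp: w0_def powr_powr)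
  define Q where "Q = (2 * m powr (1 - d0 / d)) * AA"
  have Q: "0 < Q" using m AA by (simp add: Q_def)
  have Apq: "in_Apq M \<rho> p0 q0 w0 \<and> 0 \<le> Apq_const M \<rho> p0 q0 w0 \<and> Apq_const M \<rho> p0 q0 w0 \<le> Q"
  proof (cases "p0 = 1")
    \<comment> \<open>For \<open>p0 = 1\<close> the exponent of the old weight vanishes and
      \<open>W0\<close> is \<open>V\<close> itself, whose \<open>A_1\<close> property is the
      required condition.\<close>
    case True
    then have d00: "d0 = 0" by (rule d0_eq_0)
    have *: "AE x in M. \<forall>B\<in>qballs M \<rho>. x \<in> B \<longrightarrow>
      (\<integral>\<^sup>+y\<in>B. ennreal (w0 y powr q0) \<partial>M) \<le> ennreal (m * AA * measure M B * w0 x powr q0)"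
      using V(3) w V0 by (simp add: w0 W0_def d00 less_imp_le less_imp_neq[THEN not_sym])
    note A1 = A1q_intro[OF _ w0(1) _ *]
    have "in_Apq M \<rho> 1 q0 w0" "0 \<le> Apq_const M \<rho> 1 q0 w0" "Apq_const M \<rho> 1 q0 w0 \<le> m * AA"
      using m AA by (auto intro!: A1)
    moreover have "m * AA \<le> Q" using m AA by (simp add: Q_def d00)
    ultimately show ?thesis unfolding True by linarith
  next
    case False
    then have p01: "1 < p0" using p0 by simp
    have d0: "0 < d0" using p01 by (rule d0_pos)
    have w0': "w0 x powr (- (p0 / (p0 - 1))) = w x powr (- (q / d)) * V x powr (- ((1 - d0 / d) / d0))" for x
    proof (rule eq_if_ln_eq)
      have "ln (w0 x powr (- (p0 / (p0 - 1)))) = - (q0 / d0) * (1 / q0 * (d0 / d * (q * ln (w x)) + (1 - d0 / d) * ln (V x)))"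
        using w[of x] V0[of x] by (simp add: w0_def W0_def conj0[OF p01] ln_mult)
      also have "\<dots> = - (q / d) * ln (w x) + - ((1 - d0 / d) / d0) * ln (V x)"
        using pos d_pos d0 by (simp add: divide_simps)
      finally show "ln (w0 x powr (- (p0 / (p0 - 1)))) = ln (w x powr (- (q / d)) * V x powr (- ((1 - d0 / d) / d0)))"
        using w[of x] V0[of x] by (simp add: ln_mult)
    qed (use w[of x] V0[of x] w0[of x] in auto)
    have "\<exists>a c. 0 \<le> a \<and> 0 \<le> c \<and>
        (\<integral>\<^sup>+x\<in>B. ennreal (w0 x powr q0) \<partial>M) \<le> ennreal (a * measure M B) \<and>
        (\<integral>\<^sup>+x\<in>B. ennreal (w0 x powr (- (p0 / (p0 - 1)))) \<partial>M) \<le> ennreal (c * measure M B) \<and>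
        a * c powr (q0 * inv_dual p0) \<le> Q" if B: "B \<in> qballs M \<rho>" for B
    proof -
      obtain a c where ac: "0 < a" "0 < c"
        "(\<integral>\<^sup>+x\<in>B. ennreal (w x powr q) \<partial>M) = ennreal (a * measure M B)"
        "(\<integral>\<^sup>+x\<in>B. ennreal (w x powr (- (q / d))) \<partial>M) = ennreal (c * measure M B)"
        "a * c powr d \<le> AA"
        using weight_averages[OF w A B] unfolding AA_def by blast
      obtain t where t: "0 < t"
        "(\<integral>\<^sup>+x\<in>B. ennreal (w x powr (- (q / d)) * V x powr (- ((1 - d0 / d) / d0))) \<partial>M)
          \<le> ennreal (c * (t / (m * AA)) powr (- ((1 - d0 / d) / d0)) * measure M B)"
        "(\<integral>\<^sup>+x\<in>B. ennreal ((w x powr q) powr (d0 / d) * V x powr (1 - d0 / d)) \<partial>M)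
          \<le> ennreal (2 * a powr (d0 / d) * t powr (1 - d0 / d) * measure M B)"
      proof (rule perturbed_averages[OF B, of "\<lambda>x. w x powr (- (q / d))" "\<lambda>x. w x powr q" V c a "m * AA" "(1 - d0 / d) / d0" "d0 / d"])
        show "0 < w x powr q" "0 < w x powr (- (q / d))" for x using w[of x] by simp_all
        show "0 < m * AA" using m AA by simp
        show "0 \<le> (1 - d0 / d) / d0" using \<theta> d0 by simp
        show "0 \<le> d0 / d" "d0 / d \<le> 1" by (rule \<theta>)+
        show "0 < V x" for x by (rule V0)
        show "0 < a" "0 < c" by (rule ac)+
        show "(\<integral>\<^sup>+x\<in>B. ennreal (w x powr q) \<partial>M) \<le> ennreal (a * measure M B)"
          "(\<integral>\<^sup>+x\<in>B. ennreal (w x powr (- (q / d))) \<partial>M) \<le> ennreal (c * measure M B)"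
          by (simp_all only: ac order_refl)
        show "AE x in M. \<forall>B\<in>qballs M \<rho>. x \<in> B \<longrightarrow>
            (\<integral>\<^sup>+y\<in>B. ennreal (V y) \<partial>M) \<le> ennreal (m * AA * measure M B * V x)"
          by (rule V(3))
        fix t assume "0 < t"
          "(\<integral>\<^sup>+x\<in>B. ennreal (w x powr (- (q / d)) * V x powr (- ((1 - d0 / d) / d0))) \<partial>M)
            \<le> ennreal (c * (t / (m * AA)) powr (- ((1 - d0 / d) / d0)) * measure M B)"
          "(\<integral>\<^sup>+x\<in>B. ennreal ((w x powr q) powr (d0 / d) * V x powr (1 - d0 / d)) \<partial>M)
            \<le> ennreal (2 * a powr (d0 / d) * t powr (1 - d0 / d) * measure M B)"
        then show thesis by (rule that)
      qed measurable
      show ?thesis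
        using t ac upper_Apq_bound[OF lt p01 ac(1,2) t(1) m AA ac(5)] m AA
        by (intro exI[of _ "2 * a powr (d0 / d) * t powr (1 - d0 / d)"]
            exI[of _ "c * (t / (m * AA)) powr (- ((1 - d0 / d) / d0))"])
          (auto simp: w0 W0_def w0' Q_def d0_def)
    qed
    note Apq = Apq_intro[OF p01 _ w0(1) this pos(4)]
    show ?thesis by (intro conjI; rule Apq) measurable
  qed
  define K where "K = 2 powr (1 / d + 2) * 2"
  have K: "0 < K" by (simp add: K_def)
  define \<Psi> where "\<Psi> = 2 * \<Phi> powr (p0 / p) * (K * Y) powr (1 - p0 / p)"
  have \<Psi>0: "0 < \<Psi>" using \<Phi> K Y by (simp add: \<Psi>_def)
  have "(\<integral>\<^sup>+x. ennreal (\<bar>f x\<bar> powr p0 * w0 x powr p0) \<partial>M)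
      = (\<integral>\<^sup>+x\<in>space M. ennreal ((\<bar>f x\<bar> powr p * w x powr p) powr (p0 / p) * (V x powr (1 + 1 / d) * w x powr (- (q / d))) powr (1 - p0 / p)) \<partial>M)"
    using upper_pointwise_f[OF w V0] by (intro nn_integral_cong) (auto simp: w0_def W0_def)
  also have "\<dots> \<le> ennreal \<Psi>"
    unfolding \<Psi>_def using \<Phi> V(2) K Y lt pos
    by (intro nn_integral_geometric_mean_le) (auto simp: K_def mult.assoc cong: nn_integral_cong_simp)
  finally have f0: "(\<integral>\<^sup>+x. ennreal (\<bar>f x\<bar> powr p0 * w0 x powr p0) \<partial>M) \<le> ennreal \<Psi>" .
  have "ennreal Y \<le> (\<integral>\<^sup>+x. ennreal (G x powr q0 * w0 x powr q0) \<partial>M)"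
    unfolding Y(1)[symmetric] w0
    using upper_pointwise_G[OF lt' w E(1) G E(2) v_def V(1)] by (intro nn_integral_mono ennreal_leI) (auto simp: W0_def)
  also have "\<dots> \<le> ennreal ((C * Apq_const M \<rho> p0 q0 w0 powr \<alpha> * \<Psi> powr (1 / p0)) powr q0)"
    using Apq \<Psi>0 f0 by (intro hyp) auto
  also have "\<dots> \<le> ennreal ((C * Q powr \<alpha> * \<Psi> powr (1 / p0)) powr q0)"
    using Apq C pos \<alpha> by (intro ennreal_leI powr_mono2 mult_right_mono mult_left_mono) auto
  finally have "Y \<le> (C * Q powr \<alpha> * \<Psi> powr (1 / p0)) powr q0" by simp
  then have "Y \<le> ((2 * K powr (1 - p0 / p)) powr (1 / p0) * Q powr \<alpha> * C * \<Phi> powr (1 / p)) powr q"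
    unfolding \<Psi>_def using C Q K \<Phi> Y by (intro upper_final) auto
  also have "\<dots> = (upper_const \<alpha> * C * AA powr \<alpha> * \<Phi> powr (1 / p)) powr q"
    using AA by (simp add: upper_const_def K_def Q_def m_def powr_mult mult_ac)
  finally show ?thesis unfolding Y(1) AA_def by (rule ennreal_leI)
qed simp

section \<open>From measurable minorants to norms of arbitrary functions\<close>

definition extrapolation_const :: "real \<Rightarrow> real" where
  "extrapolation_const \<alpha> = (if p < p0 then lower_const \<alpha> else if p0 < p then upper_const \<alpha> else 1)"

lemma extrapolation_const_pos: "0 < extrapolation_const \<alpha>"
proof -
  have "0 < majorant_const d" "0 < majorant_const (1 / d)"
    using d_pos by (auto intro: majorant_const_pos)
  then show ?thesis
    by (simp add: extrapolation_const_def lower_const_def upper_const_def)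
qed

lemma extrapolate_integral:
  fixes w f F :: "'a \<Rightarrow> real"
  assumes ne: "p \<noteq> p0" and \<alpha>: "0 < \<alpha>" and C: "0 < C" and w: "\<And>x. 0 < w x" and A: "in_Apq M \<rho> p q w"
    and [measurable]: "f \<in> borel_measurable M"
    and \<Phi>: "0 < \<Phi>" "(\<integral>\<^sup>+x. ennreal (\<bar>f x\<bar> powr p * w x powr p) \<partial>M) \<le> ennreal \<Phi>"
    and hyp: "\<And>w0. in_Apq M \<rho> p0 q0 w0 \<Longrightarrow>
      Lp_norm M q0 (\<lambda>x. w0 x powr q0) F \<le> ennreal (C * Apq_const M \<rho> p0 q0 w0 powr \<alpha>) * Lp_norm M p0 (\<lambda>x. w0 x powr p0) f"
  shows "(\<integral>\<^sup>+x. ennreal (\<bar>F x\<bar> powr q * w x powr q) \<partial>M)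
    \<le> ennreal ((extrapolation_const \<alpha> * C * Apq_const M \<rho> p q w powr (\<alpha> * max 1 (d0 / d)) * \<Phi> powr (1 / p)) powr q)"
    (is "_ \<le> ?R")
proof (rule nn_integral_le_by_minorants[OF sigma_finite])
  fix u :: "'a \<Rightarrow> real"
  assume [measurable]: "u \<in> borel_measurable M" and u: "\<And>x. 0 \<le> u x"
    and uF: "\<And>x. ennreal (u x) \<le> ennreal (\<bar>F x\<bar> powr q * w x powr q)"
    and fin: "(\<integral>\<^sup>+x. ennreal (u x) \<partial>M) < \<infinity>"
  have [measurable]: "w \<in> borel_measurable M" using A by (simp add: in_Apq_def weight_def)
  \<comment> \<open>Normalised so that G^q w^q is the minorant \<open>u\<close>. Then G is at most
    |F| and inherits the hypothesis, while the finite integral of \<open>u\<close> supplies the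
    finiteness needed above \<open>p0\<close>.\<close>
  define G where "G x = u x powr (1 / q) / w x" for x
  have [measurable]: "G \<in> borel_measurable M" unfolding G_def[abs_def] by measurable
  have G0: "0 \<le> G x" for x using w[of x] by (simp add: G_def)
  have Gu: "G x powr q * w x powr q = u x" for x
    using w[of x] u[of x] pos by (simp add: G_def powr_divide powr_powr)
  have GF: "G x \<le> \<bar>F x\<bar>" for x
  proof -
    have "u x \<le> (\<bar>F x\<bar> * w x) powr q"
      using uF[of x] w[of x] u[of x] by (simp add: powr_mult)
    then have "u x powr (1 / q) \<le> ((\<bar>F x\<bar> * w x) powr q) powr (1 / q)"
      using u[of x] pos by (intro powr_mono2) auto
    also have "\<dots> = \<bar>F x\<bar> * w x" using pos w[of x] by (simp add: powr_powr)
    finally show ?thesis using w[of x] by (simp add: G_def field_simps)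
  qed
  have hypG: "(\<integral>\<^sup>+x. ennreal (G x powr q0 * w0 x powr q0) \<partial>M)
        \<le> ennreal ((C * Apq_const M \<rho> p0 q0 w0 powr \<alpha> * \<Psi> powr (1 / p0)) powr q0)"
    if w0: "in_Apq M \<rho> p0 q0 w0" and \<Psi>: "0 < \<Psi>" "(\<integral>\<^sup>+x. ennreal (\<bar>f x\<bar> powr p0 * w0 x powr p0) \<partial>M) \<le> ennreal \<Psi>"
    for w0 \<Psi>
  proof -
    let ?c = "C * Apq_const M \<rho> p0 q0 w0 powr \<alpha>"
    have c: "0 \<le> ?c" using C by simp
    have "(\<integral>\<^sup>+x. ennreal (G x powr q0 * w0 x powr q0) \<partial>M) \<le> (\<integral>\<^sup>+x. ennreal (\<bar>F x\<bar> powr q0 * w0 x powr q0) \<partial>M)"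
      using GF G0 pos by (intro nn_integral_mono ennreal_leI mult_right_mono powr_mono2) auto
    also have "\<dots> = ennpow (Lp_norm M q0 (\<lambda>x. w0 x powr q0) F) q0"
      using pos by (simp add: Lp_norm_def ennpow_ennpow)
    also have "\<dots> \<le> ennpow (ennreal ?c * Lp_norm M p0 (\<lambda>x. w0 x powr p0) f) q0"
      using hyp[OF w0] pos by (intro ennpow_mono) auto
    also have "\<dots> \<le> ennpow (ennreal ?c * ennpow (ennreal \<Psi>) (1 / p0)) q0"
      unfolding Lp_norm_def using \<Psi> pos by (intro ennpow_mono mult_left_mono) auto
    also have "\<dots> = ennreal ((?c * \<Psi> powr (1 / p0)) powr q0)"
      using \<Psi>(1) c by (simp add: ennpow_ennreal ennreal_mult'[symmetric])
    finally show ?thesis .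
  qed
  consider "p < p0" | "p0 < p" using ne by linarith
  then have "(\<integral>\<^sup>+x. ennreal (G x powr q * w x powr q) \<partial>M) \<le> ?R"
  proof cases
    case 1
    then have "d < d0" using d_diff l_pos q_less_iff by (smt (verit) mult_pos_pos)
    then have "max 1 (d0 / d) = d0 / d" using d_pos by simp
    moreover have "extrapolation_const \<alpha> = lower_const \<alpha>" using 1 by (simp add: extrapolation_const_def)
    ultimately show ?thesis
      using extrapolate_below[OF 1 \<alpha> C w A _ _ G0 \<Phi> hypG] by simp
  next
    case 2
    then have "d0 < d" using d_diff l_pos q0_less_iff by (smt (verit) mult_neg_pos)
    then have "max 1 (d0 / d) = 1" using d_pos by simp
    moreover have "extrapolation_const \<alpha> = upper_const \<alpha>" using 2 by (simp add: extrapolation_const_def)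
    ultimately show ?thesis
      using extrapolate_above[OF 2 \<alpha> C w A _ _ G0 _ \<Phi> hypG] fin by (simp add: Gu)
  qed
  then show "(\<integral>\<^sup>+x. ennreal (u x) \<partial>M) \<le> ?R" by (simp add: Gu)
qed

text \<open>The integral estimate needs a finite positive bound for the norm of \<open>f\<close>. An
  infinite norm is trivial, and a zero norm is reached through arbitrarily small bounds.\<close>

lemma extrapolate_norm:
  fixes w f F :: "'a \<Rightarrow> real"
  assumes ne: "p \<noteq> p0" and \<alpha>: "0 < \<alpha>" and C: "0 < C" and w: "\<And>x. 0 < w x" and A: "in_Apq M \<rho> p q w"
    and f: "f \<in> borel_measurable M"
    and hyp: "\<And>w0. in_Apq M \<rho> p0 q0 w0 \<Longrightarrow>
      Lp_norm M q0 (\<lambda>x. w0 x powr q0) F \<le> ennreal (C * Apq_const M \<rho> p0 q0 w0 powr \<alpha>) * Lp_norm M p0 (\<lambda>x. w0 x powr p0) f"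
  shows "Lp_norm M q (\<lambda>x. w x powr q) F
    \<le> ennreal (extrapolation_const \<alpha> * C * Apq_const M \<rho> p q w powr (\<alpha> * max 1 (d0 / d))) * Lp_norm M p (\<lambda>x. w x powr p) f"
proof -
  let ?X = "\<integral>\<^sup>+x. ennreal (\<bar>f x\<bar> powr p * w x powr p) \<partial>M"
  define K where "K = extrapolation_const \<alpha> * C * Apq_const M \<rho> p q w powr (\<alpha> * max 1 (d0 / d))"
  have K: "0 < K"
    using C extrapolation_const_pos[of \<alpha>] Apq_const_pos[OF p w A] by (simp add: K_def)
  have le: "Lp_norm M q (\<lambda>x. w x powr q) F \<le> ennreal (K * \<Phi> powr (1 / p))" if \<Phi>: "0 < \<Phi>" "?X \<le> ennreal \<Phi>" for \<Phi>
  proof -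
    have "Lp_norm M q (\<lambda>x. w x powr q) F \<le> ennpow (ennreal ((K * \<Phi> powr (1 / p)) powr q)) (1 / q)"
      unfolding Lp_norm_def K_def
      using pos extrapolate_integral[OF ne \<alpha> C w A f \<Phi> hyp] by (intro ennpow_mono) auto
    also have "\<dots> = ennreal (K * \<Phi> powr (1 / p))"
      using pos K \<Phi> by (simp add: ennpow_ennreal powr_powr)
    finally show ?thesis .
  qed
  consider "?X = \<infinity>" | "?X = 0" | x where "?X = ennreal x" "0 < x"
    by (cases ?X) (auto simp: order_less_le)
  then have "Lp_norm M q (\<lambda>x. w x powr q) F \<le> ennreal K * ennpow ?X (1 / p)"
  proof cases
    case 1
    then show ?thesis using K by (simp add: ennreal_mult_top)
  next
    case 2
    have "Lp_norm M q (\<lambda>x. w x powr q) F \<le> 0 + ennreal \<epsilon>" if \<epsilon>: "0 < \<epsilon>" for \<epsilon>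
    proof -
      have "K * ((\<epsilon> / K) powr p) powr (1 / p) = \<epsilon>" using \<epsilon> K pos by (simp add: powr_powr)
      then show ?thesis using le[of "(\<epsilon> / K) powr p"] 2 \<epsilon> K by simp
    qed
    then have "Lp_norm M q (\<lambda>x. w x powr q) F \<le> 0" by (rule ennreal_le_epsilon)
    then show ?thesis by simp
  next
    case 3
    then show ?thesis using le[of x] K by (simp add: ennpow_ennreal ennreal_mult'[symmetric])
  qed
  then show ?thesis by (simp add: Lp_norm_def K_def)
qed

text \<open>Two normalisations are undone: \<open>C\<close> is made positive by
  \<open>max C 1\<close>, and the weight is made positive everywhere. If \<open>p = p0\<close>, then
  \<open>gap\<close> forces \<open>q = q0\<close> and the hypothesis is the claim.\<close>

lemma extrapolate_norm_weight:
  fixes w f F :: "'a \<Rightarrow> real"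
  assumes \<alpha>: "0 < \<alpha>" and A: "in_Apq M \<rho> p q w" and f: "f \<in> borel_measurable M"
    and hyp: "\<And>w0. in_Apq M \<rho> p0 q0 w0 \<Longrightarrow>
      Lp_norm M q0 (\<lambda>x. w0 x powr q0) F \<le> ennreal (C * Apq_const M \<rho> p0 q0 w0 powr \<alpha>) * Lp_norm M p0 (\<lambda>x. w0 x powr p0) f"
  shows "Lp_norm M q (\<lambda>x. w x powr q) F
    \<le> ennreal (extrapolation_const \<alpha> * max C 1 * Apq_const M \<rho> p q w powr (\<alpha> * max 1 (d0 / d))) * Lp_norm M p (\<lambda>x. w x powr p) f"
proof -
  have hyp': "Lp_norm M q0 (\<lambda>x. w0 x powr q0) F \<le> ennreal (max C 1 * Apq_const M \<rho> p0 q0 w0 powr \<alpha>) * Lp_norm M p0 (\<lambda>x. w0 x powr p0) f"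
    if "in_Apq M \<rho> p0 q0 w0" for w0
    using hyp[OF that] by (rule order_trans) (intro mult_right_mono ennreal_leI, auto)
  show ?thesis
  proof (cases "p = p0")
    case True
    then have "q = q0" using gap pos by simp
    then have "max 1 (d0 / d) = 1" using d_eq d0_eq d_pos by simp
    moreover have "extrapolation_const \<alpha> = 1" unfolding extrapolation_const_def using True by simp
    ultimately show ?thesis using hyp'[of w] A True \<open>q = q0\<close> by simp
  next
    case False
    define w' where "w' x = (if 0 < w x then w x else 1)" for x
    have wm [measurable]: "w \<in> borel_measurable M" and ae: "AE x in M. 0 < w x"
      using A by (auto simp: in_Apq_def weight_def)
    have [measurable]: "w' \<in> borel_measurable M" unfolding w'_def[abs_def] by measurable
    have eq: "AE x in M. w x = w' x" using ae by eventually_elim (simp add: w'_def)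
    have p1: "p \<noteq> 1" using p by simp
    note cong = Apq_cong_AE[OF p1 wm _ eq, of q]
    have "Lp_norm M q (\<lambda>x. w' x powr q) F
      \<le> ennreal (extrapolation_const \<alpha> * max C 1 * Apq_const M \<rho> p q w' powr (\<alpha> * max 1 (d0 / d))) * Lp_norm M p (\<lambda>x. w' x powr p) f"
      using False \<alpha> f hyp' A cong(1) by (intro extrapolate_norm) (auto simp: w'_def)
    moreover have "Lp_norm M q (\<lambda>x. w x powr q) F = Lp_norm M q (\<lambda>x. w' x powr q) F"
      "Lp_norm M p (\<lambda>x. w x powr p) f = Lp_norm M p (\<lambda>x. w' x powr p) f"
      using eq by (auto intro!: Lp_norm_cong_AE elim!: eventually_mono)
    ultimately show ?thesis using cong(2) by simp
  qed
qed

end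

theorem theorem7p1:
  fixes M :: "'a measure" and \<rho> :: "'a \<Rightarrow> 'a \<Rightarrow> real" and A0 C\<mu> :: real
    and p0 q0 p q \<alpha> C :: real
  assumes "homogeneous_type M \<rho> A0 C\<mu>"
    and "1 \<le> p0" and "p0 \<le> q0" and "0 < \<alpha>"
    and "1 < p" and "p \<le> q" and "1 / p - 1 / q = 1 / p0 - 1 / q0"
  shows "\<exists>C'. \<forall>T :: ('a \<Rightarrow> real) \<Rightarrow> ('a \<Rightarrow> real).
     (\<forall>w. in_Apq M \<rho> p0 q0 w \<longrightarrow> (\<forall>f. bdd_bdd_supp M \<rho> f \<longrightarrow>
        Lp_norm M q0 (\<lambda>x. w x powr q0) (T f)
          \<le> ennreal (C * Apq_const M \<rho> p0 q0 w powr \<alpha>) * Lp_norm M p0 (\<lambda>x. w x powr p0) f))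
     \<longrightarrow>
     (\<forall>w. in_Apq M \<rho> p q w \<longrightarrow> (\<forall>f. bdd_bdd_supp M \<rho> f \<longrightarrow>
        Lp_norm M q (\<lambda>x. w x powr q) (T f)
          \<le> ennreal (C' * Apq_const M \<rho> p q w powr
                 (\<alpha> * max 1 (q0 * inv_dual p0 / (q * inv_dual p))))
            * Lp_norm M p (\<lambda>x. w x powr p) f))"
proof -
  interpret homogeneous_space M \<rho> A0 C\<mu> using assms(1) by unfold_locales
  obtain ctr :: "nat \<Rightarrow> 'a" and s D where *: "1 \<le> D" "\<And>n. ctr n \<in> space M" "\<And>n. 0 < s n"
    "\<And>x r. x \<in> space M \<Longrightarrow> 0 < r \<Longrightarrow> measure M (qb x (3 * A0\<^sup>2 * r)) \<le> D * measure M (qb x r)"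
    "\<And>x r. x \<in> space M \<Longrightarrow> 0 < r \<Longrightarrow>
      \<exists>n. qb x r \<subseteq> qb (ctr n) (s n) \<and> measure M (qb (ctr n) (s n)) \<le> D * measure M (qb x r)"
    by (rule comparable_ball_sequence) blast
  interpret extrapolation M \<rho> A0 C\<mu> ctr s D p0 q0 p q "q0 * inv_dual p0" "q * inv_dual p" "1 - (1 / p - 1 / q)"
    by unfold_locales (use * assms in auto)
  show ?thesis
  \<comment> \<open>The witness is formed before \<open>T\<close>, \<open>w\<close> and
    \<open>f\<close> are introduced, from the space, the exponents, \<alpha> and \<open>C\<close>
    only.\<close>
  proof (rule exI[of _ "extrapolation_const \<alpha> * max C 1"], intro allI impI)
    fix T :: "('a \<Rightarrow> real) \<Rightarrow> ('a \<Rightarrow> real)" and w f :: "'a \<Rightarrow> real"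
    assume T: "\<forall>w. in_Apq M \<rho> p0 q0 w \<longrightarrow> (\<forall>f. bdd_bdd_supp M \<rho> f \<longrightarrow>
        Lp_norm M q0 (\<lambda>x. w x powr q0) (T f)
          \<le> ennreal (C * Apq_const M \<rho> p0 q0 w powr \<alpha>) * Lp_norm M p0 (\<lambda>x. w x powr p0) f)"
      and w: "in_Apq M \<rho> p q w" and f: "bdd_bdd_supp M \<rho> f"
    have fm: "f \<in> borel_measurable M" using f by (simp add: bdd_bdd_supp_def)
    have hyp: "Lp_norm M q0 (\<lambda>x. w0 x powr q0) (T f)
        \<le> ennreal (C * Apq_const M \<rho> p0 q0 w0 powr \<alpha>) * Lp_norm M p0 (\<lambda>x. w0 x powr p0) f"
      if "in_Apq M \<rho> p0 q0 w0" for w0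
      using T[rule_format, OF that f] .
    show "Lp_norm M q (\<lambda>x. w x powr q) (T f)
        \<le> ennreal (extrapolation_const \<alpha> * max C 1 * Apq_const M \<rho> p q w powr
              (\<alpha> * max 1 (q0 * inv_dual p0 / (q * inv_dual p))))
          * Lp_norm M p (\<lambda>x. w x powr p) f"
      by (rule extrapolate_norm_weight[where F = "T f", OF assms(4) w fm hyp])
  qed
qed

end
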